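(* Let $T$ be an NIP theory expanding a group, $\mathcal{G}$ a monster model of $T$, and $G\prec\mathcal{G}$ a small model. Let $\nu \in \mathfrak{M}_{x}(\mathcal{G},G)$. Then the map $-*\nu:\mathfrak{M}_{x}(\mathcal{G},G) \to \mathfrak{M}_{x}(\mathcal{G},G)$, $\mu\mapsto\mu*\nu$, is continuous.
   Context: Setting: $T$ is in a language $\mathcal{L}$; $x$ (and $y$ in convolutions) is a singleton variable of the sort on which the group is defined. Keisler measures: for $A\subseteq\mathcal{G}$, $\mathcal{L}_x(A)$ is the Boolean algebra of formulas in $x$ with parameters from $A$ (up to equivalence), $S_x(A)$ is the space of types over $A$, and $\mathfrak{M}_x(A)$ is the set of Keisler measures over $A$, i.e. finitely additive probability measures on $\mathcal{L}_x(A)$, with the topology induced from $[0,1]^{\mathcal{L}_x(A)}$; each is identified with the corresponding regular Borel probability measure on $S_x(A)$. $\mu|_A$ denotes restriction. The support of $\mu\in\mathfrak{M}_x(A)$ is $S(\mu)=\{p\in S_x(A):\mu(\varphi(x))>0 \text{ for all }\varphi(x)\in p\}$. $\mathfrak{M}_x(\mathcal{G},G)$ is the closed set of $\mu\in\mathfrak{M}_x(\mathcal{G})$ finitely satisfiable in $G$: whenever $\mu(\varphi(x))>0$ for $\varphi(x)\in\mathcal{L}_x(\mathcal{G})$, there is $a\in G$ with $\mathcal{G}\models\varphi(a)$. Convolution: for $\mu,\nu\in\mathfrak{M}_x(\mathcal{G})$ let $\nu_y$ be $\nu$ viewed as a measure in the variable $y$. The pair $(\mu,\nu)$ is $*$-Borel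 if for every $\varphi(x,\bar c)\in\mathcal{L}_x(\mathcal{G})$ there is a small $N\prec\mathcal{G}$ containing $\bar c$ such that for every $q\in S(\nu_y|_N)$ the value $F(q):=\mu(\varphi(x\cdot d,\bar c))$ is the same for all $d\models q$ in $\mathcal{G}$, and $F:S(\nu_y|_N)\to[0,1]$ is Borel. Then $(\mu*\nu)(\varphi(x,\bar c)):=\int_{S(\nu_y|_N)}F\,d\nu_N$, where $\nu_N$ is the Borel measure $\nu_y|_N$ restricted to its support (this does not depend on $N$). Under NIP, $*$ is defined on all pairs from $\mathfrak{M}_x(\mathcal{G},G)$ and takes values in $\mathfrak{M}_x(\mathcal{G},G)$. *)

theory Defs
  imports "HOL-Probability.Probability" "HOL-Algebra.Group"
begin

unbundle cardinal_syntax

section \<open>Many-sorted first-order logic\<close>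

text \<open>
  \<open>'s\<close> is the type of sorts. A language assigns an arity to those elements of \<open>'f\<close> and \<open>'r\<close>
  that are among its function and relation symbols (\<open>None\<close>: not a symbol of the language).
\<close>

record ('s, 'f, 'r) lang =
  fun_sig :: "'f \<Rightarrow> ('s list \<times> 's) option"
  rel_sig :: "'r \<Rightarrow> 's list option"

type_synonym 's var = "'s \<times> nat"

text \<open>
  \<open>Par (s, a)\<close> is the constant naming the element \<open>a\<close> of sort \<open>s\<close>. Sets of parameters are sets
  of such pairs, since carriers of distinct sorts are not required to be disjoint.
\<close>

datatype ('s, 'f, 'a) trm =
    Var "'s var"
  | Par "'s \<times> 'a"
  | Fn 'f "('s, 'f, 'a) trm list"

datatype ('s, 'f, 'r, 'a) fm =
    Eq "('s, 'f, 'a) trm" "('s, 'f, 'a) trm"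
  | Rl 'r "('s, 'f, 'a) trm list"
  | Neg "('s, 'f, 'r, 'a) fm"
  | Or "('s, 'f, 'r, 'a) fm" "('s, 'f, 'r, 'a) fm"
  | Ex "'s var" "('s, 'f, 'r, 'a) fm"

primrec sort_of :: "('s, 'f, 'r) lang \<Rightarrow> ('s, 'f, 'a) trm \<Rightarrow> 's option" where
  "sort_of L (Var v) = Some (fst v)"
| "sort_of L (Par c) = Some (fst c)"
| "sort_of L (Fn f ts) =
    (case fun_sig L f of
       None \<Rightarrow> None
     | Some (ss, s) \<Rightarrow> if map (sort_of L) ts = map Some ss then Some s else None)"

primrec wf_fm :: "('s, 'f, 'r) lang \<Rightarrow> ('s, 'f, 'r, 'a) fm \<Rightarrow> bool" where
  "wf_fm L (Eq t u) \<longleftrightarrow> sort_of L t \<noteq> None \<and> sort_of L t = sort_of L u"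
| "wf_fm L (Rl r ts) \<longleftrightarrow> (\<exists>ss. rel_sig L r = Some ss \<and> map (sort_of L) ts = map Some ss)"
| "wf_fm L (Neg \<phi>) \<longleftrightarrow> wf_fm L \<phi>"
| "wf_fm L (Or \<phi> \<psi>) \<longleftrightarrow> wf_fm L \<phi> \<and> wf_fm L \<psi>"
| "wf_fm L (Ex v \<phi>) \<longleftrightarrow> wf_fm L \<phi>"

primrec fv_trm :: "('s, 'f, 'a) trm \<Rightarrow> 's var set" where
  "fv_trm (Var v) = {v}"
| "fv_trm (Par c) = {}"
| "fv_trm (Fn f ts) = \<Union> (set (map fv_trm ts))"

primrec fv :: "('s, 'f, 'r, 'a) fm \<Rightarrow> 's var set" where
  "fv (Eq t u) = fv_trm t \<union> fv_trm u"
| "fv (Rl r ts) = \<Union> (set (map fv_trm ts))"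
| "fv (Neg \<phi>) = fv \<phi>"
| "fv (Or \<phi> \<psi>) = fv \<phi> \<union> fv \<psi>"
| "fv (Ex v \<phi>) = fv \<phi> - {v}"

primrec pars_trm :: "('s, 'f, 'a) trm \<Rightarrow> ('s \<times> 'a) set" where
  "pars_trm (Var v) = {}"
| "pars_trm (Par c) = {c}"
| "pars_trm (Fn f ts) = \<Union> (set (map pars_trm ts))"

primrec pars :: "('s, 'f, 'r, 'a) fm \<Rightarrow> ('s \<times> 'a) set" where
  "pars (Eq t u) = pars_trm t \<union> pars_trm u"
| "pars (Rl r ts) = \<Union> (set (map pars_trm ts))"
| "pars (Neg \<phi>) = pars \<phi>"
| "pars (Or \<phi> \<psi>) = pars \<phi> \<union> pars \<psi>"
| "pars (Ex v \<phi>) = pars \<phi>"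

primrec subst_trm :: "'s var \<Rightarrow> ('s, 'f, 'a) trm \<Rightarrow> ('s, 'f, 'a) trm \<Rightarrow> ('s, 'f, 'a) trm" where
  "subst_trm x t (Var v) = (if v = x then t else Var v)"
| "subst_trm x t (Par c) = Par c"
| "subst_trm x t (Fn f ts) = Fn f (map (subst_trm x t) ts)"

text \<open>
  Replacement of the free occurrences of \<open>x\<close> by \<open>t\<close>. Bound variables are not renamed; this is
  only used for terms \<open>t\<close> containing no variable other than \<open>x\<close>, so nothing gets captured.
\<close>

primrec subst :: "'s var \<Rightarrow> ('s, 'f, 'a) trm \<Rightarrow> ('s, 'f, 'r, 'a) fm \<Rightarrow> ('s, 'f, 'r, 'a) fm" where
  "subst x t (Eq u w) = Eq (subst_trm x t u) (subst_trm x t w)"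
| "subst x t (Rl r ts) = Rl r (map (subst_trm x t) ts)"
| "subst x t (Neg \<phi>) = Neg (subst x t \<phi>)"
| "subst x t (Or \<phi> \<psi>) = Or (subst x t \<phi>) (subst x t \<psi>)"
| "subst x t (Ex v \<phi>) = Ex v (if v = x then \<phi> else subst x t \<phi>)"

definition L_formulas :: "('s, 'f, 'r) lang \<Rightarrow> ('s, 'f, 'r, 'a) fm set" where
  "L_formulas L = {\<phi>. wf_fm L \<phi> \<and> pars \<phi> = {}}"

record ('s, 'f, 'r, 'a) struc =
  dom :: "'s \<Rightarrow> 'a set"
  fn :: "'f \<Rightarrow> 'a list \<Rightarrow> 'a"
  rl :: "'r \<Rightarrow> 'a list \<Rightarrow> bool"

definition is_struc :: "('s, 'f, 'r) lang \<Rightarrow> ('s, 'f, 'r, 'a) struc \<Rightarrow> bool" where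
  "is_struc L M \<longleftrightarrow>
     (\<forall>s. dom M s \<noteq> {}) \<and>
     (\<forall>f ss s as. fun_sig L f = Some (ss, s) \<longrightarrow> list_all2 (\<lambda>a s'. a \<in> dom M s') as ss
        \<longrightarrow> fn M f as \<in> dom M s)"

definition univ :: "('s, 'f, 'r, 'a) struc \<Rightarrow> ('s \<times> 'a) set" where
  "univ M = Sigma UNIV (dom M)"

primrec val :: "('s, 'f, 'r, 'a) struc \<Rightarrow> ('s var \<Rightarrow> 'a) \<Rightarrow> ('s, 'f, 'a) trm \<Rightarrow> 'a" where
  "val M e (Var v) = e v"
| "val M e (Par c) = snd c"
| "val M e (Fn f ts) = fn M f (map (val M e) ts)"

primrec sat :: "('s, 'f, 'r, 'a) struc \<Rightarrow> ('s var \<Rightarrow> 'a) \<Rightarrow> ('s, 'f, 'r, 'a) fm \<Rightarrow> bool" where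
  "sat M e (Eq t u) \<longleftrightarrow> val M e t = val M e u"
| "sat M e (Rl r ts) \<longleftrightarrow> rl M r (map (val M e) ts)"
| "sat M e (Neg \<phi>) \<longleftrightarrow> \<not> sat M e \<phi>"
| "sat M e (Or \<phi> \<psi>) \<longleftrightarrow> sat M e \<phi> \<or> sat M e \<psi>"
| "sat M e (Ex v \<phi>) \<longleftrightarrow> (\<exists>a\<in>dom M (fst v). sat M (e(v := a)) \<phi>)"

definition assignments :: "('s, 'f, 'r, 'a) struc \<Rightarrow> ('s var \<Rightarrow> 'a) set" where
  "assignments M = {e. \<forall>v. e v \<in> dom M (fst v)}"

definition elem_sub :: "('s, 'f, 'r) lang \<Rightarrow> ('s, 'f, 'r, 'a) struc \<Rightarrow> ('s, 'f, 'r, 'a) struc \<Rightarrow> bool" where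
  "elem_sub L N M \<longleftrightarrow>
     is_struc L N \<and> is_struc L M \<and> (\<forall>s. dom N s \<subseteq> dom M s) \<and>
     (\<forall>\<phi>\<in>L_formulas L. \<forall>e\<in>assignments N. sat N e \<phi> \<longleftrightarrow> sat M e \<phi>)"

section \<open>Theories\<close>

definition is_theory :: "('s, 'f, 'r) lang \<Rightarrow> ('s, 'f, 'r, 'a) fm set \<Rightarrow> bool" where
  "is_theory L T \<longleftrightarrow> (\<forall>\<phi>\<in>T. \<phi> \<in> L_formulas L \<and> fv \<phi> = {})"

text \<open>
  The elements of \<open>T\<close> contain no \<open>Par\<close>, but their type mentions \<open>'a\<close>. Models of \<open>T\<close> below are
  models whose elements are of this type \<open>'a\<close>.
\<close>

definition is_model :: "('s, 'f, 'r) lang \<Rightarrow> ('s, 'f, 'r, 'a) fm set \<Rightarrow> ('s, 'f, 'r, 'a) struc \<Rightarrow> bool" where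
  "is_model L T M \<longleftrightarrow> is_struc L M \<and> (\<forall>\<phi>\<in>T. \<forall>e\<in>assignments M. sat M e \<phi>)"

text \<open>
  \<open>\<phi>(x;y)\<close>, where the tuple \<open>x\<close> consists of the variables in \<open>X\<close> and \<open>y\<close> of the remaining ones,
  has the independence property in \<open>M\<close>: there are \<open>a\<^sub>i\<close> \<open>(i \<in> \<nat>)\<close> and \<open>b\<^sub>I\<close> \<open>(I \<subseteq> \<nat>)\<close> such that
  \<open>\<phi>(a\<^sub>i;b\<^sub>I)\<close> holds iff \<open>i \<in> I\<close>. The tuples are given by total assignments.
\<close>

definition has_IP :: "('s, 'f, 'r, 'a) struc \<Rightarrow> ('s, 'f, 'r, 'a) fm \<Rightarrow> 's var set \<Rightarrow> bool" where
  "has_IP M \<phi> X \<longleftrightarrow>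
     (\<exists>(a :: nat \<Rightarrow> 's var \<Rightarrow> 'a) (b :: nat set \<Rightarrow> 's var \<Rightarrow> 'a).
        range a \<subseteq> assignments M \<and> range b \<subseteq> assignments M \<and>
        (\<forall>i I. sat M (\<lambda>v. if v \<in> X then a i v else b I v) \<phi> \<longleftrightarrow> i \<in> I))"

definition NIP :: "('s, 'f, 'r) lang \<Rightarrow> ('s, 'f, 'r, 'a) fm set \<Rightarrow> bool" where
  "NIP L T \<longleftrightarrow> (\<forall>M. is_model L T M \<longrightarrow> (\<forall>\<phi>\<in>L_formulas L. \<forall>X. \<not> has_IP M \<phi> X))"

definition expands_group ::
    "('s, 'f, 'r) lang \<Rightarrow> ('s, 'f, 'r, 'a) fm set \<Rightarrow> 's \<Rightarrow> 'f \<Rightarrow> bool" where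
  "expands_group L T s mul \<longleftrightarrow>
     fun_sig L mul = Some ([s, s], s) \<and>
     (\<forall>M. is_model L T M \<longrightarrow>
        (\<exists>e. group \<lparr>carrier = dom M s, mult = (\<lambda>a b. fn M mul [a, b]), one = e\<rparr>))"

section \<open>Formulas in one variable and types\<close>

text \<open>
  The formulas in the single free variable \<open>x\<close> with parameters from \<open>A\<close>. Formulas are not
  identified up to equivalence here; instead Keisler measures are required to respect it.
\<close>

definition Lx :: "('s, 'f, 'r) lang \<Rightarrow> 's var \<Rightarrow> ('s \<times> 'a) set \<Rightarrow> ('s, 'f, 'r, 'a) fm set" where
  "Lx L x A = {\<phi>. wf_fm L \<phi> \<and> fv \<phi> \<subseteq> {x} \<and> pars \<phi> \<subseteq> A}"

definition sol :: "('s, 'f, 'r, 'a) struc \<Rightarrow> 's var \<Rightarrow> ('s, 'f, 'r, 'a) fm \<Rightarrow> 'a set" where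
  "sol M x \<phi> = {a \<in> dom M (fst x). sat M ((\<lambda>_. undefined)(x := a)) \<phi>}"

definition types ::
    "('s, 'f, 'r) lang \<Rightarrow> ('s, 'f, 'r, 'a) struc \<Rightarrow> 's var \<Rightarrow> ('s \<times> 'a) set \<Rightarrow> ('s, 'f, 'r, 'a) fm set set" where
  "types L M x A =
     {p. p \<subseteq> Lx L x A \<and>
         (\<forall>F. finite F \<and> F \<subseteq> p \<longrightarrow> (\<exists>a\<in>dom M (fst x). \<forall>\<phi>\<in>F. a \<in> sol M x \<phi>)) \<and>
         (\<forall>\<phi>\<in>Lx L x A. \<phi> \<in> p \<or> Neg \<phi> \<in> p)}"

definition realizes ::
    "('s, 'f, 'r, 'a) struc \<Rightarrow> 's var \<Rightarrow> 'a \<Rightarrow> ('s, 'f, 'r, 'a) fm set \<Rightarrow> bool" where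
  "realizes M x d p \<longleftrightarrow> d \<in> dom M (fst x) \<and> (\<forall>\<phi>\<in>p. d \<in> sol M x \<phi>)"

definition basic_clopen ::
    "('s, 'f, 'r) lang \<Rightarrow> ('s, 'f, 'r, 'a) struc \<Rightarrow> 's var \<Rightarrow> ('s \<times> 'a) set
      \<Rightarrow> ('s, 'f, 'r, 'a) fm \<Rightarrow> ('s, 'f, 'r, 'a) fm set set" where
  "basic_clopen L M x A \<phi> = {p \<in> types L M x A. \<phi> \<in> p}"

definition type_space ::
    "('s, 'f, 'r) lang \<Rightarrow> ('s, 'f, 'r, 'a) struc \<Rightarrow> 's var \<Rightarrow> ('s \<times> 'a) set
      \<Rightarrow> ('s, 'f, 'r, 'a) fm set topology" where
  "type_space L M x A = topology_generated_by (basic_clopen L M x A ` Lx L x A)"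

section \<open>Monster models\<close>

definition small :: "'k rel \<Rightarrow> ('s, 'f, 'r, 'a) struc \<Rightarrow> bool" where
  "small \<kappa> N \<longleftrightarrow> |univ N| <o \<kappa>"

definition saturated :: "('s, 'f, 'r) lang \<Rightarrow> 'k rel \<Rightarrow> ('s, 'f, 'r, 'a) struc \<Rightarrow> bool" where
  "saturated L \<kappa> M \<longleftrightarrow>
     (\<forall>A z. A \<subseteq> univ M \<and> |A| <o \<kappa> \<longrightarrow> (\<forall>p\<in>types L M z A. \<exists>d. realizes M z d p))"

definition automorphism ::
    "('s, 'f, 'r) lang \<Rightarrow> ('s, 'f, 'r, 'a) struc \<Rightarrow> ('s \<Rightarrow> 'a \<Rightarrow> 'a) \<Rightarrow> bool" where
  "automorphism L M \<sigma> \<longleftrightarrow>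
     (\<forall>s. bij_betw (\<sigma> s) (dom M s) (dom M s)) \<and>
     (\<forall>f ss s as. fun_sig L f = Some (ss, s) \<and> list_all2 (\<lambda>a s'. a \<in> dom M s') as ss
        \<longrightarrow> fn M f (map2 \<sigma> ss as) = \<sigma> s (fn M f as)) \<and>
     (\<forall>r ss as. rel_sig L r = Some ss \<and> list_all2 (\<lambda>a s'. a \<in> dom M s') as ss
        \<longrightarrow> (rl M r (map2 \<sigma> ss as) \<longleftrightarrow> rl M r as))"

definition partial_elementary ::
    "('s, 'f, 'r) lang \<Rightarrow> ('s, 'f, 'r, 'a) struc \<Rightarrow> ('s \<times> 'a) set \<Rightarrow> ('s \<Rightarrow> 'a \<Rightarrow> 'a) \<Rightarrow> bool" where
  "partial_elementary L M A g \<longleftrightarrow>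
     A \<subseteq> univ M \<and> (\<forall>(s, a)\<in>A. g s a \<in> dom M s) \<and>
     (\<forall>\<phi>\<in>L_formulas L. \<forall>e. (\<forall>v\<in>fv \<phi>. (fst v, e v) \<in> A) \<longrightarrow>
        (sat M e \<phi> \<longleftrightarrow> sat M (\<lambda>v. g (fst v) (e v)) \<phi>))"

definition strongly_homogeneous :: "('s, 'f, 'r) lang \<Rightarrow> 'k rel \<Rightarrow> ('s, 'f, 'r, 'a) struc \<Rightarrow> bool" where
  "strongly_homogeneous L \<kappa> M \<longleftrightarrow>
     (\<forall>A g. |A| <o \<kappa> \<and> partial_elementary L M A g \<longrightarrow>
        (\<exists>\<sigma>. automorphism L M \<sigma> \<and> (\<forall>(s, a)\<in>A. \<sigma> s a = g s a)))"

text \<open>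
  A monster model is \<open>\<kappa>\<close>-saturated and strongly \<open>\<kappa>\<close>-homogeneous for a cardinal \<open>\<kappa>\<close> larger than the
  number of formulas of the language (hence uncountable); "small" means of size less than \<open>\<kappa>\<close>.
\<close>

definition monster_model ::
    "('s, 'f, 'r) lang \<Rightarrow> ('s, 'f, 'r, 'a) fm set \<Rightarrow> 'k rel \<Rightarrow> ('s, 'f, 'r, 'a) struc \<Rightarrow> bool" where
  "monster_model L T \<kappa> M \<longleftrightarrow>
     is_model L T M \<and> Card_order \<kappa> \<and> |L_formulas L :: ('s, 'f, 'r, 'a) fm set| <o \<kappa> \<and>
     saturated L \<kappa> M \<and> strongly_homogeneous L \<kappa> M"

section \<open>Keisler measures\<close>

text \<open>
  Since \<open>\<mu>\<close> respects equivalence in \<open>M\<close>, it is a finitely additive probability measure on the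
  Boolean algebra of formulas up to equivalence.
\<close>

definition keisler ::
    "('s, 'f, 'r) lang \<Rightarrow> ('s, 'f, 'r, 'a) struc \<Rightarrow> 's var \<Rightarrow> ('s \<times> 'a) set
      \<Rightarrow> (('s, 'f, 'r, 'a) fm \<Rightarrow> real) set" where
  "keisler L M x A =
     {\<mu> \<in> Lx L x A \<rightarrow>\<^sub>E {0..1}.
        (\<forall>\<phi>\<in>Lx L x A. \<forall>\<psi>\<in>Lx L x A. sol M x \<phi> = sol M x \<psi> \<longrightarrow> \<mu> \<phi> = \<mu> \<psi>) \<and>
        (\<forall>\<phi>\<in>Lx L x A. sol M x \<phi> = dom M (fst x) \<longrightarrow> \<mu> \<phi> = 1) \<and>
        (\<forall>\<phi>\<in>Lx L x A. \<forall>\<psi>\<in>Lx L x A. sol M x \<phi> \<inter> sol M x \<psi> = {} \<longrightarrow> \<mu> (Or \<phi> \<psi>) = \<mu> \<phi> + \<mu> \<psi>)}"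

definition supp ::
    "('s, 'f, 'r) lang \<Rightarrow> ('s, 'f, 'r, 'a) struc \<Rightarrow> 's var \<Rightarrow> ('s \<times> 'a) set
      \<Rightarrow> (('s, 'f, 'r, 'a) fm \<Rightarrow> real) \<Rightarrow> ('s, 'f, 'r, 'a) fm set set" where
  "supp L M x A \<mu> = {p \<in> types L M x A. \<forall>\<phi>\<in>p. \<mu> \<phi> > 0}"

definition borel_of :: "'b topology \<Rightarrow> 'b measure" where
  "borel_of X = sigma (topspace X) {U. openin X U}"

definition regular_borel_prob :: "'b topology \<Rightarrow> 'b measure \<Rightarrow> bool" where
  "regular_borel_prob X m \<longleftrightarrow>
     sets m = sets (borel_of X) \<and> prob_space m \<and>
     (\<forall>B\<in>sets m.
        emeasure m B = (INF U\<in>{U. openin X U \<and> B \<subseteq> U}. emeasure m U) \<and>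
        emeasure m B = (SUP K\<in>{K. compactin X K \<and> K \<subseteq> B}. emeasure m K))"

definition keisler_borel ::
    "('s, 'f, 'r) lang \<Rightarrow> ('s, 'f, 'r, 'a) struc \<Rightarrow> 's var \<Rightarrow> ('s \<times> 'a) set
      \<Rightarrow> (('s, 'f, 'r, 'a) fm \<Rightarrow> real) \<Rightarrow> ('s, 'f, 'r, 'a) fm set measure" where
  "keisler_borel L M x A \<mu> =
     (THE m. regular_borel_prob (type_space L M x A) m \<and>
             (\<forall>\<phi>\<in>Lx L x A. measure m (basic_clopen L M x A \<phi>) = \<mu> \<phi>))"

definition fin_sat_measures ::
    "('s, 'f, 'r) lang \<Rightarrow> ('s, 'f, 'r, 'a) struc \<Rightarrow> 's var \<Rightarrow> ('s, 'f, 'r, 'a) struc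
      \<Rightarrow> (('s, 'f, 'r, 'a) fm \<Rightarrow> real) set" where
  "fin_sat_measures L M x G =
     {\<mu> \<in> keisler L M x (univ M).
        \<forall>\<phi>\<in>Lx L x (univ M). \<mu> \<phi> > 0 \<longrightarrow> (\<exists>a\<in>dom G (fst x). a \<in> sol M x \<phi>)}"

definition fin_sat_space ::
    "('s, 'f, 'r) lang \<Rightarrow> ('s, 'f, 'r, 'a) struc \<Rightarrow> 's var \<Rightarrow> ('s, 'f, 'r, 'a) struc
      \<Rightarrow> (('s, 'f, 'r, 'a) fm \<Rightarrow> real) topology" where
  "fin_sat_space L M x G =
     subtopology (product_topology (\<lambda>_. top_of_set {0..1}) (Lx L x (univ M))) (fin_sat_measures L M x G)"

section \<open>Convolution\<close>

text \<open>
  The measure \<open>\<nu>\<^sub>y\<close> in the variable \<open>y\<close> is identified with \<open>\<nu>\<close> itself: types over \<open>N\<close> in \<open>y\<close> are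
  represented by types in \<open>x\<close>, and \<open>y\<close> is always instantiated by a realization \<open>d\<close>.
\<close>

definition translate :: "'s var \<Rightarrow> 'f \<Rightarrow> 'a \<Rightarrow> ('s, 'f, 'r, 'a) fm \<Rightarrow> ('s, 'f, 'r, 'a) fm" where
  "translate x mul d \<phi> = subst x (Fn mul [Var x, Par (fst x, d)]) \<phi>"

definition fibre ::
    "('s, 'f, 'r, 'a) struc \<Rightarrow> 's var \<Rightarrow> 'f \<Rightarrow> (('s, 'f, 'r, 'a) fm \<Rightarrow> real)
      \<Rightarrow> ('s, 'f, 'r, 'a) fm \<Rightarrow> ('s, 'f, 'r, 'a) fm set \<Rightarrow> real" where
  "fibre M x mul \<mu> \<phi> q = \<mu> (translate x mul (SOME d. realizes M x d q) \<phi>)"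

definition star_Borel_over ::
    "('s, 'f, 'r) lang \<Rightarrow> 'k rel \<Rightarrow> ('s, 'f, 'r, 'a) struc \<Rightarrow> 's var \<Rightarrow> 'f
      \<Rightarrow> (('s, 'f, 'r, 'a) fm \<Rightarrow> real) \<Rightarrow> (('s, 'f, 'r, 'a) fm \<Rightarrow> real)
      \<Rightarrow> ('s, 'f, 'r, 'a) fm \<Rightarrow> ('s, 'f, 'r, 'a) struc \<Rightarrow> bool" where
  "star_Borel_over L \<kappa> M x mul \<mu> \<nu> \<phi> N \<longleftrightarrow>
     elem_sub L N M \<and> small \<kappa> N \<and> pars \<phi> \<subseteq> univ N \<and>
     (let S = supp L M x (univ N) (restrict \<nu> (Lx L x (univ N))) in
       (\<forall>q\<in>S. \<forall>d d'. realizes M x d q \<and> realizes M x d' q \<longrightarrow>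
          \<mu> (translate x mul d \<phi>) = \<mu> (translate x mul d' \<phi>)) \<and>
       fibre M x mul \<mu> \<phi> \<in> borel_measurable (borel_of (subtopology (type_space L M x (univ N)) S)))"

definition star_Borel ::
    "('s, 'f, 'r) lang \<Rightarrow> 'k rel \<Rightarrow> ('s, 'f, 'r, 'a) struc \<Rightarrow> 's var \<Rightarrow> 'f
      \<Rightarrow> (('s, 'f, 'r, 'a) fm \<Rightarrow> real) \<Rightarrow> (('s, 'f, 'r, 'a) fm \<Rightarrow> real) \<Rightarrow> bool" where
  "star_Borel L \<kappa> M x mul \<mu> \<nu> \<longleftrightarrow>
     (\<forall>\<phi>\<in>Lx L x (univ M). \<exists>N. star_Borel_over L \<kappa> M x mul \<mu> \<nu> \<phi> N)"

text \<open>
  The integral does not depend on the choice of \<open>N\<close>. The convolution is left undefined for pairs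
  that are not \<open>*\<close>-Borel.
\<close>

definition conv ::
    "('s, 'f, 'r) lang \<Rightarrow> 'k rel \<Rightarrow> ('s, 'f, 'r, 'a) struc \<Rightarrow> 's var \<Rightarrow> 'f
      \<Rightarrow> (('s, 'f, 'r, 'a) fm \<Rightarrow> real) \<Rightarrow> (('s, 'f, 'r, 'a) fm \<Rightarrow> real)
      \<Rightarrow> ('s, 'f, 'r, 'a) fm \<Rightarrow> real" where
  "conv L \<kappa> M x mul \<mu> \<nu> =
     (if star_Borel L \<kappa> M x mul \<mu> \<nu> then
        (\<lambda>\<phi>\<in>Lx L x (univ M).
           let N = SOME N. star_Borel_over L \<kappa> M x mul \<mu> \<nu> \<phi> N;
               \<nu>N = restrict \<nu> (Lx L x (univ N))
           in integral\<^sup>L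
                (restrict_space (keisler_borel L M x (univ N) \<nu>N) (supp L M x (univ N) \<nu>N))
                (fibre M x mul \<mu> \<phi>))
      else undefined)"

end

theory Submission
  imports Defs "HOL-Real_Asymp.Real_Asymp"
begin

text \<open>
  Fix \<open>\<nu>\<close> and a formula \<open>\<phi>(x)\<close>, and write \<open>a\<cdot>d\<close> for the product in the monster model. The value of \<open>\<mu> * \<nu>\<close> at
  \<open>\<phi>\<close> is the \<open>\<nu>\<close>-integral of \<open>F\<^sub>\<mu>(q) = \<mu>(\<phi>(x\<cdot>d))\<close>, \<open>d\<close> realizing \<open>q\<close>. The heart of the proof
  (\<open>conv_approx_by_points\<close>) is that, for each \<open>\<epsilon>\<close>, there are finitely many elements \<open>d\<^sub>1, \<dots>, d\<^sub>n\<close> such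
  that \<open>(\<mu> * \<nu>)(\<phi>)\<close> is within \<open>\<epsilon>\<close> of the average of the numbers \<open>\<mu>(\<phi>(x\<cdot>d\<^sub>i))\<close>, for all \<open>\<mu>\<close> at once.
  Each such average is continuous in \<open>\<mu>\<close>, being a finite combination of evaluations, and
  \<open>\<mu> \<mapsto> (\<mu> * \<nu>)(\<phi>)\<close> is a uniform limit of them.

  The elements come from the theorem of Vapnik and Chervonenkis. By NIP the relation \<open>\<phi>(a\<cdot>d)\<close> has
  finite VC dimension in both directions (\<open>shattering_bound\<close>). A family of clopen sets of finite VC
  dimension on a compact space carrying a probability measure admits finite sets of points whose
  empirical frequencies approximate the measure uniformly over the family (\<open>VC_approx_compact\<close>); the
  number of points depends only on \<open>\<epsilon>\<close> and the dimension, so finite subfamilies are enough by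
  compactness. This is used twice.

  Applied to \<open>\<mu>\<close> and the sets \<open>\<phi>(x\<cdot>d)\<close>, it gives types \<open>p\<^sub>1, \<dots>, p\<^sub>k\<close> in the support of \<open>\<mu>\<close> such that
  \<open>F\<^sub>\<mu>\<close> is uniformly close to the average of the indicators of the sets
  \<open>F\<^sub>p = {q. \<phi>(x\<cdot>d) \<in> p}\<close>, \<open>p = p\<^sub>j\<close> (\<open>fibre_by_types\<close>). Every \<open>p\<^sub>j\<close> is finitely satisfiable in
  \<open>G\<close>, and for such types \<open>F\<^sub>p\<close> is Borel: along a Morley sequence of \<open>p\<close> the truth value of \<open>\<phi>(a\<^sub>i\<cdot>d)\<close>
  can alternate only finitely often, and the parity of the longest alternation consistent with \<open>q\<close>
  decides whether \<open>q \<in> F\<^sub>p\<close> (\<open>true_set_eq\<close>). So \<open>F\<^sub>\<mu>\<close> is Borel and the convolution is defined.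

  Applied to \<open>\<nu>\<close> and the clopen sets \<open>F\<^sub>a = {q. \<phi>(a\<cdot>x) \<in> q}\<close>, \<open>a \<in> G\<close>, it gives types
  \<open>r\<^sub>1, \<dots>, r\<^sub>n\<close> with \<open>\<nu>(F\<^sub>a)\<close> close to the frequency of \<open>F\<^sub>a\<close> among the \<open>r\<^sub>i\<close>. The sets \<open>F\<^sub>p\<close>
  are pointwise limits of the \<open>F\<^sub>a\<close>, and the same \<open>r\<^sub>i\<close> serve for them
  (\<open>uniform_approx_pointwise_closure\<close>), although integrals do not in general commute with limits along
  nets: approximating \<open>\<nu>\<close> once more, on compact subsets of \<open>F\<^sub>p\<close> and of its complement, shows that \<open>F\<^sub>a\<close>
  has almost the measure of \<open>F\<^sub>p\<close> as soon as the two agree on a suitable finite set. Realizations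
  \<open>d\<^sub>i\<close> of the \<open>r\<^sub>i\<close> are the elements sought.
\<close>

section \<open>Uniform approximation for set families of finite VC dimension\<close>

definition shatters :: "'b set set \<Rightarrow> 'b set \<Rightarrow> bool" where
  "shatters F Y \<longleftrightarrow> (\<forall>Z\<subseteq>Y. \<exists>S\<in>F. S \<inter> Y = Z)"

definition VC_dim_le :: "nat \<Rightarrow> 'b set \<Rightarrow> 'b set set \<Rightarrow> bool" where
  "VC_dim_le d K F \<longleftrightarrow> (\<forall>Y\<subseteq>K. finite Y \<and> shatters F Y \<longrightarrow> card Y \<le> d)"

lemma shatters_imageD: "shatters (h ` I) Y \<Longrightarrow> Z \<subseteq> Y \<Longrightarrow> \<exists>i\<in>I. h i \<inter> Y = Z"
  unfolding shatters_def by (metis (no_types, lifting) imageE)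

definition frequency :: "'b set \<Rightarrow> nat \<Rightarrow> (nat \<Rightarrow> 'b) \<Rightarrow> real" where
  "frequency S n q = (\<Sum>i<n. indicator S (q i)) / n"

text \<open>
  Induction on the ground set. Removing a point \<open>x\<close> merges two members of \<open>F\<close> exactly when both \<open>S\<close> and
  \<open>insert x S\<close> belong to \<open>F\<close>; a set shattered by the merged pairs stays shattered after adding \<open>x\<close>, and
  this accounts for the members lost.
\<close>

lemma pajor:
  assumes "finite X" "F \<subseteq> Pow X"
  shows "card F \<le> card {Y. Y \<subseteq> X \<and> shatters F Y}"
  using assms
proof (induction X arbitrary: F rule: finite_induct)
  case empty
  then have "F = {} \<or> F = {{}}" by auto
  then show ?case
  proof
    assume "F = {{}}"
    then have "{Y. Y \<subseteq> {} \<and> shatters F Y} = {{}}" by (auto simp: shatters_def)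
    then show ?thesis using \<open>F = {{}}\<close> by simp
  qed auto
next
  case (insert x X)
  define A where "A = {S\<in>F. x \<notin> S}"
  define B where "B = {S\<in>F. x \<in> S}"
  define B' where "B' = (\<lambda>S. S - {x}) ` B"
  have finF: "finite F" using insert.prems insert.hyps(1) by (meson finite.insertI finite_Pow_iff finite_subset)
  have finA: "finite A" and finB: "finite B" using finF by (auto simp: A_def B_def)
  have "inj_on (\<lambda>S. S - {x}) B" by (rule inj_onI) (auto simp: B_def)
  then have cB: "card B' = card B" by (simp add: B'_def card_image)
  have "F = A \<union> B" "A \<inter> B = {}" by (auto simp: A_def B_def)
  then have cF: "card F = card A + card B" using finA finB card_Un_disjoint by blast
  also have "\<dots> = card (A \<union> B') + card (A \<inter> B')"
    using card_Un_Int[of A B'] finA finB cB by (simp add: B'_def)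
  finally have cF: "card F = card (A \<union> B') + card (A \<inter> B')" .
  have sub: "A \<union> B' \<subseteq> Pow X" "A \<inter> B' \<subseteq> Pow X" using insert.prems by (auto simp: A_def B_def B'_def)
  define P where "P = {Y. Y \<subseteq> X \<and> shatters (A \<union> B') Y}"
  define Q where "Q = {Y. Y \<subseteq> X \<and> shatters (A \<inter> B') Y}"
  have fin: "finite P" "finite Q" using insert.hyps(1) by (auto simp: P_def Q_def)
  have injQ: "inj_on (insert x) Q" using insert.hyps(2) by (intro inj_onI) (auto simp: Q_def)
  have "card F \<le> card P + card Q"
    using cF insert.IH[OF sub(1)] insert.IH[OF sub(2)] by (simp add: P_def Q_def)
  also have "\<dots> = card P + card (insert x ` Q)" using injQ by (simp add: card_image)
  also have "\<dots> = card (P \<union> insert x ` Q)"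
    using fin insert.hyps(2) by (subst card_Un_disjoint) (auto simp: P_def)
  also have "\<dots> \<le> card {Y. Y \<subseteq> insert x X \<and> shatters F Y}"
  proof (rule card_mono)
    show "finite {Y. Y \<subseteq> insert x X \<and> shatters F Y}" using insert.hyps(1) by auto
    have 1: "shatters F Y" if "Y \<subseteq> X" "shatters (A \<union> B') Y" for Y
      unfolding shatters_def
    proof (intro allI impI)
      fix Z assume "Z \<subseteq> Y"
      then obtain S where S: "S \<in> A \<union> B'" "S \<inter> Y = Z" using \<open>shatters (A \<union> B') Y\<close> by (auto simp: shatters_def)
      have "x \<notin> Y" using that(1) insert.hyps(2) by auto
      show "\<exists>S\<in>F. S \<inter> Y = Z"
      proof (cases "S \<in> A")
        case True then show ?thesis using S by (auto simp: A_def)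
      next
        case False
        then obtain S' where "S' \<in> F" "S = S' - {x}" using S by (auto simp: B'_def B_def)
        moreover have "S' \<inter> Y = Z" using S \<open>S = S' - {x}\<close> \<open>x \<notin> Y\<close> by auto
        ultimately show ?thesis by auto
      qed
    qed
    have 2: "shatters F (insert x Y)" if "Y \<subseteq> X" "shatters (A \<inter> B') Y" for Y
      unfolding shatters_def
    proof (intro allI impI)
      fix Z assume "Z \<subseteq> insert x Y"
      have "x \<notin> Y" using that(1) insert.hyps(2) by auto
      obtain S where S: "S \<in> A" "S \<in> B'" "S \<inter> Y = Z - {x}" using \<open>shatters (A \<inter> B') Y\<close> \<open>Z \<subseteq> insert x Y\<close>
        unfolding shatters_def by (metis Diff_subset_conv IntE insert_is_Un)
      obtain S' where S': "S' \<in> F" "x \<in> S'" "S = S' - {x}" using S by (auto simp: B'_def B_def)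
      show "\<exists>S\<in>F. S \<inter> insert x Y = Z"
      proof (cases "x \<in> Z")
        case True
        then have "S' \<inter> insert x Y = Z" using S S' \<open>Z \<subseteq> insert x Y\<close> \<open>x \<notin> Y\<close> by auto
        then show ?thesis using S' by auto
      next
        case False
        then have "S \<inter> insert x Y = Z" using S by (auto simp: A_def)
        then show ?thesis using S by (auto simp: A_def)
      qed
    qed
    show "P \<union> insert x ` Q \<subseteq> {Y. Y \<subseteq> insert x X \<and> shatters F Y}"
      using 1 2 by (auto simp: P_def Q_def)
  qed
  finally show ?case .
qed

text \<open>
  A subset with at most \<open>d\<close> elements is enumerated by a map from \<open>{..<d}\<close> into \<open>Y\<close> extended by one dummy
  value.
\<close>

lemma card_small_subsets:
  assumes "finite Y"
  shows "card {Z. Z \<subseteq> Y \<and> card Z \<le> d} \<le> (card Y + 1) ^ d"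
proof -
  define E where "E = PiE {..<d} (\<lambda>_. insert None (Some ` Y))"
  have "{Z. Z \<subseteq> Y \<and> card Z \<le> d} \<subseteq> (\<lambda>f. {y. \<exists>i<d. f i = Some y}) ` E"
  proof
    fix Z assume "Z \<in> {Z. Z \<subseteq> Y \<and> card Z \<le> d}"
    then have Z: "Z \<subseteq> Y" "card Z \<le> d" by auto
    obtain g where g: "bij_betw g {0..<card Z} Z" using ex_bij_betw_nat_finite finite_subset[OF Z(1) assms] by blast
    define f where "f = (\<lambda>i\<in>{..<d}. if i < card Z then Some (g i) else None)"
    have "g i \<in> Y" if "i < card Z" for i using bij_betw_apply[OF g] Z that by auto
    then have "f \<in> E" by (auto simp: E_def f_def PiE_def extensional_def)
    moreover have "Z = {y. \<exists>i<d. f i = Some y}"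
    proof -
      have "(\<exists>i<d. f i = Some y) \<longleftrightarrow> (\<exists>i<card Z. y = g i)" for y
        using Z(2) by (auto simp: f_def split: if_splits intro: less_le_trans)
      then have "{y. \<exists>i<d. f i = Some y} = g ` {0..<card Z}" by auto
      then show ?thesis using bij_betw_imp_surj_on[OF g] by simp
    qed
    ultimately show "Z \<in> (\<lambda>f. {y. \<exists>i<d. f i = Some y}) ` E" by blast
  qed
  moreover have "finite E" using assms by (auto simp: E_def intro!: finite_PiE)
  ultimately have "card {Z. Z \<subseteq> Y \<and> card Z \<le> d} \<le> card E"
    by (meson card_image_le card_mono finite_imageI le_trans)
  also have "\<dots> = (card Y + 1) ^ d"
    using assms by (simp add: E_def card_PiE card_insert_if card_image)
  finally show ?thesis .
qed

lemma sauer_shelah: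
  assumes "VC_dim_le d K F" "Y \<subseteq> K" "finite Y"
  shows "card ((\<lambda>S. S \<inter> Y) ` F) \<le> (card Y + 1) ^ d"
proof -
  have "card ((\<lambda>S. S \<inter> Y) ` F) \<le> card {Z. Z \<subseteq> Y \<and> shatters ((\<lambda>S. S \<inter> Y) ` F) Z}"
    using assms(3) by (intro pajor) auto
  also have "\<dots> \<le> card {Z. Z \<subseteq> Y \<and> card Z \<le> d}"
  proof (rule card_mono)
    show "finite {Z. Z \<subseteq> Y \<and> card Z \<le> d}" using assms(3) by auto
    have "card Z \<le> d" if "Z \<subseteq> Y" "shatters ((\<lambda>S. S \<inter> Y) ` F) Z" for Z
    proof -
      have "S \<inter> Y \<inter> Z = S \<inter> Z" for S using that(1) by auto
      then have "shatters F Z" using that(2) by (auto simp: shatters_def)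
      then show ?thesis using assms that(1) finite_subset unfolding VC_dim_le_def by blast
    qed
    then show "{Z. Z \<subseteq> Y \<and> shatters ((\<lambda>S. S \<inter> Y) ` F) Z} \<subseteq> {Z. Z \<subseteq> Y \<and> card Z \<le> d}" by auto
  qed
  also have "\<dots> \<le> (card Y + 1) ^ d" by (rule card_small_subsets[OF assms(3)])
  finally show ?thesis .
qed

lemma cosh_le_exp_square:
  fixes s :: real
  assumes "0 \<le> s" "s \<le> 1"
  shows "cosh s \<le> exp (s\<^sup>2)"
proof -
  have "exp s \<le> 1 + s + s\<^sup>2" by (rule exp_bound[OF assms])
  moreover have "exp (-s) \<le> 1 - s + s\<^sup>2"
  proof -
    have "(1 - s + s\<^sup>2) * (1 + s) = 1 + s * s\<^sup>2" by (simp add: algebra_simps power2_eq_square)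
    then have "1 \<le> (1 - s + s\<^sup>2) * (1 + s)" using assms by simp
    also have "\<dots> \<le> (1 - s + s\<^sup>2) * exp s"
      using assms by (intro mult_left_mono) auto
    finally show ?thesis by (simp add: exp_minus field_simps)
  qed
  ultimately have "cosh s \<le> 1 + s\<^sup>2" by (simp add: cosh_def)
  also have "\<dots> \<le> exp (s\<^sup>2)" by simp
  finally show ?thesis .
qed

text \<open>
  A derandomized exponential-moment bound. Since \<open>cosh (A + s) + cosh (A - s) = 2 * cosh A * cosh s\<close>,
  the two choices of the next sign multiply the potential by at most \<open>cosh s\<close> on average, so one of
  them does.
\<close>

lemma sign_potential:
  fixes T :: "(nat \<Rightarrow> real) set" and s :: real
  assumes "finite T" "\<And>t i. t \<in> T \<Longrightarrow> \<bar>t i\<bar> \<le> 1"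
  shows "\<exists>e. (\<forall>i. e i = 1 \<or> e i = - 1) \<and>
    (\<Sum>t\<in>T. cosh (s * (\<Sum>i<l. e i * t i))) \<le> real (card T) * cosh s ^ l"
proof (induction l)
  case 0
  show ?case by (rule exI[of _ "\<lambda>_. 1"]) simp
next
  case (Suc l)
  then obtain e where e: "\<And>i. e i = 1 \<or> e i = - (1::real)"
    and le: "(\<Sum>t\<in>T. cosh (s * (\<Sum>i<l. e i * t i))) \<le> real (card T) * cosh s ^ l" by blast
  define A where "A t = s * (\<Sum>i<l. e i * t i)" for t
  have cosh_t: "cosh (s * t l) \<le> cosh s" if "t \<in> T" for t
  proof -
    have "\<bar>s * t l\<bar> \<le> \<bar>s\<bar>" using assms(2)[OF that, of l] by (simp add: abs_mult mult_left_le)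
    then have "cosh \<bar>s * t l\<bar> \<le> cosh \<bar>s\<bar>" by (subst cosh_real_nonneg_le_iff) auto
    then show ?thesis by (simp only: cosh_real_abs)
  qed
  define P where "P r = (\<Sum>t\<in>T. cosh (A t + r * (s * t l)))" for r
  have "P 1 + P (-1) = (\<Sum>t\<in>T. 2 * (cosh (A t) * cosh (s * t l)))"
    by (simp add: P_def sum.distrib[symmetric] cosh_add cosh_diff)
  also have "\<dots> \<le> (\<Sum>t\<in>T. 2 * (cosh (A t) * cosh s))"
    using cosh_t by (intro sum_mono) (auto intro!: mult_left_mono)
  also have "\<dots> = 2 * cosh s * (\<Sum>t\<in>T. cosh (A t))" by (simp add: sum_distrib_left mult_ac)
  also have "\<dots> \<le> 2 * cosh s * (real (card T) * cosh s ^ l)"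
    using le by (intro mult_left_mono) (auto simp: A_def)
  finally have "P 1 + P (-1) \<le> 2 * (real (card T) * cosh s ^ Suc l)" by (simp add: mult_ac)
  then obtain r :: real where r: "r = 1 \<or> r = -1" "P r \<le> real (card T) * cosh s ^ Suc l"
    by (metis add_mono_thms_linordered_field(5) linorder_not_le mult_2)
  define e' where "e' = e(l := r)"
  have "s * (\<Sum>i<Suc l. e' i * t i) = A t + r * (s * t l)" for t
    by (simp add: A_def e'_def algebra_simps)
  then have "(\<Sum>t\<in>T. cosh (s * (\<Sum>i<Suc l. e' i * t i))) \<le> real (card T) * cosh s ^ Suc l"
    using r(2) by (simp add: P_def)
  moreover have "\<forall>i. e' i = 1 \<or> e' i = -1" using e r(1) by (auto simp: e'_def)
  ultimately show ?case by blast
qed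

text \<open>
  The \<open>2 * l\<close> points are paired, and one of each pair is kept according to the signs of
  \<open>sign_potential\<close>. The resulting change of frequency of a set is its signed discrepancy divided by
  \<open>2 * l\<close>; only the traces on the points matter, and there are polynomially many.
\<close>

lemma halving:
  assumes VC: "VC_dim_le d K F" and l: "l > 0" and xs: "xs ` {..<2*l} \<subseteq> K" and s: "0 < s" "s \<le> 1"
  shows "\<exists>ys. ys ` {..<l} \<subseteq> xs ` {..<2*l} \<and>
    (\<forall>S\<in>F. \<bar>frequency S l ys - frequency S (2*l) xs\<bar> \<le> ln (2 * (2 * real l + 1) ^ d) / (2 * real l * s) + s / 2)"
proof -
  define Y where "Y = xs ` {..<2*l}"
  define TR where "TR = (\<lambda>S. S \<inter> Y) ` F"
  have cY: "card Y \<le> 2 * l" unfolding Y_def using card_image_le[of "{..<2*l}" xs] by simp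
  have finTR: "finite TR" by (rule finite_subset[of _ "Pow Y"]) (auto simp: TR_def Y_def)
  have "card TR \<le> (card Y + 1) ^ d" unfolding TR_def using VC xs by (intro sauer_shelah) (auto simp: Y_def)
  also have "\<dots> \<le> (2 * l + 1) ^ d" using cY by (intro power_mono) auto
  finally have cTR: "real (card TR) \<le> (2 * real l + 1) ^ d"
    by (metis (mono_tags, lifting) of_nat_1 of_nat_add of_nat_le_iff of_nat_mult of_nat_numeral of_nat_power)
  define h where "h Z = (\<lambda>i. indicator Z (xs i) - indicator Z (xs (l + i)) :: real)" for Z
  have "\<bar>h Z i\<bar> \<le> 1" for Z i by (auto simp: h_def indicator_def)
  then obtain e where e: "\<And>i. e i = 1 \<or> e i = - (1::real)"
    and pot: "(\<Sum>t\<in>h ` TR. cosh (s * (\<Sum>i<l. e i * t i))) \<le> real (card (h ` TR)) * cosh s ^ l"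
    using sign_potential[of "h ` TR" s l] finTR by auto
  define ys where "ys i = (if e i = 1 then xs i else xs (l + i))" for i
  have ys: "ys ` {..<l} \<subseteq> xs ` {..<2*l}" by (auto simp: ys_def intro!: imageI)
  have "\<bar>frequency S l ys - frequency S (2*l) xs\<bar> \<le> ln (2 * (2 * real l + 1) ^ d) / (2 * real l * s) + s / 2" if S: "S \<in> F" for S
  proof -
    define D where "D = (\<Sum>i<l. e i * h (S \<inter> Y) i)"
    have hSY: "h (S \<inter> Y) i = h S i" if "i < l" for i
      using that by (auto simp: h_def indicator_def Y_def)
    have split: "{..<2*l} = {..<l} \<union> (\<lambda>i. l + i) ` {..<l}"
    proof -
      have "i \<in> (\<lambda>i. l + i) ` {..<l}" if "\<not> i < l" "i < 2 * l" for i
        by (rule image_eqI[of _ _ "i - l"]) (use that in auto)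
      then show ?thesis by auto
    qed
    have "(\<Sum>i<2*l. indicator S (xs i)) = (\<Sum>i<l. indicator S (xs i)) + (\<Sum>i<l. indicator S (xs (l+i)) :: real)"
      unfolding split by (subst sum.union_disjoint) (auto simp: sum.reindex)
    then have sum2: "(\<Sum>i<2*l. indicator S (xs i)) = (\<Sum>i<l. indicator S (xs i) + indicator S (xs (l+i)) :: real)"
      by (simp add: sum.distrib)
    have "2 * (\<Sum>i<l. indicator S (ys i)) - (\<Sum>i<2*l. indicator S (xs i)) = D"
      unfolding sum2 D_def sum_distrib_left sum_subtractf[symmetric]
    proof (rule sum.cong[OF refl])
      fix i assume "i \<in> {..<l}"
      then have "i < l" by simp
      show "2 * indicator S (ys i) - (indicator S (xs i) + indicator S (xs (l + i))) = e i * h (S \<inter> Y) i"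
        using e[of i] unfolding hSY[OF \<open>i < l\<close>] by (auto simp: ys_def h_def)
    qed
    then have av: "frequency S l ys - frequency S (2*l) xs = D / (2 * l)" using l by (simp add: frequency_def field_simps)
    have "exp (s * \<bar>D\<bar>) / 2 \<le> cosh (s * \<bar>D\<bar>)" by (simp add: cosh_def)
    also have "\<dots> = cosh (s * D)" using s cosh_real_abs[of "s * D"] by (simp add: abs_mult)
    also have "\<dots> \<le> (\<Sum>t\<in>h ` TR. cosh (s * (\<Sum>i<l. e i * t i)))"
      unfolding D_def using finTR S
      by (intro member_le_sum[of "h (S \<inter> Y)" "h ` TR" "\<lambda>t. cosh (s * (\<Sum>i<l. e i * t i))"]) (auto simp: TR_def)
    also have "\<dots> \<le> real (card (h ` TR)) * cosh s ^ l" by (rule pot)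
    also have "\<dots> \<le> (2 * real l + 1) ^ d * exp (s\<^sup>2) ^ l"
    proof (rule mult_mono)
      show "real (card (h ` TR)) \<le> (2 * real l + 1) ^ d"
        using cTR card_image_le[OF finTR, of h] by linarith
      show "cosh s ^ l \<le> exp (s\<^sup>2) ^ l" using cosh_le_exp_square[of s] s by (intro power_mono) auto
    qed auto
    finally have "exp (s * \<bar>D\<bar>) \<le> 2 * (2 * real l + 1) ^ d * exp (l * s\<^sup>2)"
      by (simp add: exp_of_nat_mult)
    then have "s * \<bar>D\<bar> \<le> ln (2 * (2 * real l + 1) ^ d * exp (l * s\<^sup>2))"
      by (subst ln_ge_iff) auto
    also have "\<dots> = ln (2 * (2 * real l + 1) ^ d) + l * s\<^sup>2" by (subst ln_mult) auto
    finally have "s * \<bar>D\<bar> / (2 * real l * s) \<le> (ln (2 * (2 * real l + 1) ^ d) + l * s\<^sup>2) / (2 * real l * s)"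
      using l s by (intro divide_right_mono) auto
    also have "\<dots> = ln (2 * (2 * real l + 1) ^ d) / (2 * real l * s) + s / 2"
      using l s by (simp add: field_simps power2_eq_square)
    finally show ?thesis using s l by (simp add: av)
  qed
  then show ?thesis by (intro exI[of _ ys] conjI ballI ys)
qed

text \<open>
  For \<open>s = l powr (-1/3)\<close> the error of one halving is of smaller order than \<open>l powr (-1/4)\<close>, hence is paid
  for by the increase of this quantity when \<open>2 * l\<close> is replaced by \<open>l\<close>. Summed over arbitrarily many
  halvings the errors stay below its last value.
\<close>

lemma halving_error_telescopes:
  fixes d :: nat
  obtains l0 :: nat where "l0 > 0" and
    "\<And>l. l \<ge> l0 \<Longrightarrow> ln (2 * (2 * real l + 1) ^ d) / (2 * real l * real l powr (-1/3)) + real l powr (-1/3) / 2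
        \<le> real l powr (-1/4) - (2 * real l) powr (-1/4)"
proof -
  have 1: "((\<lambda>l::nat. (ln 2 / (2 * real l * real l powr (-1/3)) + real l powr (-1/3) / 2) / real l powr (-1/4)) \<longlongrightarrow> 0) sequentially"
    by real_asymp
  have 2: "((\<lambda>l::nat. ln (2 * real l + 1) / (2 * real l * real l powr (-1/3)) / real l powr (-1/4)) \<longlongrightarrow> 0) sequentially"
    by real_asymp
  define c where "c = 1 - (2::real) powr (-1/4)"
  have "c > 0" unfolding c_def using powr_less_cancel_iff[of 2 "-1/4" 0] by simp
  have "((\<lambda>l::nat. (ln 2 / (2 * real l * real l powr (-1/3)) + real l powr (-1/3) / 2) / real l powr (-1/4)
      + real d * (ln (2 * real l + 1) / (2 * real l * real l powr (-1/3)) / real l powr (-1/4))) \<longlongrightarrow> 0 + real d * 0) sequentially"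
    by (intro tendsto_intros 1 2)
  then have "eventually (\<lambda>l::nat. (ln 2 / (2 * real l * real l powr (-1/3)) + real l powr (-1/3) / 2) / real l powr (-1/4)
      + real d * (ln (2 * real l + 1) / (2 * real l * real l powr (-1/3)) / real l powr (-1/4)) < c) sequentially"
    using \<open>c > 0\<close> by (intro order_tendstoD) auto
  then have "eventually (\<lambda>l::nat. (ln 2 + real d * ln (2 * real l + 1)) / (2 * real l * real l powr (-1/3)) + real l powr (-1/3) / 2
        \<le> real l powr (-1/4) - (2 * real l) powr (-1/4)) sequentially"
    using eventually_gt_at_top[of 0]
  proof eventually_elim
    case (elim l)
    have "(ln 2 + real d * ln (2 * real l + 1)) / (2 * real l * real l powr (-1/3)) + real l powr (-1/3) / 2
      = real l powr (-1/4) * ((ln 2 / (2 * real l * real l powr (-1/3)) + real l powr (-1/3) / 2) / real l powr (-1/4)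
      + real d * (ln (2 * real l + 1) / (2 * real l * real l powr (-1/3)) / real l powr (-1/4)))"
      using elim(2) by (simp add: distrib_left add_divide_distrib)
    also have "\<dots> \<le> real l powr (-1/4) * c" using elim by (intro mult_left_mono) auto
    also have "\<dots> = real l powr (-1/4) - (2 * real l) powr (-1/4)" by (simp add: c_def algebra_simps powr_mult)
    finally show ?case .
  qed
  then obtain l0 where "\<And>l. l \<ge> l0 \<Longrightarrow> (ln 2 + real d * ln (2 * real l + 1)) / (2 * real l * real l powr (-1/3)) + real l powr (-1/3) / 2
        \<le> real l powr (-1/4) - (2 * real l) powr (-1/4)" by (auto simp: eventually_sequentially)
  moreover have "ln (2 * (2 * real l + 1) ^ d) = ln 2 + real d * ln (2 * real l + 1)" for l
    by (simp add: ln_mult ln_realpow)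
  ultimately show ?thesis by (intro that[of "Suc l0"]) auto
qed

text \<open>
  The final size \<open>l\<close> is chosen before the number \<open>k\<close> of halvings: the initial sample may be as long as
  one likes.
\<close>

lemma repeated_halving:
  assumes VC: "VC_dim_le d K F" and "\<epsilon> > 0"
  obtains l where "l > 0" "\<And>k xs. xs ` {..<l * 2^k} \<subseteq> K \<Longrightarrow>
    \<exists>ys. ys ` {..<l} \<subseteq> xs ` {..<l * 2^k} \<and> (\<forall>S\<in>F. \<bar>frequency S l ys - frequency S (l * 2^k) xs\<bar> \<le> \<epsilon>)"
proof -
  obtain l0 where l0: "l0 > 0" and tele: "\<And>l. l \<ge> l0 \<Longrightarrow> ln (2 * (2 * real l + 1) ^ d) / (2 * real l * real l powr (-1/3)) + real l powr (-1/3) / 2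
        \<le> real l powr (-1/4) - (2 * real l) powr (-1/4)" using halving_error_telescopes by blast
  have "((\<lambda>l::nat. real l powr (-1/4)) \<longlongrightarrow> 0) sequentially" by real_asymp
  then have "eventually (\<lambda>l::nat. real l powr (-1/4) < \<epsilon>) sequentially"
    using \<open>\<epsilon> > 0\<close> by (rule order_tendstoD)
  then have "eventually (\<lambda>l::nat. real l powr (-1/4) < \<epsilon> \<and> l \<ge> l0) sequentially"
    using eventually_ge_at_top[of l0] by eventually_elim simp
  then obtain l where l: "l \<ge> l0" "real l powr (-1/4) < \<epsilon>"
    using eventually_happens[of _ "sequentially :: nat filter"] by auto
  have main: "\<exists>ys. ys ` {..<l} \<subseteq> xs ` {..<l * 2^k} \<and>
      (\<forall>S\<in>F. \<bar>frequency S l ys - frequency S (l * 2^k) xs\<bar> \<le> real l powr (-1/4) - real (l * 2^k) powr (-1/4))"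
    if "xs ` {..<l * 2^k} \<subseteq> K" for k xs
    using that
  proof (induction k arbitrary: xs)
    case 0
    show ?case by (rule exI[of _ xs]) auto
  next
    case (Suc k)
    define m where "m = l * 2^k"
    have m: "m \<ge> l0" "m > 0" using l l0 by (auto simp: m_def intro: order_trans)
    have m2: "l * 2 ^ Suc k = 2 * m" by (simp add: m_def)
    have "real m powr (-1/3) \<le> 1" using m(2) by (simp add: powr_le_one_le ge_one_powr_ge_zero powr_minus_divide)
    then obtain ys where ys: "ys ` {..<m} \<subseteq> xs ` {..<2*m}"
      and e1: "\<And>S. S\<in>F \<Longrightarrow> \<bar>frequency S m ys - frequency S (2*m) xs\<bar> \<le> ln (2 * (2 * real m + 1) ^ d) / (2 * real m * real m powr (-1/3)) + real m powr (-1/3) / 2"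
      using halving[OF VC m(2), of xs "real m powr (-1/3)"] Suc.prems[unfolded m2] m(2) by auto
    have "ys ` {..<m} \<subseteq> K" using ys Suc.prems[unfolded m2] by auto
    then obtain zs where zs: "zs ` {..<l} \<subseteq> ys ` {..<m}"
      and e2: "\<And>S. S\<in>F \<Longrightarrow> \<bar>frequency S l zs - frequency S m ys\<bar> \<le> real l powr (-1/4) - real m powr (-1/4)"
      using Suc.IH[of ys] by (auto simp: m_def)
    have "\<bar>frequency S l zs - frequency S (2*m) xs\<bar> \<le> real l powr (-1/4) - real (2*m) powr (-1/4)" if "S \<in> F" for S
      using e1[OF that] e2[OF that] tele[OF m(1)] by simp
    then show ?case unfolding m2 by (intro exI[of _ zs] conjI ballI subset_trans[OF zs ys])
  qed
  show ?thesis
  proof (rule that[of l])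
    show "l > 0" using l l0 by simp
    fix k and xs :: "nat \<Rightarrow> 'a" assume "xs ` {..<l * 2^k} \<subseteq> K"
    then show "\<exists>ys. ys ` {..<l} \<subseteq> xs ` {..<l * 2^k} \<and> (\<forall>S\<in>F. \<bar>frequency S l ys - frequency S (l * 2^k) xs\<bar> \<le> \<epsilon>)"
      using main[of xs k] l(2) by (smt (verit, best) powr_ge_zero)
  qed
qed

lemma list_with_multiplicities:
  fixes m :: "'b \<Rightarrow> nat"
  assumes "finite V" "(\<Sum>v\<in>V. m v) = N"
  obtains xs where "xs ` {..<N} \<subseteq> V" "\<And>f :: 'b \<Rightarrow> real. (\<Sum>i<N. f (xs i)) = (\<Sum>v\<in>V. m v * f v)"
proof -
  define M where "M = (\<Sum>v\<in>V. replicate_mset (m v) v)"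
  obtain zs where zs: "mset zs = M" using ex_mset by blast
  have "size M = N" unfolding M_def assms(2)[symmetric] by (simp add: size_multiset_sum)
  then have len: "length zs = N" using zs by (metis size_mset)
  have "set_mset M \<subseteq> V" unfolding M_def using assms(1) by (subst set_mset_sum) auto
  then have sub: "(\<lambda>i. zs ! i) ` {..<N} \<subseteq> V" using zs len by (metis (no_types, lifting) image_subset_iff lessThan_iff nth_mem set_mset_mset subset_iff)
  have "(\<Sum>i<N. f (zs ! i)) = (\<Sum>v\<in>V. m v * f v)" for f :: "'b \<Rightarrow> real"
  proof -
    have "(\<Sum>i<N. f (zs ! i)) = sum_list (map f zs)"
      by (simp add: sum_list_sum_nth len atLeast0LessThan)
    also have "\<dots> = sum_mset (image_mset f M)" using zs by (metis mset_map sum_mset_sum_list)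
    also have "\<dots> = (\<Sum>v\<in>V. m v * f v)"
      unfolding M_def using assms(1) by (induction V rule: finite_induct) (auto simp: sum_mset.union)
    finally show ?thesis .
  qed
  then show ?thesis using that sub by blast
qed

text \<open>
  The theorem of Vapnik and Chervonenkis for finitely supported probabilities \<open>W\<close>. Rounding the weights
  to multiples of a small fraction turns \<open>W\<close> into a long list of points, which is then halved. That
  \<open>n\<close> does not depend on \<open>V\<close> and \<open>W\<close> is what makes the passage to compact spaces possible.
\<close>

lemma finite_eps_approximation:
  assumes VC: "VC_dim_le d K F" and "\<epsilon> > 0"
  obtains n where "n > 0" "\<And>V W. \<lbrakk>finite V; V \<subseteq> K; \<And>v. v \<in> V \<Longrightarrow> W v \<ge> 0; (\<Sum>v\<in>V. W v) = (1::real)\<rbrakk> \<Longrightarrow>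
    \<exists>q. q ` {..<n} \<subseteq> V \<and> (\<forall>S\<in>F. \<bar>(\<Sum>v\<in>V \<inter> S. W v) - frequency S n q\<bar> \<le> \<epsilon>)"
proof -
  obtain l where l: "l > 0" and half: "\<And>k xs. xs ` {..<l * 2^k} \<subseteq> K \<Longrightarrow>
    \<exists>ys. ys ` {..<l} \<subseteq> xs ` {..<l * 2^k} \<and> (\<forall>S\<in>F. \<bar>frequency S l ys - frequency S (l * 2^k) xs\<bar> \<le> \<epsilon> / 2)"
    by (rule repeated_halving[OF VC half_gt_zero[OF \<open>\<epsilon> > 0\<close>]]) blast
  have "\<exists>q. q ` {..<l} \<subseteq> V \<and> (\<forall>S\<in>F. \<bar>(\<Sum>v\<in>V \<inter> S. W v) - frequency S l q\<bar> \<le> \<epsilon>)"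
    if V: "finite V" "V \<subseteq> K" and W0: "\<And>v. v \<in> V \<Longrightarrow> W v \<ge> 0" and W1: "(\<Sum>v\<in>V. W v) = (1::real)" for V W
  proof -
    obtain v0 where v0: "v0 \<in> V" using W1 by fastforce
    \<comment> \<open>The list is so long that rounding changes no weight sum by more than \<open>\<epsilon> / 2\<close>.\<close>
    obtain k :: nat where k: "real (card V) / (\<epsilon> / 2) < 2 ^ k"
      using real_arch_pow[of 2] by auto
    define N where "N = l * 2 ^ k"
    have N0: "N > 0" using l by (simp add: N_def)
    have "(2::real) ^ k \<le> real N" using l by (simp add: N_def)
    then have "\<epsilon> / 2 * 2 ^ k \<le> \<epsilon> / 2 * real N" using \<open>\<epsilon> > 0\<close> by (intro mult_left_mono) auto
    moreover have "real (card V) < \<epsilon> / 2 * 2 ^ k" using k \<open>\<epsilon> > 0\<close> by (simp add: field_simps)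
    ultimately have "real (card V) \<le> \<epsilon> / 2 * real N" by linarith
    then have cVN: "card V / N \<le> \<epsilon> / 2" using N0 by (simp add: divide_le_eq)
    define fl where "fl v = nat \<lfloor>N * W v\<rfloor>" for v
    have fl: "real (fl v) \<le> N * W v" "N * W v \<le> real (fl v) + 1" if "v \<in> V" for v
      using W0[OF that] unfolding fl_def by auto
    have NW: "(\<Sum>v\<in>V. N * W v) = N" using W1 by (simp add: sum_distrib_left[symmetric])
    have "real (\<Sum>v\<in>V. fl v) \<le> N" using sum_mono[of V "\<lambda>v. real (fl v)" "\<lambda>v. N * W v"] fl(1) NW by simp
    then have flN: "(\<Sum>v\<in>V. fl v) \<le> N" by linarith
    define r where "r = N - (\<Sum>v\<in>V. fl v)"
    have "N \<le> real (\<Sum>v\<in>V. fl v) + card V"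
      using sum_mono[of V "\<lambda>v. N * W v" "\<lambda>v. real (fl v) + 1"] fl(2) NW by (simp add: sum.distrib)
    then have r: "real r \<le> card V" using flN by (simp add: r_def)
    \<comment> \<open>The mass lost by rounding down is put on one point.\<close>
    define m where "m v = fl v + (if v = v0 then r else 0)" for v
    have "(\<Sum>v\<in>V. m v) = N" using V(1) v0 flN by (simp add: m_def sum.distrib r_def)
    then obtain xs where xs: "xs ` {..<N} \<subseteq> V" and cnt: "\<And>f :: _ \<Rightarrow> real. (\<Sum>i<N. f (xs i)) = (\<Sum>v\<in>V. m v * f v)"
      using list_with_multiplicities[OF V(1)] by metis
    have err: "\<bar>(\<Sum>v\<in>V \<inter> S. W v) - frequency S N xs\<bar> \<le> \<epsilon> / 2" for S
    proof -
      have ind: "(\<Sum>v\<in>V. c v * indicator S v) = (\<Sum>v\<in>V \<inter> S. c v)" for c :: "_ \<Rightarrow> real"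
        using V(1) by (simp add: sum.inter_restrict indicator_def if_distrib cong: if_cong)
      have "N * frequency S N xs = (\<Sum>v\<in>V. real (m v) * indicat_real S v)" using cnt[of "indicator S"] N0 by (simp add: frequency_def)
      also have "\<dots> = (\<Sum>v\<in>V \<inter> S. real (m v))" by (rule ind)
      also have "\<dots> = (\<Sum>v\<in>V \<inter> S. real (fl v)) + (if v0 \<in> S then r else 0)"
        using V(1) v0 by (simp add: m_def sum.distrib if_distrib[of real] cong: if_cong)
      finally have Nav: "N * frequency S N xs = (\<Sum>v\<in>V \<inter> S. real (fl v)) + (if v0 \<in> S then r else 0)" .
      have lo: "(\<Sum>v\<in>V \<inter> S. real (fl v)) \<le> N * (\<Sum>v\<in>V \<inter> S. W v)"
        unfolding sum_distrib_left by (rule sum_mono) (use fl in auto)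
      have "N * (\<Sum>v\<in>V \<inter> S. W v) \<le> (\<Sum>v\<in>V \<inter> S. real (fl v) + 1)"
        unfolding sum_distrib_left by (rule sum_mono) (use fl in auto)
      also have "\<dots> \<le> (\<Sum>v\<in>V \<inter> S. real (fl v)) + card V"
        using V(1) card_mono[of V "V \<inter> S"] by (simp add: sum.distrib)
      finally have "\<bar>N * (\<Sum>v\<in>V \<inter> S. W v) - N * frequency S N xs\<bar> \<le> card V"
        using lo r unfolding Nav by (auto simp: abs_le_iff)
      then have "N * \<bar>(\<Sum>v\<in>V \<inter> S. W v) - frequency S N xs\<bar> \<le> card V"
        by (metis abs_mult abs_of_nat right_diff_distrib)
      then have "\<bar>(\<Sum>v\<in>V \<inter> S. W v) - frequency S N xs\<bar> \<le> card V / N" using N0 by (simp add: field_simps)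
      then show ?thesis using cVN by linarith
    qed
    have "xs ` {..<l * 2^k} \<subseteq> K" using xs V(2) by (auto simp: N_def)
    from half[OF this] obtain ys where "ys ` {..<l} \<subseteq> xs ` {..<N} \<and> (\<forall>S\<in>F. \<bar>frequency S l ys - frequency S N xs\<bar> \<le> \<epsilon> / 2)"
      unfolding N_def by (elim exE)
    then have ys: "ys ` {..<l} \<subseteq> xs ` {..<N}" "\<And>S. S\<in>F \<Longrightarrow> \<bar>frequency S l ys - frequency S N xs\<bar> \<le> \<epsilon> / 2"
      by auto
    have "\<bar>(\<Sum>v\<in>V \<inter> S. W v) - frequency S l ys\<bar> \<le> \<epsilon>" if "S \<in> F" for S
      using err[of S] ys(2)[OF that] by linarith
    then show ?thesis using ys(1) xs by (intro exI[of _ ys] conjI ballI) auto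
  qed
  then show ?thesis using that[of l] l by auto
qed

section \<open>Uniform approximation on compact spaces\<close>

lemma continuous_map_indicator_clopen:
  assumes "openin Y (topspace Y \<inter> C)" "closedin Y (topspace Y \<inter> C)"
  shows "continuous_map Y euclideanreal (indicator C)"
  unfolding continuous_map
proof (intro conjI allI impI)
  fix U :: "real set"
  have "openin Y (topspace Y - C)"
    using assms(2) unfolding closedin_def by (metis Diff_Int_distrib2 Diff_cancel Diff_empty Diff_Int2 Int_commute Diff_Int Un_empty_left)
  moreover have "{x \<in> topspace Y. indicator C x \<in> U} =
    (if (1::real) \<in> U then topspace Y \<inter> C else {}) \<union> (if (0::real) \<in> U then topspace Y - C else {})"
    by (auto simp: indicator_def split: if_splits)
  ultimately show "openin Y {x \<in> topspace Y. indicator C x \<in> U}" using assms(1) by auto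
qed auto

text \<open>
  Finitely many of the sets \<open>H i\<close> cut \<open>K\<close> into finitely many pieces; choosing one point in each reduces
  this subfamily to the finite theorem, with a sample size that does not depend on the subfamily. For a
  single \<open>i\<close> the good samples form a closed subset of the compact space \<open>K\<^sup>n\<close>, so there is a sample that
  is good for all \<open>i\<close>.
\<close>

lemma VC_approx_compact:
  fixes X :: "'b topology" and H :: "'i \<Rightarrow> 'b set"
  assumes K: "compactin X K" and P: "prob_space P" "K \<in> sets P" "measure P K > 0"
    and H: "\<And>i. i \<in> I \<Longrightarrow> H i \<in> sets P"
    and clopen: "\<And>i. i \<in> I \<Longrightarrow> openin (subtopology X K) (K \<inter> H i)"
      "\<And>i. i \<in> I \<Longrightarrow> closedin (subtopology X K) (K \<inter> H i)"
    and VC: "VC_dim_le d K (H ` I)" and \<epsilon>: "\<epsilon> > 0"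
  obtains n q where "n > 0" "q ` {..<n} \<subseteq> K"
    "\<And>i. i \<in> I \<Longrightarrow> \<bar>measure P (K \<inter> H i) / measure P K - frequency (H i) n q\<bar> \<le> \<epsilon>"
proof -
  interpret P: prob_space P by (rule P)
  define m where "m i = measure P (K \<inter> H i) / measure P K" for i
  obtain n where n: "n > 0" and fin: "\<And>V W. \<lbrakk>finite V; V \<subseteq> K; \<And>v. v \<in> V \<Longrightarrow> W v \<ge> 0; (\<Sum>v\<in>V. W v) = (1::real)\<rbrakk> \<Longrightarrow>
    \<exists>q. q ` {..<n} \<subseteq> V \<and> (\<forall>S\<in>H ` I. \<bar>(\<Sum>v\<in>V \<inter> S. W v) - frequency S n q\<bar> \<le> \<epsilon>)"
    by (rule finite_eps_approximation[OF VC \<epsilon>]) blast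
  have finite_case: "\<exists>q. q ` {..<n} \<subseteq> K \<and> (\<forall>i\<in>I0. \<bar>m i - frequency (H i) n q\<bar> \<le> \<epsilon>)" if I0: "finite I0" "I0 \<subseteq> I" for I0
  proof -
    \<comment> \<open>Points with the same pattern are not distinguished by the sets \<open>H i\<close>, \<open>i \<in> I0\<close>.\<close>
    define pat where "pat k = {i\<in>I0. k \<in> H i}" for k
    define rep where "rep J = (SOME k. k \<in> K \<and> pat k = J)" for J
    define V where "V = rep ` (pat ` K)"
    have rep: "rep (pat k) \<in> K" "pat (rep (pat k)) = pat k" if "k \<in> K" for k
      using someI[of "\<lambda>k'. k' \<in> K \<and> pat k' = pat k" k] that by (auto simp: rep_def)
    have "finite (pat ` K)" by (rule finite_subset[of _ "Pow I0"]) (auto simp: pat_def I0)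
    then have finV: "finite V" by (simp add: V_def)
    have VK: "V \<subseteq> K" using rep by (auto simp: V_def)
    have repV: "rep (pat v) = v" if "v \<in> V" for v using that rep by (auto simp: V_def)
    define cell where "cell v = {k\<in>K. pat k = pat v}" for v
    have cell: "cell v \<in> sets P" if "v \<in> K" for v
    proof -
      have "cell v = K - ((\<Union>i\<in>pat v. K - H i) \<union> (\<Union>i\<in>I0 - pat v. H i))"
        by (auto simp: cell_def pat_def)
      moreover have "finite (pat v)" "pat v \<subseteq> I0" using I0 by (auto simp: pat_def)
      then have "(\<Union>i\<in>pat v. K - H i) \<in> sets P" using I0(2) P(2) H by (intro sets.finite_UN sets.Diff) auto
      moreover have "(\<Union>i\<in>I0 - pat v. H i) \<in> sets P" using I0 H by (intro sets.finite_UN) auto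
      ultimately show ?thesis using P(2) by (simp only: sets.Diff sets.Un)
    qed
    define W where "W v = measure P (cell v) / measure P K" for v
    have sumW: "(\<Sum>v\<in>V'. W v) = measure P {k\<in>K. rep (pat k) \<in> V'} / measure P K" if V': "V' \<subseteq> V" for V'
    proof -
      have "finite V'" using V' finV finite_subset by blast
      moreover have "disjoint_family_on cell V'"
        unfolding disjoint_family_on_def
      proof (intro ballI impI)
        fix v w assume "v \<in> V'" "w \<in> V'" "v \<noteq> w"
        then have "pat v \<noteq> pat w" using repV V' by (metis subsetD)
        then show "cell v \<inter> cell w = {}" by (auto simp: cell_def)
      qed
      ultimately have "measure P (\<Union>v\<in>V'. cell v) = (\<Sum>v\<in>V'. measure P (cell v))"
        using cell V' VK by (intro P.finite_measure_finite_Union) auto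
      moreover have "(\<Union>v\<in>V'. cell v) = {k\<in>K. rep (pat k) \<in> V'}"
        using repV V' by (auto simp: cell_def rep dest: subsetD)
      ultimately show ?thesis by (simp add: W_def sum_divide_distrib)
    qed
    have "(\<Sum>v\<in>V. W v) = 1"
    proof -
      have "{k\<in>K. rep (pat k) \<in> V} = K" by (auto simp: V_def)
      then show ?thesis using sumW[of V] P(3) by simp
    qed
    then obtain q where q: "q ` {..<n} \<subseteq> V" "\<And>S. S\<in>H ` I \<Longrightarrow> \<bar>(\<Sum>v\<in>V \<inter> S. W v) - frequency S n q\<bar> \<le> \<epsilon>"
      using fin[OF finV VK, of W] by (auto simp: W_def)
    have "\<bar>m i - frequency (H i) n q\<bar> \<le> \<epsilon>" if i: "i \<in> I0" for i
    proof -
      have "rep (pat k) \<in> H i \<longleftrightarrow> k \<in> H i" if "k \<in> K" for k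
        using rep(2)[OF that] i unfolding pat_def by blast
      then have "{k\<in>K. rep (pat k) \<in> V \<inter> H i} = K \<inter> H i" by (auto simp: V_def)
      then have "(\<Sum>v\<in>V \<inter> H i. W v) = m i" using sumW[of "V \<inter> H i"] by (simp add: m_def)
      then show ?thesis using q(2)[of "H i"] i I0 by auto
    qed
    then show ?thesis using q(1) VK by blast
  qed
  define Z where "Z = product_topology (\<lambda>_::nat. subtopology X K) {..<n}"
  have topK: "topspace (subtopology X K) = K" using compactin_subset_topspace[OF K] by auto
  have Z: "compact_space Z" "topspace Z = PiE {..<n} (\<lambda>_. K)"
    using compact_space_subtopology[OF K] by (simp_all only: Z_def compact_space_product_topology topspace_product_topology topK simp_thms) blast
  define E where "E i = {q \<in> topspace Z. frequency (H i) n q \<in> {m i - \<epsilon>..m i + \<epsilon>}}" for i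
  have closed: "closedin Z (E i)" if "i \<in> I" for i
    unfolding E_def
  proof (rule closedin_continuous_map_preimage)
    have "continuous_map Z euclideanreal (\<lambda>q. indicator (H i) (q j))" if "j < n" for j
    proof -
      have "continuous_map Z (subtopology X K) (\<lambda>q. q j)"
        unfolding Z_def using that by (intro continuous_map_product_projection) auto
      moreover have "continuous_map (subtopology X K) euclideanreal (indicator (H i))"
        using clopen[OF \<open>i \<in> I\<close>] topK by (intro continuous_map_indicator_clopen) auto
      ultimately show ?thesis using continuous_map_compose[of Z _ "\<lambda>q. q j" _ "indicator (H i) :: 'b \<Rightarrow> real"] by (simp add: comp_def)
    qed
    then have "continuous_map Z euclideanreal (\<lambda>q. \<Sum>j<n. indicator (H i) (q j))"
      by (intro continuous_map_sum) auto
    then show "continuous_map Z euclideanreal (frequency (H i) n)"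
      using continuous_map_real_mult_right[of Z _ "1 / real n"] by (auto simp: frequency_def[abs_def])
  qed auto
  have "\<Inter> (insert (topspace Z) (E ` I)) \<noteq> {}"
  proof (rule Z(1)[unfolded compact_space_fip, rule_format])
    show "(\<forall>C\<in>insert (topspace Z) (E ` I). closedin Z C) \<and>
       (\<forall>\<F>. finite \<F> \<and> \<F> \<subseteq> insert (topspace Z) (E ` I) \<longrightarrow> \<Inter> \<F> \<noteq> {})"
    proof (intro conjI ballI allI impI)
      show "closedin Z C" if "C \<in> insert (topspace Z) (E ` I)" for C using that closed by auto
      fix \<F> assume F: "finite \<F> \<and> \<F> \<subseteq> insert (topspace Z) (E ` I)"
      then have "finite (\<F> - {topspace Z})" "\<F> - {topspace Z} \<subseteq> E ` I" by auto
      then obtain I0 where I0: "finite I0" "I0 \<subseteq> I" "\<F> - {topspace Z} = E ` I0" by (meson finite_subset_image)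
      obtain q where q: "q ` {..<n} \<subseteq> K" "\<And>i. i\<in>I0 \<Longrightarrow> \<bar>m i - frequency (H i) n q\<bar> \<le> \<epsilon>"
        using finite_case[OF I0(1,2)] by auto
      define q' where "q' = restrict q {..<n}"
      have "q' \<in> topspace Z" using q(1) by (auto simp: Z(2) q'_def)
      moreover have "frequency S n q' = frequency S n q" for S by (simp add: frequency_def q'_def)
      ultimately have "q' \<in> E i" if "i \<in> I0" for i using q(2)[OF that] by (auto simp: E_def abs_le_iff)
      then have "q' \<in> \<Inter> \<F>" using I0(3) \<open>q' \<in> topspace Z\<close> by blast
      then show "\<Inter> \<F> \<noteq> {}" by blast
    qed
  qed
  then obtain q where q: "q \<in> topspace Z" "\<And>i. i \<in> I \<Longrightarrow> q \<in> E i" by auto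
  show ?thesis
  proof (rule that[of n q])
    show "q ` {..<n} \<subseteq> K" using q(1) by (auto simp: Z(2))
    show "\<bar>measure P (K \<inter> H i) / measure P K - frequency (H i) n q\<bar> \<le> \<epsilon>" if "i \<in> I" for i
      using q(2)[OF that] unfolding m_def[symmetric] by (auto simp: E_def abs_le_iff)
  qed (rule n)
qed

lemma frequency_eq_1:
  assumes "n > 0" "q ` {..<n} \<subseteq> S" shows "frequency S n q = 1"
proof -
  have "(\<Sum>i<n. indicator S (q i)) = (\<Sum>i<n. 1::real)" using assms by (intro sum.cong) auto
  then show ?thesis using assms by (simp add: frequency_def)
qed

lemma frequency_eq_0:
  assumes "q ` {..<n} \<inter> S = {}" shows "frequency S n q = 0"
  using assms by (auto simp: frequency_def indicator_def intro!: sum.neutral)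

lemma frequency_cong:
  assumes "S \<inter> q ` {..<n} = S' \<inter> q ` {..<n}" shows "frequency S n q = frequency S' n q"
proof -
  have "indicator S (q i) = (indicator S' (q i) :: real)" if "i < n" for i
    using assms that by (auto simp: indicator_def)
  then show ?thesis by (simp add: frequency_def)
qed

lemma borel_of_openin: "openin X U \<Longrightarrow> U \<in> sets (borel_of X)"
  unfolding borel_of_def by (subst sets_measure_of) (auto dest: openin_subset)

lemma space_borel_of [simp]: "space (borel_of X) = topspace X"
  by (simp add: borel_of_def space_measure_of_conv)

lemma borel_of_closedin: "closedin X C \<Longrightarrow> C \<in> sets (borel_of X)"
proof -
  assume "closedin X C"
  then have "topspace X - (topspace X - C) \<in> sets (borel_of X)"
    using borel_of_openin[of X "topspace X - C"] sets.compl_sets[of "topspace X - C" "borel_of X"] by (simp add: closedin_def)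
  then show ?thesis using \<open>closedin X C\<close> by (simp add: closedin_subset double_diff)
qed

lemma regular_inner:
  assumes reg: "regular_borel_prob X P" and B: "B \<in> sets P" and "\<delta> > 0"
  obtains K where "compactin X K" "K \<subseteq> B" "measure P K > measure P B - \<delta>"
proof -
  interpret prob_space P using reg by (simp add: regular_borel_prob_def)
  have eq: "emeasure P B = (SUP K\<in>{K. compactin X K \<and> K \<subseteq> B}. emeasure P K)"
    using reg B unfolding regular_borel_prob_def by blast
  show ?thesis
  proof (cases "measure P B \<le> \<delta> / 2")
    case True
    then show ?thesis using that[of "{}"] \<open>\<delta> > 0\<close> by simp
  next
    case False
    then have "ennreal (measure P B - \<delta>) < emeasure P B"
      using \<open>\<delta> > 0\<close> by (simp add: emeasure_eq_measure ennreal_lessI)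
    then obtain K where K: "compactin X K" "K \<subseteq> B" "ennreal (measure P B - \<delta>) < emeasure P K"
      unfolding eq by (auto simp: less_SUP_iff)
    have "measure P B - \<delta> < measure P K"
      using K(3) by (simp add: emeasure_eq_measure ennreal_less_iff not_le[symmetric]) (metis K(3) emeasure_eq_measure ennreal_leI linorder_not_le)
    then show ?thesis using that K by blast
  qed
qed

context
  fixes X :: "'b topology" and P :: "'b measure" and F :: "'i \<Rightarrow> 'b set" and I :: "'i set" and d :: nat
  assumes X: "compact_space X" "Hausdorff_space X" and reg: "regular_borel_prob X P"
    and clopen: "\<And>a. a \<in> I \<Longrightarrow> openin X (F a)" "\<And>a. a \<in> I \<Longrightarrow> closedin X (F a)"
    and VC: "VC_dim_le d (topspace X) (F ` I)"
begin

lemma sets_P: "sets P = sets (borel_of X)" and prob_P: "prob_space P" and space_P: "space P = topspace X"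
  using reg sets_eq_imp_space_eq[of P "borel_of X"] by (auto simp: regular_borel_prob_def)

text \<open>
  The measure of \<open>F a\<close> inside \<open>K\<close> is nearly determined once \<open>F a\<close> contains, or avoids, a suitable finite
  subset of \<open>K\<close>: a sample approximating the measure conditioned on \<open>K\<close> has frequency one or zero.
\<close>

lemma compact_witnesses:
  assumes K: "compactin X K" and "\<delta> > 0"
  obtains Q where "finite Q" "Q \<subseteq> K"
    "\<And>a. \<lbrakk>a \<in> I; Q \<subseteq> F a\<rbrakk> \<Longrightarrow> measure P (K \<inter> F a) \<ge> measure P K - \<delta>"
    "\<And>a. \<lbrakk>a \<in> I; Q \<inter> F a = {}\<rbrakk> \<Longrightarrow> measure P (K \<inter> F a) \<le> \<delta>"
proof -
  interpret prob_space P by (rule prob_P)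
  have Kc: "closedin X K" using compactin_imp_closedin[OF X(2) K] .
  then have KP: "K \<in> sets P" by (simp add: sets_P borel_of_closedin)
  show ?thesis
  proof (cases "measure P K > 0")
    case False
    then have z: "measure P K = 0" by (simp add: not_less measure_le_0_iff)
    have "measure P (K \<inter> F a) \<le> measure P K" for a using KP by (intro finite_measure_mono) auto
    then show ?thesis using that[of "{}"] \<open>\<delta> > 0\<close> z by (auto simp: measure_le_0_iff)
  next
    case True
    have sub: "VC_dim_le d K (F ` I)" using VC closedin_subset[OF Kc] unfolding VC_dim_le_def by blast
    obtain n q where nq: "n > 0" "q ` {..<n} \<subseteq> K"
      "\<And>i. i \<in> I \<Longrightarrow> \<bar>measure P (K \<inter> F i) / measure P K - frequency (F i) n q\<bar> \<le> \<delta>"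
    proof (rule VC_approx_compact[OF K prob_P KP True _ _ _ sub \<open>\<delta> > 0\<close>])
      show "F i \<in> sets P" if "i \<in> I" for i using clopen(1)[OF that] by (simp add: sets_P borel_of_openin)
      show "openin (subtopology X K) (K \<inter> F i)" if "i \<in> I" for i
        using clopen(1)[OF that] by (auto simp: openin_subtopology)
      show "closedin (subtopology X K) (K \<inter> F i)" if "i \<in> I" for i
        using clopen(2)[OF that] by (auto simp: closedin_subtopology)
    qed blast
    have le1: "measure P K \<le> 1" by simp
    show ?thesis
    proof (rule that[of "q ` {..<n}"])
      fix a assume a: "a \<in> I"
      show "measure P (K \<inter> F a) \<ge> measure P K - \<delta>" if "q ` {..<n} \<subseteq> F a"
      proof -
        have "1 - \<delta> \<le> measure P (K \<inter> F a) / measure P K"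
          using nq(3)[OF a] frequency_eq_1[OF nq(1) that] by (auto simp: abs_le_iff)
        then have "measure P K * (1 - \<delta>) \<le> measure P (K \<inter> F a)" using True by (simp add: pos_le_divide_eq mult.commute)
        moreover have "measure P K * \<delta> \<le> \<delta>" using le1 \<open>\<delta> > 0\<close> by (simp add: mult_left_le_one_le)
        ultimately show ?thesis by (simp add: algebra_simps)
      qed
      show "measure P (K \<inter> F a) \<le> \<delta>" if "q ` {..<n} \<inter> F a = {}"
      proof -
        have "measure P (K \<inter> F a) / measure P K \<le> \<delta>"
          using nq(3)[OF a] frequency_eq_0[OF that] by (auto simp: abs_le_iff)
        then have "measure P (K \<inter> F a) \<le> \<delta> * measure P K" using True by (simp add: pos_divide_le_eq)
        also have "\<dots> \<le> \<delta>" using le1 \<open>\<delta> > 0\<close> by (simp add: mult_left_le)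
        finally show ?thesis .
      qed
    qed (use nq in auto)
  qed
qed

text \<open>
  The sample good for the clopen sets \<open>F a\<close> is also good for every Borel set \<open>B\<close> that agrees with some
  \<open>F a\<close> on each finite set. By regularity \<open>B\<close> and its complement contain compact sets \<open>K1\<close> and \<open>K0\<close> of
  almost the same measure. If \<open>F a\<close> agrees with \<open>B\<close> on the witnesses of \<open>K1\<close> and \<open>K0\<close>, it contains most
  of \<open>K1\<close> and little of \<open>K0\<close>, so its measure is close to that of \<open>B\<close>; if it also agrees with \<open>B\<close> on the
  sample, the frequencies are equal.
\<close>

lemma uniform_approx_pointwise_closure:
  assumes "\<epsilon> > 0"
  obtains n r where "n > 0" "r ` {..<n} \<subseteq> topspace X"
    "\<And>B. \<lbrakk>B \<in> sets P; \<And>Q. \<lbrakk>finite Q; Q \<subseteq> topspace X\<rbrakk> \<Longrightarrow> \<exists>a\<in>I. F a \<inter> Q = B \<inter> Q\<rbrakk>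
      \<Longrightarrow> \<bar>measure P B - frequency B n r\<bar> \<le> \<epsilon>"
proof -
  interpret prob_space P by (rule prob_P)
  have top: "topspace X \<in> sets P" "measure P (topspace X) = 1" using sets.top[of P] prob_space by (auto simp: space_P)
  have FP: "F a \<in> sets P" if "a \<in> I" for a using clopen(1)[OF that] by (simp add: sets_P borel_of_openin)
  obtain n r where nr: "n > 0" "r ` {..<n} \<subseteq> topspace X"
    "\<And>i. i \<in> I \<Longrightarrow> \<bar>measure P (topspace X \<inter> F i) / measure P (topspace X) - frequency (F i) n r\<bar> \<le> \<epsilon> / 2"
  proof (rule VC_approx_compact[of X "topspace X" P I F d "\<epsilon> / 2"])
    show "compactin X (topspace X)" using X(1) by (simp add: compact_space_def)
    show "openin (subtopology X (topspace X)) (topspace X \<inter> F i)" if "i \<in> I" for i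
      using clopen(1)[OF that] by auto
    show "closedin (subtopology X (topspace X)) (topspace X \<inter> F i)" if "i \<in> I" for i
      using clopen(2)[OF that] by auto
  qed (use top prob_P FP VC \<open>\<epsilon> > 0\<close> in auto)
  show ?thesis
  proof (rule that[OF nr(1,2)])
    fix B assume B: "B \<in> sets P" and cl: "\<And>Q. \<lbrakk>finite Q; Q \<subseteq> topspace X\<rbrakk> \<Longrightarrow> \<exists>a\<in>I. F a \<inter> Q = B \<inter> Q"
    define \<delta> where "\<delta> = \<epsilon> / 4"
    have \<delta>: "\<delta> > 0" using \<open>\<epsilon> > 0\<close> by (simp add: \<delta>_def)
    have Bc: "space P - B \<in> sets P" using B by auto
    obtain K1 where K1: "compactin X K1" "K1 \<subseteq> B" "measure P K1 > measure P B - \<delta>"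
      using regular_inner[OF reg B \<delta>] .
    obtain K0 where K0: "compactin X K0" "K0 \<subseteq> space P - B" "measure P K0 > measure P (space P - B) - \<delta>"
      using regular_inner[OF reg Bc \<delta>] .
    have mBc: "measure P (space P - B) = 1 - measure P B" using B prob_compl by blast
    have KP: "K1 \<in> sets P" "K0 \<in> sets P"
      using K1(1) K0(1) compactin_imp_closedin[OF X(2)] by (auto simp: sets_P borel_of_closedin)
    obtain Q1 where Q1: "finite Q1" "Q1 \<subseteq> K1"
      "\<And>a. \<lbrakk>a \<in> I; Q1 \<subseteq> F a\<rbrakk> \<Longrightarrow> measure P (K1 \<inter> F a) \<ge> measure P K1 - \<delta>"
      using compact_witnesses[OF K1(1) \<delta>] by metis
    obtain Q0 where Q0: "finite Q0" "Q0 \<subseteq> K0"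
      "\<And>a. \<lbrakk>a \<in> I; Q0 \<inter> F a = {}\<rbrakk> \<Longrightarrow> measure P (K0 \<inter> F a) \<le> \<delta>"
      using compact_witnesses[OF K0(1) \<delta>] by metis
    define Q where "Q = Q1 \<union> Q0 \<union> r ` {..<n}"
    have "Q \<subseteq> topspace X" using Q1(2) Q0(2) nr(2) K1(1) K0(1) compactin_subset_topspace unfolding Q_def by blast
    then obtain a where a: "a \<in> I" "F a \<inter> Q = B \<inter> Q" using cl[of Q] Q1(1) Q0(1) by (auto simp: Q_def)
    have "Q1 \<subseteq> F a" "Q0 \<inter> F a = {}" using a(2) Q1(2) Q0(2) K1(2) K0(2) unfolding Q_def by blast+
    then have m: "measure P (K1 \<inter> F a) \<ge> measure P K1 - \<delta>" "measure P (K0 \<inter> F a) \<le> \<delta>"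
      using Q1(3)[OF a(1)] Q0(3)[OF a(1)] by auto
    have "measure P (K1 \<inter> F a) \<le> measure P (F a)" using FP[OF a(1)] by (intro finite_measure_mono) auto
    then have lo: "measure P B - 2 * \<delta> \<le> measure P (F a)" using m(1) K1(3) by linarith
    have "measure P (F a) \<le> measure P ((K0 \<inter> F a) \<union> (space P - K0))"
      using FP[OF a(1)] KP sets.sets_into_space[OF FP[OF a(1)]] by (intro finite_measure_mono) auto
    also have "\<dots> \<le> measure P (K0 \<inter> F a) + measure P (space P - K0)"
      using FP[OF a(1)] KP by (intro measure_Un_le) auto
    also have "measure P (space P - K0) = 1 - measure P K0" using KP prob_compl by blast
    finally have up: "measure P (F a) \<le> measure P B + 2 * \<delta>" using m(2) K0(3) mBc by linarith
    have "topspace X \<inter> F a = F a" using sets.sets_into_space[OF FP[OF a(1)]] by (auto simp: space_P)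
    then have "\<bar>measure P (F a) - frequency (F a) n r\<bar> \<le> \<epsilon> / 2" using nr(3)[OF a(1)] top by simp
    moreover have "frequency (F a) n r = frequency B n r" using a(2) by (intro frequency_cong) (auto simp: Q_def)
    ultimately show "\<bar>measure P B - frequency B n r\<bar> \<le> \<epsilon>" using lo up unfolding \<delta>_def by linarith
  qed
qed

end

section \<open>Regular Borel probability measures\<close>

lemma sets_borel_of_eq: "sets (borel_of X) = sigma_sets (topspace X) {U. openin X U}"
  unfolding borel_of_def by (rule sets_measure_of) (auto dest: openin_subset)

lemma continuous_map_borel_measurable:
  assumes "continuous_map X Y f" shows "f \<in> borel_of X \<rightarrow>\<^sub>M borel_of Y"
proof (rule measurable_sigma_sets[OF sets_borel_of_eq])
  show "{U. openin Y U} \<subseteq> Pow (topspace Y)" by (auto dest: openin_subset)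
  show "f \<in> space (borel_of X) \<rightarrow> topspace Y" using continuous_map_image_subset_topspace[OF assms] by auto
  show "f -` U \<inter> space (borel_of X) \<in> sets (borel_of X)" if "U \<in> {U. openin Y U}" for U
  proof -
    have "f -` U \<inter> space (borel_of X) = {x \<in> topspace X. f x \<in> U}" by auto
    then show ?thesis using assms that by (auto simp: continuous_map intro!: borel_of_openin)
  qed
qed

lemma sets_borel_of_subtopology:
  assumes "S \<in> sets (borel_of X)"
  shows "sets (borel_of (subtopology X S)) = sets (restrict_space (borel_of X) S)"
proof -
  have S: "S \<subseteq> topspace X" using sets.sets_into_space[OF assms] by simp
  have "sets (borel_of (subtopology X S)) = sigma_sets S ((\<inter>) S ` {U. openin X U})"
    unfolding sets_borel_of_eq using S by (auto dest: subsetD simp: openin_subtopology Int_absorb1 Int_commute intro!: arg_cong2[where f=sigma_sets])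
  also have "\<dots> = (\<inter>) S ` sigma_sets (topspace X) {U. openin X U}"
    using assms S by (intro sigma_sets_Int[symmetric]) (auto simp: sets_borel_of_eq)
  finally show ?thesis by (simp add: sets_restrict_space sets_borel_of_eq)
qed

text \<open>
  Outer regularity is inner regularity of the complement, compact sets being closed here.
\<close>

lemma regular_borel_probI:
  assumes X: "compact_space X" "Hausdorff_space X" and sP: "sets P = sets (borel_of X)" and "prob_space P"
    and inner: "\<And>B \<delta>. \<lbrakk>B \<in> sets P; \<delta> > 0\<rbrakk> \<Longrightarrow> \<exists>K. compactin X K \<and> K \<subseteq> B \<and> measure P B - \<delta> \<le> measure P K"
  shows "regular_borel_prob X P"
  unfolding regular_borel_prob_def
proof (intro conjI ballI sP \<open>prob_space P\<close>)
  interpret prob_space P by fact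
  have spP: "space P = topspace X" using sets_eq_imp_space_eq[OF sP] by simp
  fix B assume B: "B \<in> sets P"
  show "emeasure P B = (SUP K\<in>{K. compactin X K \<and> K \<subseteq> B}. emeasure P K)"
  proof (rule antisym)
    show "(SUP K\<in>{K. compactin X K \<and> K \<subseteq> B}. emeasure P K) \<le> emeasure P B"
      using B by (intro SUP_least emeasure_mono) auto
    show "emeasure P B \<le> (SUP K\<in>{K. compactin X K \<and> K \<subseteq> B}. emeasure P K)"
    proof (rule ennreal_le_epsilon)
      fix e :: real assume "0 < e"
      then obtain K where K: "compactin X K" "K \<subseteq> B" "measure P B - e \<le> measure P K" using inner[OF B] by blast
      then have "emeasure P B \<le> emeasure P K + ennreal e"
        using \<open>0 < e\<close> by (simp add: emeasure_eq_measure ennreal_plus[symmetric] del: ennreal_plus)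
      also have "emeasure P K \<le> (SUP K\<in>{K. compactin X K \<and> K \<subseteq> B}. emeasure P K)" using K by (intro SUP_upper) auto
      finally show "emeasure P B \<le> (SUP K\<in>{K. compactin X K \<and> K \<subseteq> B}. emeasure P K) + ennreal e" by simp
    qed
  qed
  show "emeasure P B = (INF U\<in>{U. openin X U \<and> B \<subseteq> U}. emeasure P U)"
  proof (rule antisym)
    show "emeasure P B \<le> (INF U\<in>{U. openin X U \<and> B \<subseteq> U}. emeasure P U)"
      by (intro INF_greatest emeasure_mono) (auto simp: sP borel_of_openin)
    show "(INF U\<in>{U. openin X U \<and> B \<subseteq> U}. emeasure P U) \<le> emeasure P B"
    proof (rule ennreal_le_epsilon)
      fix e :: real assume "0 < e"
      have "space P - B \<in> sets P" using B by auto
      then obtain K where K: "compactin X K" "K \<subseteq> space P - B" "measure P (space P - B) - e \<le> measure P K"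
        using inner[OF _ \<open>0 < e\<close>] by blast
      have Kc: "closedin X K" using compactin_imp_closedin[OF X(2) K(1)] .
      then have U: "openin X (topspace X - K)" "B \<subseteq> topspace X - K"
        using K(2) sets.sets_into_space[OF B] by (auto simp: spP closedin_def)
      have "measure P (topspace X - K) = 1 - measure P K"
        using prob_compl[of K] Kc by (simp add: spP sP borel_of_closedin)
      moreover have "measure P (space P - B) = 1 - measure P B" using prob_compl[OF B] .
      ultimately have "measure P (topspace X - K) \<le> measure P B + e" using K(3) by simp
      then have "emeasure P (topspace X - K) \<le> emeasure P B + ennreal e"
        using \<open>0 < e\<close> by (simp add: emeasure_eq_measure ennreal_plus[symmetric] del: ennreal_plus)
      then show "(INF U\<in>{U. openin X U \<and> B \<subseteq> U}. emeasure P U) \<le> emeasure P B + ennreal e"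
        using U by (intro INF_lower2[of "topspace X - K"]) auto
    qed
  qed
qed

lemma regular_borel_prob_distr:
  assumes X: "regular_borel_prob X P" and Y: "compact_space Y" "Hausdorff_space Y" and f: "continuous_map X Y f"
  shows "regular_borel_prob Y (distr P (borel_of Y) f)"
proof (rule regular_borel_probI[OF Y])
  interpret prob_space P using X by (simp add: regular_borel_prob_def)
  have sP: "sets P = sets (borel_of X)" using X by (simp add: regular_borel_prob_def)
  have spP: "space P = topspace X" using sets_eq_imp_space_eq[OF sP] by simp
  have m: "f \<in> P \<rightarrow>\<^sub>M borel_of Y"
    using continuous_map_borel_measurable[OF f] measurable_cong_sets[OF sP refl] by blast
  then show "prob_space (distr P (borel_of Y) f)" by (rule prob_space_distr)
  fix B \<delta> assume B: "B \<in> sets (distr P (borel_of Y) f)" and "(\<delta>::real) > 0"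
  then have "f -` B \<inter> space P \<in> sets P" using m by auto
  then obtain K where K: "compactin X K" "K \<subseteq> f -` B \<inter> space P" "measure P K > measure P (f -` B \<inter> space P) - \<delta>"
    using regular_inner[OF X _ \<open>\<delta> > 0\<close>] by blast
  have fK: "compactin Y (f ` K)" using image_compactin[OF K(1) f] .
  have fKs: "f ` K \<in> sets (borel_of Y)" using compactin_imp_closedin[OF Y(2) fK] by (rule borel_of_closedin)
  have "measure P K \<le> measure P (f -` (f ` K) \<inter> space P)"
    using K(2) measurable_sets[OF m fKs] by (intro finite_measure_mono) auto
  then have "measure (distr P (borel_of Y) f) B - \<delta> \<le> measure (distr P (borel_of Y) f) (f ` K)"
    using K(3) B fKs m by (simp add: measure_distr)
  then show "\<exists>K. compactin Y K \<and> K \<subseteq> B \<and> measure (distr P (borel_of Y) f) B - \<delta> \<le> measure (distr P (borel_of Y) f) K"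
    using fK K(2) by (intro exI[of _ "f ` K"] conjI) auto
qed simp

text \<open>
  The complement of \<open>S\<close> may be an uncountable union of open null sets; inner regularity reduces it to
  compact sets, which are covered by finitely many of them.
\<close>

lemma regular_full_measure:
  assumes reg: "regular_borel_prob X P" and S: "S \<in> sets P"
    and null: "\<And>x. x \<in> topspace X - S \<Longrightarrow> \<exists>U. openin X U \<and> x \<in> U \<and> measure P U = 0"
  shows "measure P S = 1"
proof -
  interpret prob_space P using reg by (simp add: regular_borel_prob_def)
  have sP: "sets P = sets (borel_of X)" using reg by (simp add: regular_borel_prob_def)
  have spP: "space P = topspace X" using sets_eq_imp_space_eq[OF sP] by simp
  have Sc: "space P - S \<in> sets P" using S by auto
  have "measure P (space P - S) \<le> 0 + \<delta>" if \<delta>: "\<delta> > 0" for \<delta>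
  proof -
    obtain K where K: "compactin X K" "K \<subseteq> space P - S" "measure P K > measure P (space P - S) - \<delta>"
      using regular_inner[OF reg Sc \<delta>] .
    define \<D> where "\<D> = {U. openin X U \<and> measure P U = 0}"
    have "\<forall>D\<in>\<D>. openin X D" "K \<subseteq> \<Union>\<D>" using null K(2) by (auto simp: \<D>_def spP)
    then obtain \<F> where F: "finite \<F>" "\<F> \<subseteq> \<D>" "K \<subseteq> \<Union>\<F>" using K(1) unfolding compactin_def by metis
    have FP: "\<F> \<subseteq> sets P" using F(2) by (auto simp: \<D>_def sP borel_of_openin)
    have "measure P K \<le> measure P (\<Union>\<F>)" using F FP by (intro finite_measure_mono) auto
    also have "\<dots> \<le> (\<Sum>U\<in>\<F>. measure P U)"
      using finite_measure_subadditive_finite[of \<F> "\<lambda>U. U"] F FP by simp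
    also have "\<dots> = 0" using F(2) by (intro sum.neutral) (auto simp: \<D>_def)
    finally show ?thesis using K(3) by simp
  qed
  then have "measure P (space P - S) \<le> 0" by (rule field_le_epsilon)
  then show ?thesis using prob_compl[OF S] prob_le_1[of S] by linarith
qed

lemma (in prob_space) prob_Int_full:
  assumes "K \<in> events" "prob K = 1" "H \<in> events" shows "prob (K \<inter> H) = prob H"
proof -
  have "prob (H - K) \<le> prob (space M - K)" using assms sets.sets_into_space[OF assms(3)] by (intro finite_measure_mono) auto
  also have "\<dots> = 0" using prob_compl[OF assms(1)] assms(2) by simp
  finally have "prob (H - K) = 0" by (simp add: measure_le_0_iff)
  moreover have "prob H = prob (H \<inter> K) + prob (H - K)"
    using finite_measure_Union[of "H \<inter> K" "H - K"] assms by (auto simp: Int_Diff_Un)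
  ultimately show ?thesis by (simp add: Int_commute)
qed

section \<open>Extending a finitely additive measure from clopen sets\<close>

text \<open>
  The algebra \<open>\<C>\<close> of clopen sets is a base of the topology; for type spaces it consists of the sets
  defined by formulas.
\<close>

locale clopen_content =
  fixes X :: "'b topology" and \<C> :: "'b set set" and m :: "'b set \<Rightarrow> real"
  assumes compact: "compact_space X" and Hausdorff: "Hausdorff_space X"
    and open_C: "C \<in> \<C> \<Longrightarrow> openin X C" and closed_C: "C \<in> \<C> \<Longrightarrow> closedin X C"
    and top_C: "topspace X \<in> \<C>" and Un_C: "\<lbrakk>C \<in> \<C>; D \<in> \<C>\<rbrakk> \<Longrightarrow> C \<union> D \<in> \<C>"
    and Diff_C: "\<lbrakk>C \<in> \<C>; D \<in> \<C>\<rbrakk> \<Longrightarrow> C - D \<in> \<C>"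
    and base: "\<lbrakk>openin X U; x \<in> U\<rbrakk> \<Longrightarrow> \<exists>C\<in>\<C>. x \<in> C \<and> C \<subseteq> U"
    and m_nonneg: "C \<in> \<C> \<Longrightarrow> 0 \<le> m C" and m_top: "m (topspace X) = 1"
    and m_add: "\<lbrakk>C \<in> \<C>; D \<in> \<C>; C \<inter> D = {}\<rbrakk> \<Longrightarrow> m (C \<union> D) = m C + m D"
begin

lemma empty_C: "{} \<in> \<C>" using Diff_C[OF top_C top_C] by simp

lemma finite_UN_C: "finite I \<Longrightarrow> (\<And>i. i \<in> I \<Longrightarrow> D i \<in> \<C>) \<Longrightarrow> (\<Union>i\<in>I. D i) \<in> \<C>"
  by (induction I rule: finite_induct) (auto simp: empty_C Un_C)

lemma m_mono: assumes "C \<in> \<C>" "D \<in> \<C>" "C \<subseteq> D" shows "m C \<le> m D"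
proof -
  have "m (C \<union> (D - C)) = m C + m (D - C)" using assms by (intro m_add Diff_C) auto
  moreover have "C \<union> (D - C) = D" using assms by auto
  ultimately show ?thesis using m_nonneg[OF Diff_C[OF assms(2,1)]] by simp
qed

lemma m_empty: "m {} = 0" using m_add[OF empty_C empty_C] by simp

lemma m_Un_le: assumes "C \<in> \<C>" "D \<in> \<C>" shows "m (C \<union> D) \<le> m C + m D"
proof -
  have "m (C \<union> (D - C)) = m C + m (D - C)" using assms by (intro m_add Diff_C) auto
  moreover have "m (D - C) \<le> m D" using assms by (intro m_mono Diff_C) auto
  ultimately show ?thesis by simp
qed

lemma m_UN_le: "finite I \<Longrightarrow> (\<And>i. i \<in> I \<Longrightarrow> D i \<in> \<C>) \<Longrightarrow> m (\<Union>i\<in>I. D i) \<le> (\<Sum>i\<in>I. m (D i))"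
proof (induction I rule: finite_induct)
  case (insert i I)
  have "m (D i \<union> (\<Union>i\<in>I. D i)) \<le> m (D i) + m (\<Union>i\<in>I. D i)"
    using insert by (intro m_Un_le finite_UN_C) auto
  then show ?case using insert by simp
qed (simp add: m_empty)

definition inner_content :: "'b set \<Rightarrow> ennreal" where
  "inner_content U = (SUP C\<in>{C\<in>\<C>. C \<subseteq> U}. ennreal (m C))"

definition outer_content :: "'b set \<Rightarrow> ennreal" where
  "outer_content E = (INF U\<in>{U. openin X U \<and> E \<subseteq> U}. inner_content U)"

lemma inner_content_upper: "C \<in> \<C> \<Longrightarrow> C \<subseteq> U \<Longrightarrow> ennreal (m C) \<le> inner_content U"
  unfolding inner_content_def by (intro SUP_upper) auto

lemma inner_content_mono: "U \<subseteq> V \<Longrightarrow> inner_content U \<le> inner_content V"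
  unfolding inner_content_def by (intro SUP_subset_mono) auto

lemma inner_content_C: "C \<in> \<C> \<Longrightarrow> inner_content C = ennreal (m C)"
  using inner_content_upper[of C C] unfolding inner_content_def by (intro antisym SUP_least) (auto intro!: ennreal_leI m_mono)

lemma inner_content_le_1: "U \<subseteq> topspace X \<Longrightarrow> inner_content U \<le> 1"
  using inner_content_mono[of U "topspace X"] by (simp add: inner_content_C[OF top_C] m_top)

text \<open>
  A member of \<open>\<C>\<close> is compact, so a countable open cover of it reduces to a finite one by members of
  \<open>\<C>\<close>, where finite subadditivity applies.
\<close>

lemma inner_content_UN_le:
  fixes U :: "nat \<Rightarrow> 'b set"
  assumes "\<And>i. openin X (U i)"
  shows "inner_content (\<Union>i. U i) \<le> (\<Sum>i. inner_content (U i))"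
  unfolding inner_content_def[of "\<Union>i. U i"]
proof (rule SUP_least)
  fix C assume "C \<in> {C \<in> \<C>. C \<subseteq> (\<Union>i. U i)}"
  then have C: "C \<in> \<C>" "C \<subseteq> (\<Union>i. U i)" by auto
  define \<D> where "\<D> = {D\<in>\<C>. \<exists>i. D \<subseteq> U i}"
  have "compactin X C" using compact closed_C[OF C(1)] closedin_compact_space by blast
  moreover have "\<forall>D\<in>\<D>. openin X D" using open_C by (auto simp: \<D>_def)
  moreover have "C \<subseteq> \<Union>\<D>"
  proof
    fix x assume "x \<in> C"
    then obtain i where "x \<in> U i" using C by auto
    then show "x \<in> \<Union>\<D>" using base[OF assms, of x i] by (auto simp: \<D>_def)
  qed
  ultimately obtain \<F> where F: "finite \<F>" "\<F> \<subseteq> \<D>" "C \<subseteq> \<Union>\<F>" unfolding compactin_def by metis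
  define idx where "idx D = (SOME i. D \<subseteq> U i)" for D
  have idx: "D \<subseteq> U (idx D)" if "D \<in> \<F>" for D
    using someI_ex[of "\<lambda>i. D \<subseteq> U i"] that F(2) by (auto simp: idx_def \<D>_def)
  define G where "G i = (\<Union>D\<in>{D\<in>\<F>. idx D = i}. D)" for i
  have GC: "G i \<in> \<C>" for i unfolding G_def using F by (intro finite_UN_C) (auto simp: \<D>_def)
  have GU: "G i \<subseteq> U i" for i using idx by (auto simp: G_def)
  have "\<Union>\<F> = (\<Union>i\<in>idx ` \<F>. G i)" by (auto simp: G_def)
  then have "m C \<le> m (\<Union>i\<in>idx ` \<F>. G i)" using F C GC finite_UN_C[of "idx ` \<F>" G] by (intro m_mono) auto
  also have "\<dots> \<le> (\<Sum>i\<in>idx ` \<F>. m (G i))" using F GC by (intro m_UN_le) auto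
  finally have "ennreal (m C) \<le> ennreal (\<Sum>i\<in>idx ` \<F>. m (G i))" by (rule ennreal_leI)
  also have "\<dots> = (\<Sum>i\<in>idx ` \<F>. ennreal (m (G i)))" using m_nonneg GC by simp
  also have "\<dots> \<le> (\<Sum>i\<in>idx ` \<F>. inner_content (U i))" using GC GU by (intro sum_mono inner_content_upper) auto
  also have "\<dots> \<le> (\<Sum>i. inner_content (U i))" using F(1) by (intro sum_le_suminf) auto
  finally show "ennreal (m C) \<le> (\<Sum>i. inner_content (U i))" .
qed

lemma outer_content_open: "openin X U \<Longrightarrow> outer_content U = inner_content U"
  unfolding outer_content_def by (intro antisym INF_lower2[of U] INF_greatest inner_content_mono) auto

lemma outer_content_mono: "E \<subseteq> E' \<Longrightarrow> outer_content E \<le> outer_content E'"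
  unfolding outer_content_def by (intro INF_superset_mono) auto

lemma outer_content_UN_le:
  fixes A :: "nat \<Rightarrow> 'b set"
  assumes "\<And>i. A i \<subseteq> topspace X"
  shows "outer_content (\<Union>i. A i) \<le> (\<Sum>i. outer_content (A i))"
proof (rule ennreal_le_epsilon)
  fix e :: real assume "0 < e" "(\<Sum>n. outer_content (A n)) < Orderings.top_class.top"
  have "\<exists>U. openin X U \<and> A n \<subseteq> U \<and> inner_content U \<le> outer_content (A n) + e * (1/2)^Suc n" for n
  proof -
    have "outer_content (A n) < outer_content (A n) + e * (1/2)^Suc n"
      using \<open>0 < e\<close> \<open>(\<Sum>n. outer_content (A n)) < Orderings.top_class.top\<close> by (auto simp add: less_top dest!: ennreal_suminf_lessD)
    then have "(INF U\<in>{U. openin X U \<and> A n \<subseteq> U}. inner_content U) < outer_content (A n) + e * (1/2)^Suc n" by (simp add: outer_content_def)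
    then show ?thesis unfolding INF_less_iff by (auto intro: less_imp_le)
  qed
  then obtain U where U: "\<And>n. openin X (U n)" "\<And>n. A n \<subseteq> U n" "\<And>n. inner_content (U n) \<le> outer_content (A n) + e * (1/2)^Suc n" by metis
  have "outer_content (\<Union>i. A i) \<le> outer_content (\<Union>i. U i)" using U(2) by (intro outer_content_mono) auto
  also have "\<dots> = inner_content (\<Union>i. U i)" using U(1) by (intro outer_content_open) auto
  also have "\<dots> \<le> (\<Sum>i. inner_content (U i))" by (rule inner_content_UN_le[OF U(1)])
  also have "\<dots> \<le> (\<Sum>n. outer_content (A n) + e * (1/2) ^ Suc n)" by (intro suminf_le U(3)) auto
  also have "... = (\<Sum>n. outer_content (A n)) + (\<Sum>n. ennreal e * ennreal ((1/2) ^ Suc n))"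
    using \<open>0 < e\<close> by (subst suminf_add[symmetric])
      (auto simp del: ennreal_suminf_cmult simp add: ennreal_mult[symmetric])
  also have "\<dots> = (\<Sum>n. outer_content (A n)) + e"
    unfolding ennreal_suminf_cmult
    by (subst suminf_ennreal_eq[OF zero_le_power power_half_series]) auto
  finally show "outer_content (\<Union>i. A i) \<le> (\<Sum>n. outer_content (A n)) + e" .
qed

lemma outer_content_empty: "outer_content {} = 0"
  using outer_content_open[OF open_C[OF empty_C]] inner_content_C[OF empty_C] by (simp add: m_empty)

lemma outer_content_outer: "outer_measure_space (Pow (topspace X)) outer_content"
  unfolding outer_measure_space_def positive_def increasing_def countably_subadditive_def
  using outer_content_mono outer_content_UN_le outer_content_empty by (auto simp: image_subset_iff)

lemma outer_content_Un_le: assumes "A \<subseteq> topspace X" "B \<subseteq> topspace X" shows "outer_content (A \<union> B) \<le> outer_content A + outer_content B"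
proof -
  have "outer_content (\<Union>i. binaryset A B i) \<le> (\<Sum>i. outer_content (binaryset A B i))"
    using assms by (intro outer_content_UN_le) (auto simp: binaryset_def)
  then show ?thesis using suminf_binaryset_eq[of outer_content A B] outer_content_empty by (simp add: UN_binaryset_eq)
qed

text \<open>
  Caratheodory's inequality, first for open test sets: approximate \<open>V \<inter> U\<close> from inside by \<open>C\<close>, and then the
  open set \<open>V - C\<close>, which contains \<open>V - U\<close>, by a set \<open>D\<close> disjoint from \<open>C\<close>.
\<close>

lemma inner_content_split:
  assumes U: "openin X U" and V: "openin X V"
  shows "outer_content (V \<inter> U) + outer_content (V - U) \<le> inner_content V"
proof (rule ennreal_le_epsilon)
  fix e :: real assume "0 < e"
  have approx: "\<exists>C\<in>\<C>. C \<subseteq> W \<and> inner_content W \<le> ennreal (m C) + ennreal (e / 2)" if "openin X W" for W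
  proof (cases "inner_content W = 0")
    case True then show ?thesis using empty_C by (intro bexI[of _ "{}"]) auto
  next
    case False
    have "inner_content W \<noteq> \<infinity>" using inner_content_le_1[OF openin_subset[OF that]] by (auto simp: top_unique)
    then have "inner_content W - ennreal (e / 2) < inner_content W"
      using False \<open>0 < e\<close> by (intro ennreal_between) (auto simp: less_top zero_less_iff_neq_zero)
    then obtain C where C: "C \<in> \<C>" "C \<subseteq> W" "inner_content W - ennreal (e / 2) < ennreal (m C)"
      unfolding inner_content_def[of W] less_SUP_iff by auto
    then have "inner_content W \<le> ennreal (m C) + ennreal (e / 2)"
      by (metis add.commute ennreal_minus_le_iff less_imp_le)
    then show ?thesis using C by blast
  qed
  obtain C where C: "C \<in> \<C>" "C \<subseteq> V \<inter> U" "inner_content (V \<inter> U) \<le> ennreal (m C) + ennreal (e / 2)"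
    using approx[of "V \<inter> U"] U V by auto
  have VC: "openin X (V - C)" using V closed_C[OF C(1)] by (rule openin_diff)
  obtain D where D: "D \<in> \<C>" "D \<subseteq> V - C" "inner_content (V - C) \<le> ennreal (m D) + ennreal (e / 2)"
    using approx[OF VC] by auto
  have "outer_content (V - U) \<le> outer_content (V - C)" using C by (intro outer_content_mono) auto
  then have "outer_content (V \<inter> U) + outer_content (V - U) \<le> (ennreal (m C) + ennreal (e / 2)) + (ennreal (m D) + ennreal (e / 2))"
    using C(3) D(3) outer_content_open[OF VC] outer_content_open[OF openin_Int[OF V U]] by (intro add_mono) auto
  also have "\<dots> = ennreal (m C + m D) + ennreal e"
    using m_nonneg[OF C(1)] m_nonneg[OF D(1)] \<open>0 < e\<close> by (simp add: ennreal_plus[symmetric] del: ennreal_plus)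
  also have "m C + m D = m (C \<union> D)" using C D by (intro m_add[symmetric]) auto
  also have "ennreal (m (C \<union> D)) \<le> inner_content V" using C D by (intro inner_content_upper Un_C) auto
  finally show "outer_content (V \<inter> U) + outer_content (V - U) \<le> inner_content V + ennreal e" by simp
qed

lemma open_in_lambda_system:
  assumes U: "openin X U"
  shows "U \<in> lambda_system (topspace X) (Pow (topspace X)) outer_content"
proof -
  have "outer_content (E \<inter> U) + outer_content (E - U) = outer_content E" if E: "E \<subseteq> topspace X" for E
  proof (rule antisym)
    show "outer_content (E \<inter> U) + outer_content (E - U) \<le> outer_content E"
      unfolding outer_content_def[of E]
    proof (rule INF_greatest)
      fix V assume "V \<in> {U. openin X U \<and> E \<subseteq> U}"
      then have V: "openin X V" "E \<subseteq> V" by auto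
      have "outer_content (E \<inter> U) + outer_content (E - U) \<le> outer_content (V \<inter> U) + outer_content (V - U)" using V by (intro add_mono outer_content_mono) auto
      also have "\<dots> \<le> inner_content V" by (rule inner_content_split[OF U V(1)])
      finally show "outer_content (E \<inter> U) + outer_content (E - U) \<le> inner_content V" .
    qed
    show "outer_content E \<le> outer_content (E \<inter> U) + outer_content (E - U)"
      using outer_content_Un_le[of "E \<inter> U" "E - U"] E by (simp add: Int_Diff_Un le_infI1 Diff_subset)
        (metis Diff_subset Int_Diff_Un order_trans)
  qed
  then show ?thesis using openin_subset[OF U]
    by (simp add: algebra.lambda_system_eq[OF algebra_Pow])
qed

definition borel_extension :: "'b measure" where
  "borel_extension = measure_of (topspace X) (sets (borel_of X)) outer_content"

lemma emeasure_borel_extension: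
  assumes "B \<in> sets (borel_of X)" shows "emeasure borel_extension B = outer_content B"
proof -
  have ms: "measure_space (topspace X) (lambda_system (topspace X) (Pow (topspace X)) outer_content) outer_content"
    using sigma_algebra.caratheodory_lemma[OF sigma_algebra_Pow outer_content_outer] .
  have sa: "sigma_algebra (topspace X) (sets (borel_of X))"
    using sets.sigma_algebra_axioms[of "borel_of X"] by simp
  have "sigma_sets (topspace X) {U. openin X U} \<subseteq> lambda_system (topspace X) (Pow (topspace X)) outer_content"
    using ms open_in_lambda_system by (intro sigma_algebra.sigma_sets_subset) (auto simp: measure_space_def)
  moreover have "sets (borel_of X) = sigma_sets (topspace X) {U. openin X U}"
    unfolding borel_of_def by (rule sets_measure_of) (auto dest: openin_subset)
  ultimately have "measure_space (topspace X) (sets (borel_of X)) outer_content"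
    using measure_down[OF ms sa] by simp
  then show ?thesis unfolding borel_extension_def using assms
    by (intro emeasure_measure_of_sigma) (auto simp: measure_space_def)
qed

lemma sets_borel_extension [simp]: "sets borel_extension = sets (borel_of X)"
  unfolding borel_extension_def using sets.sets_measure_of_eq[of "borel_of X"] by simp

lemma space_borel_extension [simp]: "space borel_extension = topspace X"
  using sets_eq_imp_space_eq[OF sets_borel_extension] by simp

lemma measure_borel_extension: "C \<in> \<C> \<Longrightarrow> measure borel_extension C = m C"
  using emeasure_borel_extension[OF borel_of_openin[OF open_C]] outer_content_open[OF open_C] inner_content_C m_nonneg
  by (simp add: measure_def)

lemma prob_space_borel_extension: "prob_space borel_extension"
  by (rule prob_spaceI) (simp add: emeasure_borel_extension borel_of_openin outer_content_open inner_content_C[OF top_C] m_top)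

lemma regular_borel_extension: "regular_borel_prob X borel_extension"
proof (rule regular_borel_probI[OF compact Hausdorff sets_borel_extension prob_space_borel_extension])
  interpret prob_space borel_extension by (rule prob_space_borel_extension)
  fix B and e :: real assume B: "B \<in> sets borel_extension" and "0 < e"
  define B' where "B' = topspace X - B"
  have B': "B' \<in> sets borel_extension" using B sets.compl_sets[of B borel_extension] by (simp add: B'_def)
  have eq: "outer_content B' = ennreal (measure borel_extension B')"
    using emeasure_borel_extension[of B'] B' by (simp add: emeasure_eq_measure)
  have "outer_content B' < outer_content B' + ennreal e" unfolding eq using \<open>0 < e\<close> by simp
  then obtain U where U: "openin X U" "B' \<subseteq> U" "inner_content U < outer_content B' + ennreal e"
    unfolding outer_content_def[of B'] INF_less_iff by auto
  have Us: "U \<in> sets borel_extension" using U by (simp add: borel_of_openin)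
  have K: "compactin X (topspace X - U)" "topspace X - U \<subseteq> B"
    using U closedin_compact_space[OF compact closedin_diff[OF closedin_topspace U(1)]] by (auto simp: B'_def)
  have "emeasure borel_extension U < emeasure borel_extension B' + ennreal e"
    using U(3) Us B' outer_content_open[OF U(1)] by (simp add: emeasure_borel_extension)
  then have 1: "measure borel_extension U < measure borel_extension B' + e"
    using \<open>0 < e\<close> by (simp add: emeasure_eq_measure ennreal_plus[symmetric] ennreal_less_iff del: ennreal_plus)
  have "measure borel_extension B = 1 - measure borel_extension B'"
    using prob_compl[OF B] prob_compl[OF B'] by (simp add: B'_def)
  moreover have "measure borel_extension (topspace X - U) = 1 - measure borel_extension U"
    using prob_compl[OF Us] by simp
  ultimately have "measure borel_extension B - e \<le> measure borel_extension (topspace X - U)" using 1 by simp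
  then show "\<exists>K. compactin X K \<and> K \<subseteq> B \<and> measure borel_extension B - e \<le> measure borel_extension K"
    using K by blast
qed

text \<open>
  Covering compact subsets of an open set by members of \<open>\<C>\<close> shows that inner regularity determines the
  measure on open sets; outer regularity then determines it everywhere.
\<close>

lemma regular_borel_unique:
  assumes reg: "regular_borel_prob X P" and eq: "\<And>C. C \<in> \<C> \<Longrightarrow> measure P C = m C"
  shows "P = borel_extension"
proof (rule measure_eqI)
  interpret prob_space P using reg by (simp add: regular_borel_prob_def)
  show sP: "sets P = sets borel_extension" using reg by (simp add: regular_borel_prob_def)
  have open_eq: "emeasure P U = inner_content U" if U: "openin X U" for U
  proof (rule antisym)
    have UP: "U \<in> sets P" using U by (simp add: sP borel_of_openin)
    show "inner_content U \<le> emeasure P U"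
      unfolding inner_content_def
    proof (rule SUP_least)
      fix C assume "C \<in> {C \<in> \<C>. C \<subseteq> U}"
      then show "ennreal (m C) \<le> emeasure P U"
        using eq[of C] emeasure_mono[of C U P] UP by (simp add: emeasure_eq_measure)
    qed
    have "emeasure P U = (SUP K\<in>{K. compactin X K \<and> K \<subseteq> U}. emeasure P K)"
      using reg UP unfolding regular_borel_prob_def by blast
    also have "\<dots> \<le> inner_content U"
    proof (rule SUP_least)
      fix K assume "K \<in> {K. compactin X K \<and> K \<subseteq> U}"
      then have K: "compactin X K" "K \<subseteq> U" by auto
      define \<D> where "\<D> = {C\<in>\<C>. C \<subseteq> U}"
      have "\<forall>D\<in>\<D>. openin X D" "K \<subseteq> \<Union>\<D>" using open_C base[OF U] K(2) by (auto simp: \<D>_def) blast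
      then obtain \<F> where F: "finite \<F>" "\<F> \<subseteq> \<D>" "K \<subseteq> \<Union>\<F>" using K(1) unfolding compactin_def by metis
      have FC: "\<Union>\<F> \<in> \<C>" using finite_UN_C[of \<F> "\<lambda>D. D"] F by (auto simp: \<D>_def)
      have "emeasure P K \<le> emeasure P (\<Union>\<F>)"
        using F FC by (intro emeasure_mono) (auto simp: sP borel_of_openin open_C)
      also have "\<dots> = ennreal (m (\<Union>\<F>))" using eq[OF FC] by (simp add: emeasure_eq_measure)
      also have "\<dots> \<le> inner_content U" using FC F by (intro inner_content_upper) (auto simp: \<D>_def)
      finally show "emeasure P K \<le> inner_content U" .
    qed
    finally show "emeasure P U \<le> inner_content U" .
  qed
  fix B assume B: "B \<in> sets P"
  then have "emeasure P B = (INF U\<in>{U. openin X U \<and> B \<subseteq> U}. emeasure P U)"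
    using reg unfolding regular_borel_prob_def by blast
  also have "\<dots> = outer_content B" unfolding outer_content_def using open_eq by (intro INF_cong) auto
  finally show "emeasure P B = emeasure borel_extension B" using B by (simp add: sP emeasure_borel_extension)
qed

end

section \<open>Substitution and elimination of parameters\<close>

lemma val_cong: "(\<And>v. v \<in> fv_trm t \<Longrightarrow> e v = e' v) \<Longrightarrow> val M e t = val M e' t"
proof (induction t)
  case (Fn f ts)
  have "map (val M e) ts = map (val M e') ts" using Fn by (intro map_cong) auto
  then show ?case by (simp only: val.simps)
qed auto

lemma sat_cong: "(\<And>v. v \<in> fv \<phi> \<Longrightarrow> e v = e' v) \<Longrightarrow> sat M e \<phi> = sat M e' \<phi>"
proof (induction \<phi> arbitrary: e e')
  case (Eq t u)
  have "val M e t = val M e' t" "val M e u = val M e' u" by (rule val_cong, rule Eq, simp)+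
  then show ?case by (simp only: sat.simps)
next
  case (Rl r ts)
  have "map (val M e) ts = map (val M e') ts" using Rl by (intro map_cong val_cong) auto
  then show ?case by (simp only: sat.simps)
next
  case (Neg \<phi>)
  have "sat M e \<phi> = sat M e' \<phi>" by (rule Neg.IH) (rule Neg.prems, simp only: fv.simps)
  then show ?case by (simp only: sat.simps)
next
  case (Or \<phi> \<psi>)
  have "sat M e \<phi> = sat M e' \<phi>" by (rule Or.IH(1)) (rule Or.prems, simp)
  moreover have "sat M e \<psi> = sat M e' \<psi>" by (rule Or.IH(2)) (rule Or.prems, simp)
  ultimately show ?case by (simp only: sat.simps)
next
  case (Ex v \<phi>)
  have "sat M (e(v := a)) \<phi> = sat M (e'(v := a)) \<phi>" for a
    by (rule Ex.IH) (use Ex.prems in \<open>simp add: fun_upd_def\<close>)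
  then show ?case by (simp only: sat.simps)
qed

lemma finite_fv_trm: "finite (fv_trm t)" by (induction t) auto
lemma finite_fv: "finite (fv \<phi>)" by (induction \<phi>) (auto simp: finite_fv_trm)
lemma finite_pars_trm: "finite (pars_trm t)" by (induction t) auto
lemma finite_pars: "finite (pars \<phi>)" by (induction \<phi>) (auto simp: finite_pars_trm)

lemma val_subst_trm: "val M e (subst_trm x t u) = val M (e(x := val M e t)) u"
proof (induction u)
  case (Fn f ts)
  have "map (val M e) (map (subst_trm x t) ts) = map (val M (e(x := val M e t))) ts"
    unfolding map_map comp_def by (rule map_cong[OF refl Fn.IH])
  then show ?case by (simp only: val.simps subst_trm.simps)
qed auto

text \<open>
  No capture can occur: below a quantifier over \<open>x\<close> nothing is replaced, and other quantified variables do
  not occur in \<open>t\<close>.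
\<close>

lemma sat_subst: "fv_trm t \<subseteq> {x} \<Longrightarrow> sat M e (subst x t \<phi>) = sat M (e(x := val M e t)) \<phi>"
proof (induction \<phi> arbitrary: e)
  case (Rl r ts)
  have "map (val M e) (map (subst_trm x t) ts) = map (val M (e(x := val M e t))) ts"
    unfolding map_map comp_def by (rule map_cong[OF refl val_subst_trm])
  then show ?case by (simp only: sat.simps subst.simps)
next
  case (Ex v \<phi>)
  show ?case
  proof (cases "v = x")
    case False
    have "sat M (e(v := a)) (subst x t \<phi>) = sat M ((e(x := val M e t))(v := a)) \<phi>" for a
    proof -
      have "val M (e(v := a)) t = val M e t" using Ex.prems False by (intro val_cong) auto
      then have "sat M (e(v := a)) (subst x t \<phi>) = sat M ((e(v := a))(x := val M e t)) \<phi>"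
        using Ex.IH[OF Ex.prems, of "e(v := a)"] by (simp only:)
      then show ?thesis by (simp only: fun_upd_twist[OF False])
    qed
    then show ?thesis using False by (simp only: subst.simps sat.simps if_False)
  next
    case True
    then show ?thesis by (simp only: subst.simps sat.simps simp_thms if_True fun_upd_upd)
  qed
qed (simp_all add: val_subst_trm)

lemma sort_of_subst_trm:
  assumes "sort_of L t = Some (fst x)" shows "sort_of L (subst_trm x t u) = sort_of L u"
proof (induction u)
  case (Fn f ts)
  have "map (sort_of L) (map (subst_trm x t) ts) = map (sort_of L) ts" using Fn by auto
  then show ?case by (simp only: sort_of.simps subst_trm.simps)
qed (auto simp: assms)

lemma wf_subst:
  assumes "sort_of L t = Some (fst x)" "wf_fm L \<phi>" shows "wf_fm L (subst x t \<phi>)"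
  using assms(2)
proof (induction \<phi>)
  case (Rl r ts)
  have "map (sort_of L) (map (subst_trm x t) ts) = map (sort_of L) ts"
    using assms(1) by (simp add: sort_of_subst_trm)
  then show ?case using Rl by (simp only: wf_fm.simps subst.simps)
next
  case (Eq u w)
  then show ?case unfolding wf_fm.simps subst.simps sort_of_subst_trm[OF assms(1)] .
qed (simp_all add: sort_of_subst_trm[OF assms(1)])

lemma fv_subst_trm: "fv_trm (subst_trm x t u) \<subseteq> (fv_trm u - {x}) \<union> fv_trm t"
  by (induction u) auto

lemma fv_subst: "fv (subst x t \<phi>) \<subseteq> (fv \<phi> - {x}) \<union> fv_trm t"
proof (induction \<phi>)
  case (Eq u w) show ?case using fv_subst_trm[of x t u] fv_subst_trm[of x t w] by auto
next
  case (Rl r ts) show ?case using fv_subst_trm[of x t] by fastforce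
qed auto

lemma pars_subst_trm: "pars_trm (subst_trm x t u) \<subseteq> pars_trm u \<union> pars_trm t"
  by (induction u) auto

lemma pars_subst: "pars (subst x t \<phi>) \<subseteq> pars \<phi> \<union> pars_trm t"
proof (induction \<phi>)
  case (Eq u w) show ?case using pars_subst_trm[of x t u] pars_subst_trm[of x t w] by auto
next
  case (Rl r ts) show ?case using pars_subst_trm[of x t] by fastforce
qed auto

primrec bv :: "('s, 'f, 'r, 'a) fm \<Rightarrow> 's var set" where
  "bv (Eq t u) = {}"
| "bv (Rl r ts) = {}"
| "bv (Neg \<phi>) = bv \<phi>"
| "bv (Or \<phi> \<psi>) = bv \<phi> \<union> bv \<psi>"
| "bv (Ex v \<phi>) = insert v (bv \<phi>)"

lemma finite_bv: "finite (bv \<phi>)" by (induction \<phi>) auto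

primrec unpar_trm :: "('s \<times> 'a \<Rightarrow> 's var) \<Rightarrow> ('s, 'f, 'a) trm \<Rightarrow> ('s, 'f, 'a) trm" where
  "unpar_trm \<rho> (Var v) = Var v"
| "unpar_trm \<rho> (Par c) = Var (\<rho> c)"
| "unpar_trm \<rho> (Fn f ts) = Fn f (map (unpar_trm \<rho>) ts)"

primrec unpar :: "('s \<times> 'a \<Rightarrow> 's var) \<Rightarrow> ('s, 'f, 'r, 'a) fm \<Rightarrow> ('s, 'f, 'r, 'a) fm" where
  "unpar \<rho> (Eq t u) = Eq (unpar_trm \<rho> t) (unpar_trm \<rho> u)"
| "unpar \<rho> (Rl r ts) = Rl r (map (unpar_trm \<rho>) ts)"
| "unpar \<rho> (Neg \<phi>) = Neg (unpar \<rho> \<phi>)"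
| "unpar \<rho> (Or \<phi> \<psi>) = Or (unpar \<rho> \<phi>) (unpar \<rho> \<psi>)"
| "unpar \<rho> (Ex v \<phi>) = Ex v (unpar \<rho> \<phi>)"

lemma pars_unpar_trm: "pars_trm (unpar_trm \<rho> t) = {}" by (induction t) auto
lemma pars_unpar: "pars (unpar \<rho> \<phi>) = {}" by (induction \<phi>) (auto simp: pars_unpar_trm)

lemma sort_of_unpar_trm:
  assumes "\<And>c. fst (\<rho> c) = fst c" shows "sort_of L (unpar_trm \<rho> t) = sort_of L t"
proof (induction t)
  case (Fn f ts)
  have "map (sort_of L) (map (unpar_trm \<rho>) ts) = map (sort_of L) ts" using Fn by auto
  then show ?case by (simp only: sort_of.simps unpar_trm.simps)
qed (auto simp: assms)

lemma wf_unpar: assumes "\<And>c. fst (\<rho> c) = fst c" "wf_fm L \<phi>" shows "wf_fm L (unpar \<rho> \<phi>)"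
  using assms(2)
proof (induction \<phi>)
  case (Rl r ts)
  have "map (sort_of L) (map (unpar_trm \<rho>) ts) = map (sort_of L) ts"
    using assms(1) by (simp add: sort_of_unpar_trm)
  then show ?case using Rl by (simp only: wf_fm.simps unpar.simps)
next
  case (Eq u w)
  then show ?case unfolding wf_fm.simps unpar.simps sort_of_unpar_trm[OF assms(1)] .
qed (simp_all add: sort_of_unpar_trm[OF assms(1)])

lemma val_unpar_trm:
  "(\<And>c. c \<in> pars_trm t \<Longrightarrow> e (\<rho> c) = snd c) \<Longrightarrow> val M e (unpar_trm \<rho> t) = val M e t"
proof (induction t)
  case (Fn f ts)
  have "map (val M e) (map (unpar_trm \<rho>) ts) = map (val M e) ts" using Fn by auto
  then show ?case by (simp only: val.simps unpar_trm.simps)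
qed auto

lemma sat_unpar:
  "\<lbrakk>\<And>c. c \<in> pars \<phi> \<Longrightarrow> e (\<rho> c) = snd c; \<rho> ` pars \<phi> \<inter> bv \<phi> = {}\<rbrakk> \<Longrightarrow> sat M e (unpar \<rho> \<phi>) = sat M e \<phi>"
proof (induction \<phi> arbitrary: e)
  case (Eq t u)
  have "val M e (unpar_trm \<rho> t) = val M e t" "val M e (unpar_trm \<rho> u) = val M e u"
    using Eq by (simp_all add: val_unpar_trm)
  then show ?case by (simp only: sat.simps unpar.simps)
next
  case (Rl r ts)
  have "map (val M e) (map (unpar_trm \<rho>) ts) = map (val M e) ts" using Rl by (auto intro!: val_unpar_trm)
  then show ?case by (simp only: sat.simps unpar.simps)
next
  case (Neg \<phi>) then show ?case by simp
next
  case (Or \<phi> \<psi>)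
  have "sat M e (unpar \<rho> \<phi>) = sat M e \<phi>" "sat M e (unpar \<rho> \<psi>) = sat M e \<psi>"
    using Or.prems by (auto intro!: Or.IH)
  then show ?case by simp
next
  case (Ex v \<phi>)
  have "sat M (e(v := a)) (unpar \<rho> \<phi>) = sat M (e(v := a)) \<phi>" for a
    using Ex.prems by (intro Ex.IH) auto
  then show ?case by simp
qed

text \<open>
  Parameters become fresh variables. The independence property refers to formulas without parameters,
  and the values of the fresh variables under \<open>c\<close> stand for the parameters.
\<close>

lemma parameter_elimination:
  fixes \<psi> :: "('s, 'f, 'r, 'a) fm"
  assumes wf: "wf_fm L \<psi>" and par: "pars \<psi> \<subseteq> univ M" and ne: "\<And>s. dom M s \<noteq> {}" and W: "finite W"
  obtains \<psi>0 c Z where "\<psi>0 \<in> L_formulas L" "c \<in> assignments M" "Z \<inter> W = {}"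
    "\<And>e. (\<And>w. w \<in> Z \<Longrightarrow> e w = c w) \<Longrightarrow> sat M e \<psi>0 = sat M e \<psi>"
proof -
  define N where "N = Suc (Max (insert 0 (snd ` (bv \<psi> \<union> W))))"
  have N: "snd w < N" if "w \<in> bv \<psi> \<union> W" for w
    unfolding N_def using that W finite_bv[of \<psi>] by (intro le_imp_less_Suc Max_ge) auto
  obtain g :: "'s \<times> 'a \<Rightarrow> nat" where g: "inj_on g (pars \<psi>)"
    using finite_imp_inj_to_nat_seg[OF finite_pars] by metis
  define \<rho> where "\<rho> c = (fst c, N + g c)" for c :: "'s \<times> 'a"
  have inj: "inj_on \<rho> (pars \<psi>)" using g by (auto simp: inj_on_def \<rho>_def)
  have new: "\<rho> c \<notin> bv \<psi> \<union> W" for c using N[of "\<rho> c"] by (auto simp: \<rho>_def)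
  define c where "c w = (if w \<in> \<rho> ` pars \<psi> then snd (inv_into (pars \<psi>) \<rho> w) else SOME a. a \<in> dom M (fst w))" for w
  have c\<rho>: "c (\<rho> p) = snd p" if "p \<in> pars \<psi>" for p using inj that by (simp add: c_def inv_into_f_f)
  have "c w \<in> dom M (fst w)" for w
  proof (cases "w \<in> \<rho> ` pars \<psi>")
    case True
    then obtain p where p: "p \<in> pars \<psi>" "w = \<rho> p" by auto
    then have "snd p \<in> dom M (fst p)" using par by (auto simp: univ_def)
    then show ?thesis using p c\<rho> by (simp add: \<rho>_def)
  next
    case False
    then show ?thesis using ne[of "fst w"] by (simp add: c_def some_in_eq)
  qed
  then have c: "c \<in> assignments M" unfolding assignments_def by blast
  have wf0: "unpar \<rho> \<psi> \<in> L_formulas L"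
    using wf by (simp add: L_formulas_def pars_unpar) (rule wf_unpar, auto simp: \<rho>_def)
  have sat0: "sat M e (unpar \<rho> \<psi>) = sat M e \<psi>" if "\<And>w. w \<in> \<rho> ` pars \<psi> \<Longrightarrow> e w = c w" for e
  proof (rule sat_unpar)
    show "e (\<rho> p) = snd p" if "p \<in> pars \<psi>" for p using \<open>\<And>w. w \<in> \<rho> ` pars \<psi> \<Longrightarrow> e w = c w\<close>[of "\<rho> p"] c\<rho>[OF that] that by simp
    show "\<rho> ` pars \<psi> \<inter> bv \<psi> = {}" using new by blast
  qed
  have "\<rho> ` pars \<psi> \<inter> W = {}" using new by blast
  from that[OF wf0 c this sat0] show ?thesis .
qed

section \<open>Definable relations\<close>

text \<open>
  Relations are taken on assignments and compared only where the variables in \<open>V\<close> receive values of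
  the right sorts. With the closure properties below, definable sets can be described by their meaning,
  without writing formulas.
\<close>

definition definable :: "('s, 'f, 'r) lang \<Rightarrow> ('s, 'f, 'r, 'a) struc \<Rightarrow> ('s \<times> 'a) set \<Rightarrow> 's var set \<Rightarrow> (('s var \<Rightarrow> 'a) \<Rightarrow> bool) \<Rightarrow> bool" where
  "definable L M A V R \<longleftrightarrow> (\<exists>\<psi>. wf_fm L \<psi> \<and> fv \<psi> \<subseteq> V \<and> pars \<psi> \<subseteq> A \<and>
     (\<forall>e. (\<forall>v\<in>V. e v \<in> dom M (fst v)) \<longrightarrow> (sat M e \<psi> \<longleftrightarrow> R e)))"

lemma definableI: "\<lbrakk>wf_fm L \<psi>; fv \<psi> \<subseteq> V; pars \<psi> \<subseteq> A;
  \<And>e. (\<And>v. v \<in> V \<Longrightarrow> e v \<in> dom M (fst v)) \<Longrightarrow> sat M e \<psi> \<longleftrightarrow> R e\<rbrakk> \<Longrightarrow> definable L M A V R"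
  unfolding definable_def by blast

lemma definableE: assumes "definable L M A V R"
  obtains \<psi> where "wf_fm L \<psi>" "fv \<psi> \<subseteq> V" "pars \<psi> \<subseteq> A"
  "\<And>e. (\<And>v. v \<in> V \<Longrightarrow> e v \<in> dom M (fst v)) \<Longrightarrow> sat M e \<psi> \<longleftrightarrow> R e"
  using assms unfolding definable_def by metis

lemma definable_mono: assumes "definable L M A V R" "A \<subseteq> A'" "V \<subseteq> V'" shows "definable L M A' V' R"
proof -
  from assms(1) obtain \<psi> where \<psi>: "wf_fm L \<psi>" "fv \<psi> \<subseteq> V" "pars \<psi> \<subseteq> A"
    "\<And>e. (\<And>v. v \<in> V \<Longrightarrow> e v \<in> dom M (fst v)) \<Longrightarrow> sat M e \<psi> \<longleftrightarrow> R e" by (rule definableE) blast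
  show ?thesis
  proof (rule definableI[OF \<psi>(1)])
    fix e :: "'a var \<Rightarrow> 'd" assume e: "\<And>v. v \<in> V' \<Longrightarrow> e v \<in> dom M (fst v)"
    show "sat M e \<psi> \<longleftrightarrow> R e" using assms(3) by (intro \<psi>(4) e) (rule subsetD)
  qed (use \<psi> assms in blast)+
qed

lemma definable_cong: assumes "definable L M A V R" "\<And>e. (\<And>v. v \<in> V \<Longrightarrow> e v \<in> dom M (fst v)) \<Longrightarrow> R e \<longleftrightarrow> R' e"
  shows "definable L M A V R'"
  using assms unfolding definable_def by metis

lemma definable_not: assumes "definable L M A V R" shows "definable L M A V (\<lambda>e. \<not> R e)"
proof -
  from assms obtain \<psi> where "wf_fm L \<psi>" "fv \<psi> \<subseteq> V" "pars \<psi> \<subseteq> A"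
    and "\<And>e. (\<And>v. v \<in> V \<Longrightarrow> e v \<in> dom M (fst v)) \<Longrightarrow> sat M e \<psi> \<longleftrightarrow> R e" by (rule definableE) blast
  then show ?thesis by (intro definableI[of L "Neg \<psi>"]) auto
qed

lemma definable_or: assumes "definable L M A V R" "definable L M A V R'" shows "definable L M A V (\<lambda>e. R e \<or> R' e)"
proof -
  from assms(1) obtain \<psi> where 1: "wf_fm L \<psi>" "fv \<psi> \<subseteq> V" "pars \<psi> \<subseteq> A"
    "\<And>e. (\<And>v. v \<in> V \<Longrightarrow> e v \<in> dom M (fst v)) \<Longrightarrow> sat M e \<psi> \<longleftrightarrow> R e" by (rule definableE) blast
  from assms(2) obtain \<psi>' where 2: "wf_fm L \<psi>'" "fv \<psi>' \<subseteq> V" "pars \<psi>' \<subseteq> A"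
    "\<And>e. (\<And>v. v \<in> V \<Longrightarrow> e v \<in> dom M (fst v)) \<Longrightarrow> sat M e \<psi>' \<longleftrightarrow> R' e" by (rule definableE) blast
  show ?thesis using 1 2 by (intro definableI[of L "Or \<psi> \<psi>'"]) auto
qed

lemma definable_and: assumes "definable L M A V R" "definable L M A V R'" shows "definable L M A V (\<lambda>e. R e \<and> R' e)"
  using definable_not[OF definable_or[OF definable_not[OF assms(1)] definable_not[OF assms(2)]]] by simp

lemma definable_iff_bool: assumes "definable L M A V R" shows "definable L M A V (\<lambda>e. R e \<longleftrightarrow> b)"
  using assms definable_not[OF assms] by (cases b) auto

lemma definable_ex: assumes "definable L M A V R" shows "definable L M A (V - {v}) (\<lambda>e. \<exists>a\<in>dom M (fst v). R (e(v := a)))"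
proof -
  from assms obtain \<psi> where "wf_fm L \<psi>" "fv \<psi> \<subseteq> V" "pars \<psi> \<subseteq> A"
    and "\<And>e. (\<And>v. v \<in> V \<Longrightarrow> e v \<in> dom M (fst v)) \<Longrightarrow> sat M e \<psi> \<longleftrightarrow> R e" by (rule definableE) blast
  then show ?thesis by (intro definableI[of L "Ex v \<psi>"]) auto
qed

lemma definable_True: assumes "\<And>s. dom M s \<noteq> {}" shows "definable L M A V (\<lambda>e. True)"
proof -
  obtain v :: "'a \<times> nat" where True by simp
  show ?thesis using assms[of "fst v"] by (intro definableI[of L "Ex v (Eq (Var v) (Var v))"]) auto
qed

lemma definable_ball:
  assumes "\<And>s. dom M s \<noteq> {}" and "finite I" "\<And>i. i \<in> I \<Longrightarrow> definable L M A V (R i)"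
  shows "definable L M A V (\<lambda>e. \<forall>i\<in>I. R i e)"
  using assms(2,3)
proof (induction I rule: finite_induct)
  case empty then show ?case using definable_True[OF assms(1)] by simp
next
  case (insert i I)
  have "definable L M A V (\<lambda>e. R i e \<and> (\<forall>i\<in>I. R i e))" using insert by (intro definable_and) auto
  then show ?case by simp
qed

text \<open>
  The formula \<open>\<exists>v. v = w \<and> \<psi>\<close> avoids the capture of \<open>w\<close> that a substitution could cause.
\<close>

lemma definable_rename:
  assumes "definable L M A V R" "fst w = fst v" "w \<noteq> v"
  shows "definable L M A (insert w (V - {v})) (\<lambda>e. R (e(v := e w)))"
proof -
  from assms(1) obtain \<psi> where \<psi>: "wf_fm L \<psi>" "fv \<psi> \<subseteq> V" "pars \<psi> \<subseteq> A"
    "\<And>e. (\<And>v. v \<in> V \<Longrightarrow> e v \<in> dom M (fst v)) \<Longrightarrow> sat M e \<psi> \<longleftrightarrow> R e" by (rule definableE) blast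
  show ?thesis
  proof (rule definableI[of L "Ex v (Neg (Or (Neg (Eq (Var v) (Var w))) (Neg \<psi>)))"])
    fix e :: "'a var \<Rightarrow> 'd" assume e: "\<And>u. u \<in> insert w (V - {v}) \<Longrightarrow> e u \<in> dom M (fst u)"
    have "sat M (e(v := e w)) \<psi> \<longleftrightarrow> R (e(v := e w))" using e e[of w] assms(2) by (intro \<psi>(4)) auto
    then show "sat M e (Ex v (Neg (Or (Neg (Eq (Var v) (Var w))) (Neg \<psi>)))) \<longleftrightarrow> R (e(v := e w))"
      using e[of w] assms(2,3) by auto
  qed (use \<psi> assms in auto)
qed

lemma definable_param:
  assumes "definable L M A V R" "a \<in> dom M (fst v)"
  shows "definable L M (insert (fst v, a) A) (V - {v}) (\<lambda>e. R (e(v := a)))"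
proof -
  from assms(1) obtain \<psi> where \<psi>: "wf_fm L \<psi>" "fv \<psi> \<subseteq> V" "pars \<psi> \<subseteq> A"
    "\<And>e. (\<And>v. v \<in> V \<Longrightarrow> e v \<in> dom M (fst v)) \<Longrightarrow> sat M e \<psi> \<longleftrightarrow> R e" by (rule definableE) blast
  show ?thesis
  proof (rule definableI[of L "subst v (Par (fst v, a)) \<psi>"])
    fix e :: "'a var \<Rightarrow> 'd" assume e: "\<And>u. u \<in> V - {v} \<Longrightarrow> e u \<in> dom M (fst u)"
    have "sat M (e(v := a)) \<psi> \<longleftrightarrow> R (e(v := a))" using e assms(2) by (intro \<psi>(4)) auto
    then show "sat M e (subst v (Par (fst v, a)) \<psi>) \<longleftrightarrow> R (e(v := a))" by (simp add: sat_subst)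
  qed (use \<psi> fv_subst[of v "Par (fst v, a)" \<psi>] pars_subst[of v "Par (fst v, a)" \<psi>] in \<open>auto intro!: wf_subst\<close>)
qed

lemma definable_ex_set:
  assumes "finite W" "definable L M A V R"
  shows "definable L M A (V - W) (\<lambda>e. \<exists>f. (\<forall>w\<in>W. f w \<in> dom M (fst w)) \<and> R (\<lambda>w. if w \<in> W then f w else e w))"
  using assms
proof (induction W rule: finite_induct)
  case empty then show ?case by simp
next
  case (insert v W)
  have "definable L M A (V - W - {v}) (\<lambda>e. \<exists>a\<in>dom M (fst v). \<exists>f. (\<forall>w\<in>W. f w \<in> dom M (fst w)) \<and>
      R (\<lambda>w. if w \<in> W then f w else (e(v := a)) w))" using insert by (intro definable_ex) auto
  moreover have "V - W - {v} = V - insert v W" by auto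
  ultimately have "definable L M A (V - insert v W) (\<lambda>e. \<exists>a\<in>dom M (fst v). \<exists>f. (\<forall>w\<in>W. f w \<in> dom M (fst w)) \<and>
      R (\<lambda>w. if w \<in> W then f w else (e(v := a)) w))" by (simp only:)
  moreover have "(\<exists>a\<in>dom M (fst v). \<exists>f. (\<forall>w\<in>W. f w \<in> dom M (fst w)) \<and> R (\<lambda>w. if w \<in> W then f w else (e(v := a)) w))
    \<longleftrightarrow> (\<exists>f. (\<forall>w\<in>insert v W. f w \<in> dom M (fst w)) \<and> R (\<lambda>w. if w \<in> insert v W then f w else e w))" (is "?l \<longleftrightarrow> ?r") for e
  proof
    assume ?l
    then obtain a f where af: "a\<in>dom M (fst v)" "\<forall>w\<in>W. f w \<in> dom M (fst w)" "R (\<lambda>w. if w \<in> W then f w else (e(v := a)) w)" by blast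
    moreover have "(\<lambda>w. if w \<in> W then f w else (e(v := a)) w) = (\<lambda>w. if w \<in> insert v W then (f(v := a)) w else e w)"
      using insert.hyps by auto
    moreover have "\<forall>w\<in>insert v W. (f(v := a)) w \<in> dom M (fst w)" using af by auto
    ultimately show ?r by (intro exI[of _ "f(v := a)"] conjI) simp_all
  next
    assume ?r
    then obtain f where f: "\<forall>w\<in>insert v W. f w \<in> dom M (fst w)" "R (\<lambda>w. if w \<in> insert v W then f w else e w)" by blast
    moreover have "(\<lambda>w. if w \<in> insert v W then f w else e w) = (\<lambda>w. if w \<in> W then f w else (e(v := f v)) w)" by auto
    ultimately show ?l by (intro bexI[of _ "f v"] exI[of _ f]) auto
  qed
  ultimately show ?case by (simp only:)
qed

lemma definable_param_set:
  assumes "finite W" "definable L M A V R" "\<And>w. w \<in> W \<Longrightarrow> f w \<in> dom M (fst w)"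
  shows "definable L M (A \<union> (\<lambda>w. (fst w, f w)) ` W) (V - W) (\<lambda>e. R (\<lambda>w. if w \<in> W then f w else e w))"
  using assms
proof (induction W rule: finite_induct)
  case empty then show ?case by simp
next
  case (insert v W)
  have "definable L M (insert (fst v, f v) (A \<union> (\<lambda>w. (fst w, f w)) ` W)) (V - W - {v})
    (\<lambda>e. R (\<lambda>w. if w \<in> W then f w else (e(v := f v)) w))" using insert by (intro definable_param) auto
  moreover have "(\<lambda>w. if w \<in> W then f w else (e(v := f v)) w) = (\<lambda>w. if w \<in> insert v W then f w else e w)" for e
    by auto
  moreover have "V - W - {v} = V - insert v W" by auto
  moreover have "insert (fst v, f v) (A \<union> (\<lambda>w. (fst w, f w)) ` W) = A \<union> (\<lambda>w. (fst w, f w)) ` insert v W" by auto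
  ultimately show ?case by (simp only:)
qed

lemma sat_sol:
  assumes "fv \<phi> \<subseteq> {x}" "e x \<in> dom M (fst x)" shows "e x \<in> sol M x \<phi> \<longleftrightarrow> sat M e \<phi>"
proof -
  have "sat M ((\<lambda>_. undefined)(x := e x)) \<phi> = sat M e \<phi>" using assms(1) by (intro sat_cong) auto
  then show ?thesis using assms(2) by (simp add: sol_def)
qed

lemma definable_sol: assumes "\<phi> \<in> Lx L x A" shows "definable L M A {x} (\<lambda>e. e x \<in> sol M x \<phi>)"
  using assms by (intro definableI[of L \<phi>]) (auto simp: Lx_def sat_sol)

lemma definable_formula:
  assumes "definable L M A {x} (\<lambda>e. Q (e x))"
  obtains \<psi> where "\<psi> \<in> Lx L x A" "sol M x \<psi> = {a \<in> dom M (fst x). Q a}"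
proof -
  from assms obtain \<psi> where \<psi>: "wf_fm L \<psi>" "fv \<psi> \<subseteq> {x}" "pars \<psi> \<subseteq> A"
    "\<And>e. (\<And>v. v \<in> {x} \<Longrightarrow> e v \<in> dom M (fst v)) \<Longrightarrow> sat M e \<psi> \<longleftrightarrow> Q (e x)" by (rule definableE) blast
  have "sol M x \<psi> = {a \<in> dom M (fst x). Q a}" unfolding sol_def using \<psi>(4) by auto
  then show ?thesis using that \<psi>(1-3) by (auto simp: Lx_def)
qed

lemma definable_dep:
  assumes "definable L M A V R" "\<And>v. v \<in> V \<Longrightarrow> e v \<in> dom M (fst v)" "\<And>v. v \<in> V \<Longrightarrow> e v = e' v"
  shows "R e = R e'"
proof -
  obtain \<psi> where \<psi>: "wf_fm L \<psi>" "fv \<psi> \<subseteq> V" "pars \<psi> \<subseteq> A"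
    "\<And>e. (\<And>v. v \<in> V \<Longrightarrow> e v \<in> dom M (fst v)) \<Longrightarrow> sat M e \<psi> \<longleftrightarrow> R e"
    using assms(1) by (rule definableE) blast
  have "R e \<longleftrightarrow> sat M e \<psi>" using assms(2) by (intro \<psi>(4)[symmetric])
  also have "\<dots> \<longleftrightarrow> sat M e' \<psi>" by (intro sat_cong assms(3)) (rule subsetD[OF \<psi>(2)])
  also have "\<dots> \<longleftrightarrow> R e'"
  proof (rule \<psi>(4))
    fix v assume "v \<in> V" then show "e' v \<in> dom M (fst v)" using assms(2)[of v] assms(3)[of v] by simp
  qed
  finally show ?thesis .
qed

section \<open>Type spaces and Keisler measures\<close>

abbreviation And :: "('s, 'f, 'r, 'a) fm \<Rightarrow> ('s, 'f, 'r, 'a) fm \<Rightarrow> ('s, 'f, 'r, 'a) fm" where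
  "And \<phi> \<psi> \<equiv> Neg (Or (Neg \<phi>) (Neg \<psi>))"

abbreviation Tt :: "'s var \<Rightarrow> ('s, 'f, 'r, 'a) fm" where
  "Tt x \<equiv> Eq (Var x) (Var x)"

lemma sol_subset: "sol M x \<phi> \<subseteq> dom M (fst x)" by (auto simp: sol_def)
lemma sol_Neg: "sol M x (Neg \<phi>) = dom M (fst x) - sol M x \<phi>" by (auto simp: sol_def)
lemma sol_Or: "sol M x (Or \<phi> \<psi>) = sol M x \<phi> \<union> sol M x \<psi>" by (auto simp: sol_def)
lemma sol_And: "sol M x (And \<phi> \<psi>) = sol M x \<phi> \<inter> sol M x \<psi>" by (auto simp: sol_def)
lemma sol_Tt: "sol M x (Tt x) = dom M (fst x)" by (auto simp: sol_def)

lemma Lx_Neg [simp]: "Neg \<phi> \<in> Lx L x A \<longleftrightarrow> \<phi> \<in> Lx L x A" by (auto simp: Lx_def)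
lemma Lx_Or [simp]: "Or \<phi> \<psi> \<in> Lx L x A \<longleftrightarrow> \<phi> \<in> Lx L x A \<and> \<psi> \<in> Lx L x A" by (auto simp: Lx_def)
lemma Lx_Tt [simp]: "Tt x \<in> Lx L x A" by (auto simp: Lx_def)
lemma Lx_mono: "A \<subseteq> B \<Longrightarrow> Lx L x A \<subseteq> Lx L x B" by (auto simp: Lx_def)

text \<open>
  For \<open>D\<close> the whole sort this is consistency; for \<open>D\<close> the universe of a submodel it is finite
  satisfiability in that submodel.
\<close>

definition fin_sat :: "('s, 'f, 'r, 'a) struc \<Rightarrow> 's var \<Rightarrow> 'a set \<Rightarrow> ('s, 'f, 'r, 'a) fm set \<Rightarrow> bool" where
  "fin_sat M x D P \<longleftrightarrow> (\<forall>F. finite F \<and> F \<subseteq> P \<longrightarrow> (\<exists>a\<in>D. \<forall>\<phi>\<in>F. a \<in> sol M x \<phi>))"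

lemma fin_satD: "\<lbrakk>fin_sat M x D P; finite F; F \<subseteq> P\<rbrakk> \<Longrightarrow> \<exists>a\<in>D. \<forall>\<phi>\<in>F. a \<in> sol M x \<phi>"
  unfolding fin_sat_def by simp

text \<open>
  A maximal finitely satisfiable extension is complete: if adding \<open>\<phi>\<close> and adding \<open>Neg \<phi>\<close> both failed on
  finite sets, an element of \<open>D\<close> satisfying the remaining formulas would satisfy neither.
\<close>

lemma fin_sat_extend_type:
  assumes D: "D \<subseteq> dom M (fst x)" and P: "P \<subseteq> Lx L x A" "fin_sat M x D P"
  obtains p where "P \<subseteq> p" "p \<in> types L M x A" "fin_sat M x D p"
proof -
  define \<A> where "\<A> = {Q. P \<subseteq> Q \<and> Q \<subseteq> Lx L x A \<and> fin_sat M x D Q}"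
  have "\<exists>p\<in>\<A>. \<forall>Q\<in>\<A>. p \<subseteq> Q \<longrightarrow> Q = p"
  proof (rule subset_Zorn_nonempty)
    show "\<A> \<noteq> {}" using P by (auto simp: \<A>_def)
    fix \<C> assume C: "\<C> \<noteq> {}" "subset.chain \<A> \<C>"
    then have CA: "\<C> \<subseteq> \<A>" by (auto simp: subset_chain_def)
    have "fin_sat M x D (\<Union>\<C>)"
      unfolding fin_sat_def
    proof (intro allI impI)
      fix F assume F: "finite F \<and> F \<subseteq> \<Union>\<C>"
      obtain Q where Q: "Q \<in> \<C>" "F \<subseteq> Q"
        using finite_subset_Union_chain[of F \<C> \<A>] F C by blast
      then have "fin_sat M x D Q" using CA by (auto simp: \<A>_def)
      then show "\<exists>a\<in>D. \<forall>\<phi>\<in>F. a \<in> sol M x \<phi>" using fin_satD[of M x D Q F] F Q(2) by blast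
    qed
    moreover have "P \<subseteq> \<Union>\<C>" "\<Union>\<C> \<subseteq> Lx L x A" using C(1) CA by (auto simp: \<A>_def)
    ultimately show "\<Union>\<C> \<in> \<A>" by (simp add: \<A>_def)
  qed
  then obtain p where p: "p \<in> \<A>" and max: "\<And>Q. Q \<in> \<A> \<Longrightarrow> p \<subseteq> Q \<Longrightarrow> Q = p" by blast
  have pfs: "fin_sat M x D p" and pL: "p \<subseteq> Lx L x A" and Pp: "P \<subseteq> p" using p by (auto simp: \<A>_def)
  have ins: "\<psi> \<in> p" if "\<psi> \<in> Lx L x A" "fin_sat M x D (insert \<psi> p)" for \<psi>
  proof -
    have "insert \<psi> p \<in> \<A>" using that pL Pp by (auto simp: \<A>_def)
    then show ?thesis using max[of "insert \<psi> p"] by blast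
  qed
  have "\<phi> \<in> p \<or> Neg \<phi> \<in> p" if \<phi>: "\<phi> \<in> Lx L x A" for \<phi>
  proof (rule ccontr)
    assume "\<not> ?thesis"
    then have "\<not> fin_sat M x D (insert \<phi> p)" "\<not> fin_sat M x D (insert (Neg \<phi>) p)"
      using ins \<phi> by auto
    then obtain F1 F2 where F: "finite F1" "F1 \<subseteq> insert \<phi> p" "\<not> (\<exists>a\<in>D. \<forall>\<phi>\<in>F1. a \<in> sol M x \<phi>)"
      "finite F2" "F2 \<subseteq> insert (Neg \<phi>) p" "\<not> (\<exists>a\<in>D. \<forall>\<phi>\<in>F2. a \<in> sol M x \<phi>)"
      unfolding fin_sat_def by metis
    obtain a where a: "a \<in> D" "\<forall>\<psi>\<in>(F1 \<union> F2) \<inter> p. a \<in> sol M x \<psi>"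
      using fin_satD[OF pfs, of "(F1 \<union> F2) \<inter> p"] F by auto
    show False
    proof (cases "a \<in> sol M x \<phi>")
      case True
      then have "\<forall>\<psi>\<in>F1. a \<in> sol M x \<psi>" using a F(2) by blast
      then show False using F(3) a(1) by blast
    next
      case False
      then have "a \<in> sol M x (Neg \<phi>)" using a(1) D by (auto simp: sol_Neg)
      then have "\<forall>\<psi>\<in>F2. a \<in> sol M x \<psi>" using a F(5) by blast
      then show False using F(6) a(1) by blast
    qed
  qed
  then have "p \<in> types L M x A" using pL fin_satD[OF pfs] D by (fastforce simp: types_def)
  then show ?thesis using that Pp pfs by blast
qed

context
  fixes L :: "('s, 'f, 'r) lang" and M :: "('s, 'f, 'r, 'a) struc" and x :: "'s var" and A :: "('s \<times> 'a) set"
begin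

lemma types_Lx: "p \<in> types L M x A \<Longrightarrow> \<phi> \<in> p \<Longrightarrow> \<phi> \<in> Lx L x A"
  by (auto simp: types_def)

lemma types_fin_sat: "p \<in> types L M x A \<Longrightarrow> fin_sat M x (dom M (fst x)) p"
  by (auto simp: types_def fin_sat_def)

lemma types_complete: "p \<in> types L M x A \<Longrightarrow> \<phi> \<in> Lx L x A \<Longrightarrow> \<phi> \<in> p \<or> Neg \<phi> \<in> p"
  by (auto simp: types_def)

lemma types_entail:
  assumes p: "p \<in> types L M x A" and F: "finite F" "F \<subseteq> p" and \<psi>: "\<psi> \<in> Lx L x A"
    and ent: "\<And>a. a \<in> dom M (fst x) \<Longrightarrow> (\<And>\<phi>. \<phi> \<in> F \<Longrightarrow> a \<in> sol M x \<phi>) \<Longrightarrow> a \<in> sol M x \<psi>"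
  shows "\<psi> \<in> p"
proof (rule ccontr)
  assume "\<psi> \<notin> p"
  then have "Neg \<psi> \<in> p" using types_complete[OF p \<psi>] by blast
  then obtain a where "a \<in> dom M (fst x)" "\<forall>\<phi>\<in>insert (Neg \<psi>) F. a \<in> sol M x \<phi>"
    using fin_satD[OF types_fin_sat[OF p], of "insert (Neg \<psi>) F"] F by auto
  then show False using ent[of a] by (auto simp: sol_Neg)
qed

lemma types_Neg: assumes p: "p \<in> types L M x A" and \<phi>: "\<phi> \<in> Lx L x A" shows "Neg \<phi> \<in> p \<longleftrightarrow> \<phi> \<notin> p"
proof -
  have False if "\<phi> \<in> p" "Neg \<phi> \<in> p"
    using fin_satD[OF types_fin_sat[OF p], of "{\<phi>, Neg \<phi>}"] that by (auto simp: sol_Neg)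
  then show ?thesis using types_complete[OF p \<phi>] by blast
qed

lemma types_Or:
  assumes p: "p \<in> types L M x A" and "\<phi> \<in> Lx L x A" "\<psi> \<in> Lx L x A"
  shows "Or \<phi> \<psi> \<in> p \<longleftrightarrow> \<phi> \<in> p \<or> \<psi> \<in> p"
proof
  assume "Or \<phi> \<psi> \<in> p"
  show "\<phi> \<in> p \<or> \<psi> \<in> p"
  proof (rule ccontr)
    assume "\<not> ?thesis"
    then have "{Neg \<phi>, Neg \<psi>, Or \<phi> \<psi>} \<subseteq> p" using types_Neg[OF p] assms \<open>Or \<phi> \<psi> \<in> p\<close> by auto
    then show False using fin_satD[OF types_fin_sat[OF p], of "{Neg \<phi>, Neg \<psi>, Or \<phi> \<psi>}"]
      by (auto simp: sol_Neg sol_Or)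
  qed
next
  assume "\<phi> \<in> p \<or> \<psi> \<in> p"
  then show "Or \<phi> \<psi> \<in> p"
  proof
    assume "\<phi> \<in> p" then show ?thesis using assms by (intro types_entail[OF p, of "{\<phi>}"]) (auto simp: sol_Or)
  next
    assume "\<psi> \<in> p" then show ?thesis using assms by (intro types_entail[OF p, of "{\<psi>}"]) (auto simp: sol_Or)
  qed
qed

lemma types_Tt: "p \<in> types L M x A \<Longrightarrow> Tt x \<in> p"
  by (rule types_entail[of p "{}"]) (auto simp: sol_Tt)

lemma tp_in_types:
  assumes "a \<in> dom M (fst x)" shows "{\<phi> \<in> Lx L x A. a \<in> sol M x \<phi>} \<in> types L M x A"
  using assms by (auto simp: types_def sol_Neg)

lemma realizes_iff:
  assumes p: "p \<in> types L M x A" and d: "realizes M x d p" and \<phi>: "\<phi> \<in> Lx L x A"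
  shows "\<phi> \<in> p \<longleftrightarrow> d \<in> sol M x \<phi>"
proof
  show "\<phi> \<in> p" if "d \<in> sol M x \<phi>"
  proof (rule ccontr)
    assume "\<phi> \<notin> p"
    then have "Neg \<phi> \<in> p" using types_Neg[OF p \<phi>] by simp
    then show False using d that by (auto simp: realizes_def sol_Neg)
  qed
qed (use d in \<open>auto simp: realizes_def\<close>)

lemma types_restrict:
  assumes p: "p \<in> types L M x A" and B: "B \<subseteq> A" shows "p \<inter> Lx L x B \<in> types L M x B"
proof -
  have "fin_sat M x (dom M (fst x)) (p \<inter> Lx L x B)"
    using types_fin_sat[OF p] by (auto simp: fin_sat_def)
  then show ?thesis using types_complete[OF p] Lx_mono[OF B, of L x] by (auto simp: types_def fin_sat_def)
qed

abbreviation "bc \<equiv> basic_clopen L M x A"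
abbreviation "TS \<equiv> type_space L M x A"

lemma bc_mem: "p \<in> bc \<phi> \<longleftrightarrow> p \<in> types L M x A \<and> \<phi> \<in> p" by (simp add: basic_clopen_def)

lemma bc_Neg: "\<phi> \<in> Lx L x A \<Longrightarrow> bc (Neg \<phi>) = types L M x A - bc \<phi>"
  using types_Neg by (auto simp: bc_mem)

lemma bc_Or: "\<phi> \<in> Lx L x A \<Longrightarrow> \<psi> \<in> Lx L x A \<Longrightarrow> bc (Or \<phi> \<psi>) = bc \<phi> \<union> bc \<psi>"
  using types_Or by (auto simp: bc_mem)

lemma bc_Tt: "bc (Tt x) = types L M x A" using types_Tt by (auto simp: bc_mem)

lemma bc_And: "\<phi> \<in> Lx L x A \<Longrightarrow> \<psi> \<in> Lx L x A \<Longrightarrow> bc (And \<phi> \<psi>) = bc \<phi> \<inter> bc \<psi>"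
  by (auto simp: bc_Neg bc_Or bc_mem)

text \<open>
  Elements of the model have types over \<open>A\<close>, so a formula and the clopen set it defines determine the
  same solutions.
\<close>

lemma bc_mono_iff:
  assumes "\<phi> \<in> Lx L x A" "\<psi> \<in> Lx L x A"
  shows "bc \<phi> \<subseteq> bc \<psi> \<longleftrightarrow> sol M x \<phi> \<subseteq> sol M x \<psi>"
proof
  assume sub: "bc \<phi> \<subseteq> bc \<psi>"
  show "sol M x \<phi> \<subseteq> sol M x \<psi>"
  proof
    fix a assume a: "a \<in> sol M x \<phi>"
    then have "a \<in> dom M (fst x)" by (rule subsetD[OF sol_subset])
    then have "{\<phi> \<in> Lx L x A. a \<in> sol M x \<phi>} \<in> bc \<phi>" using tp_in_types a assms by (auto simp: bc_mem)
    then show "a \<in> sol M x \<psi>" using sub by (auto simp: bc_mem)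
  qed
next
  assume "sol M x \<phi> \<subseteq> sol M x \<psi>"
  show "bc \<phi> \<subseteq> bc \<psi>"
  proof
    fix p assume "p \<in> bc \<phi>"
    then have p: "p \<in> types L M x A" "\<phi> \<in> p" by (auto simp: bc_mem)
    have "\<psi> \<in> p" using \<open>sol M x \<phi> \<subseteq> sol M x \<psi>\<close> assms p(2) by (intro types_entail[OF p(1), of "{\<phi>}"]) auto
    then show "p \<in> bc \<psi>" using p(1) by (simp add: bc_mem)
  qed
qed

lemma topspace_TS [simp]: "topspace TS = types L M x A"
proof -
  have "\<Union> (bc ` Lx L x A) \<subseteq> types L M x A" by (auto simp: basic_clopen_def)
  moreover have "types L M x A \<subseteq> \<Union> (bc ` Lx L x A)" unfolding bc_Tt[symmetric] by (intro Union_upper imageI Lx_Tt)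
  ultimately have "\<Union> (bc ` Lx L x A) = types L M x A" by (rule antisym)
  then show ?thesis by (simp add: type_space_def topology_generated_by_topspace)
qed

lemma openin_bc: "\<phi> \<in> Lx L x A \<Longrightarrow> openin TS (bc \<phi>)"
  unfolding type_space_def by (intro topology_generated_by_Basis) auto

lemma closedin_bc: "\<phi> \<in> Lx L x A \<Longrightarrow> closedin TS (bc \<phi>)"
  using openin_bc[of "Neg \<phi>"] by (auto simp: closedin_def bc_Neg bc_mem)

lemma TS_base:
  assumes "openin TS U" "p \<in> U" obtains \<phi> where "\<phi> \<in> Lx L x A" "p \<in> bc \<phi>" "bc \<phi> \<subseteq> U"
proof -
  have "generate_topology_on (bc ` Lx L x A) U"
    using assms(1) unfolding type_space_def by (simp add: openin_topology_generated_by_iff)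
  then have "\<forall>p\<in>U. \<exists>\<phi>\<in>Lx L x A. p \<in> bc \<phi> \<and> bc \<phi> \<subseteq> U"
  proof induction
    case (Int a b)
    show ?case
    proof
      fix p assume "p \<in> a \<inter> b"
      then obtain \<phi> \<psi> where "\<phi> \<in> Lx L x A" "p \<in> bc \<phi>" "bc \<phi> \<subseteq> a" "\<psi> \<in> Lx L x A" "p \<in> bc \<psi>" "bc \<psi> \<subseteq> b"
        using Int by (meson IntD1 IntD2)
      then show "\<exists>\<phi>\<in>Lx L x A. p \<in> bc \<phi> \<and> bc \<phi> \<subseteq> a \<inter> b"
        by (intro bexI[of _ "And \<phi> \<psi>"]) (auto simp only: bc_And Lx_Neg Lx_Or)
    qed
  next
    case (UN K)
    then show ?case by (meson UnionE Union_upper order_trans)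
  qed auto
  then show ?thesis using that assms(2) by blast
qed

text \<open>
  If no finitely many members of a cover by basic sets suffice, the negations of their formulas are
  finitely satisfiable and lie in a type outside the cover.
\<close>

lemma compact_TS: "compact_space TS"
  unfolding compact_space_def compactin_def
proof (intro conjI allI impI)
  fix \<U> assume U: "Ball \<U> (openin TS) \<and> topspace TS \<subseteq> \<Union>\<U>"
  define \<Phi> where "\<Phi> = {\<phi>\<in>Lx L x A. \<exists>U\<in>\<U>. bc \<phi> \<subseteq> U}"
  have "\<not> fin_sat M x (dom M (fst x)) (Neg ` \<Phi>)"
  proof
    assume "fin_sat M x (dom M (fst x)) (Neg ` \<Phi>)"
    moreover have "Neg ` \<Phi> \<subseteq> Lx L x A" by (auto simp: \<Phi>_def)
    ultimately obtain p where p: "Neg ` \<Phi> \<subseteq> p" "p \<in> types L M x A"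
      using fin_sat_extend_type[OF subset_refl] by metis
    then obtain U where "U \<in> \<U>" "p \<in> U" "openin TS U" using U by auto
    then obtain \<phi> where "\<phi> \<in> Lx L x A" "p \<in> bc \<phi>" "bc \<phi> \<subseteq> U" using TS_base by blast
    then have "\<phi> \<in> \<Phi>" using \<open>U \<in> \<U>\<close> by (auto simp: \<Phi>_def)
    then have "Neg \<phi> \<in> p" using p by auto
    then show False using types_Neg[OF p(2) \<open>\<phi> \<in> Lx L x A\<close>] \<open>p \<in> bc \<phi>\<close> by (auto simp: bc_mem)
  qed
  then obtain F' where "finite F'" "F' \<subseteq> Neg ` \<Phi>" "\<not> (\<exists>a\<in>dom M (fst x). \<forall>\<phi>\<in>F'. a \<in> sol M x \<phi>)"
    unfolding fin_sat_def by blast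
  moreover from this(1,2) obtain F where "finite F" "F \<subseteq> \<Phi>" "F' = Neg ` F" by (meson finite_subset_image)
  ultimately have F: "finite F" "F \<subseteq> \<Phi>" "\<not> (\<exists>a\<in>dom M (fst x). \<forall>\<phi>\<in>F. a \<in> sol M x (Neg \<phi>))"
    by auto
  define u where "u \<phi> = (SOME U. U \<in> \<U> \<and> bc \<phi> \<subseteq> U)" for \<phi>
  have u: "u \<phi> \<in> \<U> \<and> bc \<phi> \<subseteq> u \<phi>" if "\<phi> \<in> F" for \<phi>
    unfolding u_def by (rule someI_ex) (use that F(2) in \<open>auto simp: \<Phi>_def\<close>)
  have "topspace TS \<subseteq> \<Union> (u ` F)"
  proof
    fix p assume "p \<in> topspace TS"
    then have p: "p \<in> types L M x A" by simp
    have "\<exists>\<phi>\<in>F. \<phi> \<in> p"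
    proof (rule ccontr)
      assume "\<not> ?thesis"
      then have "Neg ` F \<subseteq> p" using types_Neg[OF p] F(2) by (auto simp: \<Phi>_def)
      then show False using fin_satD[OF types_fin_sat[OF p], of "Neg ` F"] F by auto
    qed
    then show "p \<in> \<Union> (u ` F)" using u p by (auto simp: bc_mem subset_iff)
  qed
  then show "\<exists>\<F>. finite \<F> \<and> \<F> \<subseteq> \<U> \<and> topspace TS \<subseteq> \<Union>\<F>" using F(1) u by (intro exI[of _ "u ` F"]) auto
qed auto

lemma Hausdorff_TS: "Hausdorff_space TS"
  unfolding Hausdorff_space_def
proof (intro allI impI)
  fix p q assume pq: "p \<in> topspace TS \<and> q \<in> topspace TS \<and> p \<noteq> q"
  have p: "p \<in> types L M x A" and q: "q \<in> types L M x A" using pq by auto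
  have "\<exists>\<phi>\<in>Lx L x A. \<phi> \<in> p \<and> \<phi> \<notin> q"
  proof (cases "p \<subseteq> q")
    case False then show ?thesis using types_Lx[OF p] by blast
  next
    case True
    then obtain \<psi> where \<psi>: "\<psi> \<in> q" "\<psi> \<notin> p" using pq by blast
    then have "\<psi> \<in> Lx L x A" using types_Lx[OF q] by blast
    then show ?thesis using \<psi> types_Neg[OF p] types_Neg[OF q] by (intro bexI[of _ "Neg \<psi>"]) auto
  qed
  then obtain \<phi> where \<phi>: "\<phi> \<in> Lx L x A" "\<phi> \<in> p" "\<phi> \<notin> q" by blast
  then show "\<exists>U V. openin TS U \<and> openin TS V \<and> p \<in> U \<and> q \<in> V \<and> disjnt U V"
    using p q openin_bc[of \<phi>] openin_bc[of "Neg \<phi>"]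
    by (intro exI[of _ "bc \<phi>"] exI[of _ "bc (Neg \<phi>)"]) (auto simp: bc_Neg bc_mem disjnt_def)
qed

lemma keislerD:
  assumes "\<mu> \<in> keisler L M x A"
  shows "\<phi> \<in> Lx L x A \<Longrightarrow> 0 \<le> \<mu> \<phi>" "\<phi> \<in> Lx L x A \<Longrightarrow> \<mu> \<phi> \<le> 1"
    "\<phi> \<in> Lx L x A \<Longrightarrow> \<psi> \<in> Lx L x A \<Longrightarrow> sol M x \<phi> = sol M x \<psi> \<Longrightarrow> \<mu> \<phi> = \<mu> \<psi>"
    "\<phi> \<in> Lx L x A \<Longrightarrow> sol M x \<phi> = dom M (fst x) \<Longrightarrow> \<mu> \<phi> = 1"
    "\<phi> \<in> Lx L x A \<Longrightarrow> \<psi> \<in> Lx L x A \<Longrightarrow> sol M x \<phi> \<inter> sol M x \<psi> = {} \<Longrightarrow> \<mu> (Or \<phi> \<psi>) = \<mu> \<phi> + \<mu> \<psi>"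
    "\<mu> \<in> extensional (Lx L x A)"
proof -
  note all = assms[unfolded keisler_def mem_Collect_eq]
  note 1 = all[THEN conjunct1] and 2 = all[THEN conjunct2, THEN conjunct1]
    and 3 = all[THEN conjunct2, THEN conjunct2, THEN conjunct1] and 4 = all[THEN conjunct2, THEN conjunct2, THEN conjunct2]
  show "0 \<le> \<mu> \<phi>" "\<mu> \<phi> \<le> 1" if "\<phi> \<in> Lx L x A" for \<phi> using PiE_mem[OF 1 that] by auto
  show "\<mu> \<phi> = \<mu> \<psi>" if "\<phi> \<in> Lx L x A" "\<psi> \<in> Lx L x A" "sol M x \<phi> = sol M x \<psi>" for \<phi> \<psi>
    by (rule 2[rule_format, OF that])
  show "\<mu> \<phi> = 1" if "\<phi> \<in> Lx L x A" "sol M x \<phi> = dom M (fst x)" for \<phi> by (rule 3[rule_format, OF that])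
  show "\<mu> (Or \<phi> \<psi>) = \<mu> \<phi> + \<mu> \<psi>" if "\<phi> \<in> Lx L x A" "\<psi> \<in> Lx L x A" "sol M x \<phi> \<inter> sol M x \<psi> = {}" for \<phi> \<psi>
    by (rule 4[rule_format, OF that])
  show "\<mu> \<in> extensional (Lx L x A)" using 1 by (simp add: PiE_def)
qed

lemma keisler_content:
  assumes \<mu>: "\<mu> \<in> keisler L M x A"
  obtains m where "clopen_content TS (bc ` Lx L x A) m" "\<And>\<phi>. \<phi> \<in> Lx L x A \<Longrightarrow> m (bc \<phi>) = \<mu> \<phi>"
proof -
  define m where "m C = \<mu> (SOME \<phi>. \<phi> \<in> Lx L x A \<and> bc \<phi> = C)" for C
  have m: "m (bc \<phi>) = \<mu> \<phi>" if "\<phi> \<in> Lx L x A" for \<phi>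
  proof -
    have "(SOME \<psi>. \<psi> \<in> Lx L x A \<and> bc \<psi> = bc \<phi>) \<in> Lx L x A \<and> bc (SOME \<psi>. \<psi> \<in> Lx L x A \<and> bc \<psi> = bc \<phi>) = bc \<phi>"
      by (rule someI[of _ \<phi>]) (use that in simp)
    then show ?thesis unfolding m_def using that bc_mono_iff by (intro keislerD(3)[OF \<mu>]) blast+
  qed
  have "clopen_content TS (bc ` Lx L x A) m"
  proof
    fix C D assume "C \<in> bc ` Lx L x A" "D \<in> bc ` Lx L x A"
    then obtain \<phi> \<psi> where \<phi>: "\<phi> \<in> Lx L x A" "C = bc \<phi>" and \<psi>: "\<psi> \<in> Lx L x A" "D = bc \<psi>" by auto
    have "C \<union> D = bc (Or \<phi> \<psi>)" using \<phi> \<psi> by (simp add: bc_Or)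
    then show "C \<union> D \<in> bc ` Lx L x A" using \<phi> \<psi> by auto
    have N: "Neg \<psi> \<in> Lx L x A" using \<psi> by simp
    have "bc (And \<phi> (Neg \<psi>)) = bc \<phi> \<inter> (types L M x A - bc \<psi>)"
      unfolding bc_And[OF \<phi>(1) N] bc_Neg[OF \<psi>(1)] ..
    moreover have "C - D = bc \<phi> \<inter> (types L M x A - bc \<psi>)"
      unfolding \<phi>(2) \<psi>(2) by (auto simp: basic_clopen_def)
    ultimately have "C - D = bc (And \<phi> (Neg \<psi>))" by (simp only:)
    moreover have "And \<phi> (Neg \<psi>) \<in> Lx L x A" using \<phi> \<psi> by simp
    ultimately show "C - D \<in> bc ` Lx L x A" by (simp only: imageI)
    assume "C \<inter> D = {}"
    have "sol M x \<phi> \<inter> sol M x \<psi> = {}"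
    proof -
      have "sol M x \<phi> \<subseteq> sol M x (Neg \<psi>)"
      proof (subst bc_mono_iff[symmetric])
        show "bc \<phi> \<subseteq> bc (Neg \<psi>)" unfolding bc_Neg[OF \<psi>(1)]
          using \<open>C \<inter> D = {}\<close> unfolding \<phi>(2) \<psi>(2) by (auto simp: basic_clopen_def)
      qed (use \<phi> \<psi> in simp_all)
      then show ?thesis by (auto simp: sol_Neg)
    qed
    then have "\<mu> (Or \<phi> \<psi>) = \<mu> \<phi> + \<mu> \<psi>" by (rule keislerD(5)[OF \<mu> \<phi>(1) \<psi>(1)])
    moreover have "Or \<phi> \<psi> \<in> Lx L x A" using \<phi>(1) \<psi>(1) by simp
    ultimately show "m (C \<union> D) = m C + m D"
      unfolding \<phi>(2) \<psi>(2) bc_Or[OF \<phi>(1) \<psi>(1), symmetric] by (simp only: m \<phi>(1) \<psi>(1))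
  next
    fix U p assume "openin TS U" "p \<in> U"
    then obtain \<phi> where "\<phi> \<in> Lx L x A" "p \<in> bc \<phi>" "bc \<phi> \<subseteq> U" by (rule TS_base)
    then show "\<exists>C\<in>bc ` Lx L x A. p \<in> C \<and> C \<subseteq> U" by (intro bexI[of _ "bc \<phi>"] conjI imageI)
  next
    show "topspace TS \<in> bc ` Lx L x A" by (simp, subst bc_Tt[symmetric], simp)
    show "m (topspace TS) = 1"
      using m[of "Tt x"] keislerD(4)[OF \<mu>, of "Tt x"] by (simp add: bc_Tt sol_Tt)
  next
    fix C assume "C \<in> bc ` Lx L x A"
    then obtain \<phi> where \<phi>: "\<phi> \<in> Lx L x A" "C = bc \<phi>" by blast
    show "openin TS C" "closedin TS C" unfolding \<phi>(2) using openin_bc[OF \<phi>(1)] closedin_bc[OF \<phi>(1)] .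
    show "0 \<le> m C" unfolding \<phi>(2) m[OF \<phi>(1)] by (rule keislerD(1)[OF \<mu> \<phi>(1)])
  qed (rule compact_TS Hausdorff_TS)+
  then show ?thesis by (rule that[OF _ m])
qed

lemma keisler_borel_props:
  assumes \<mu>: "\<mu> \<in> keisler L M x A"
  shows keisler_borel_regular: "regular_borel_prob TS (keisler_borel L M x A \<mu>)"
    and keisler_borel_bc: "\<And>\<phi>. \<phi> \<in> Lx L x A \<Longrightarrow> measure (keisler_borel L M x A \<mu>) (bc \<phi>) = \<mu> \<phi>"
    and keisler_borel_unique: "\<And>P. regular_borel_prob TS P \<Longrightarrow>
      (\<And>\<phi>. \<phi> \<in> Lx L x A \<Longrightarrow> measure P (bc \<phi>) = \<mu> \<phi>) \<Longrightarrow> P = keisler_borel L M x A \<mu>"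
proof -
  obtain m where m: "clopen_content TS (bc ` Lx L x A) m" "\<And>\<phi>. \<phi> \<in> Lx L x A \<Longrightarrow> m (bc \<phi>) = \<mu> \<phi>"
    using keisler_content[OF \<mu>] by metis
  interpret clopen_content TS "bc ` Lx L x A" m by (rule m(1))
  have uniq: "P = borel_extension" if "regular_borel_prob TS P" "\<And>\<phi>. \<phi> \<in> Lx L x A \<Longrightarrow> measure P (bc \<phi>) = \<mu> \<phi>" for P
    using that m(2) by (intro regular_borel_unique) auto
  have eq: "keisler_borel L M x A \<mu> = borel_extension"
    unfolding keisler_borel_def
  proof (rule the_equality)
    show "regular_borel_prob TS borel_extension \<and> (\<forall>\<phi>\<in>Lx L x A. measure borel_extension (bc \<phi>) = \<mu> \<phi>)"
      using regular_borel_extension measure_borel_extension m(2) by auto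
  qed (use uniq in auto)
  show "regular_borel_prob TS (keisler_borel L M x A \<mu>)" using regular_borel_extension by (simp add: eq)
  show "\<And>\<phi>. \<phi> \<in> Lx L x A \<Longrightarrow> measure (keisler_borel L M x A \<mu>) (bc \<phi>) = \<mu> \<phi>"
    using measure_borel_extension m(2) by (simp add: eq)
  show "\<And>P. regular_borel_prob TS P \<Longrightarrow>
      (\<And>\<phi>. \<phi> \<in> Lx L x A \<Longrightarrow> measure P (bc \<phi>) = \<mu> \<phi>) \<Longrightarrow> P = keisler_borel L M x A \<mu>"
    using uniq by (simp add: eq)
qed

lemma closedin_supp:
  assumes \<mu>: "\<mu> \<in> keisler L M x A" shows "closedin TS (supp L M x A \<mu>)"
proof -
  have "topspace TS - supp L M x A \<mu> = \<Union> (bc ` {\<phi> \<in> Lx L x A. \<not> \<mu> \<phi> > 0})"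
    using types_Lx by (auto simp: supp_def bc_mem) blast
  then have "openin TS (topspace TS - supp L M x A \<mu>)" by (auto intro!: openin_Union openin_bc)
  then show ?thesis by (auto simp: closedin_def supp_def)
qed

lemma measure_supp:
  assumes \<mu>: "\<mu> \<in> keisler L M x A" shows "measure (keisler_borel L M x A \<mu>) (supp L M x A \<mu>) = 1"
proof (rule regular_full_measure[OF keisler_borel_regular[OF \<mu>]])
  have "sets (keisler_borel L M x A \<mu>) = sets (borel_of TS)"
    using keisler_borel_regular[OF \<mu>] by (simp add: regular_borel_prob_def)
  then show "supp L M x A \<mu> \<in> sets (keisler_borel L M x A \<mu>)"
    using borel_of_closedin[OF closedin_supp[OF \<mu>]] by simp
  fix p assume "p \<in> topspace TS - supp L M x A \<mu>"
  then obtain \<phi> where p: "p \<in> types L M x A" "\<phi> \<in> p" "\<not> \<mu> \<phi> > 0" by (auto simp: supp_def)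
  then have \<phi>: "\<phi> \<in> Lx L x A" using types_Lx by blast
  then have "\<mu> \<phi> = 0" using p(3) keislerD(1)[OF \<mu> \<phi>] by simp
  then show "\<exists>U. openin TS U \<and> p \<in> U \<and> measure (keisler_borel L M x A \<mu>) U = 0"
    using p \<phi> openin_bc keisler_borel_bc[OF \<mu>] by (intro exI[of _ "bc \<phi>"]) (auto simp: bc_mem)
qed

text \<open>
  Both values equal the measure of the conjunction when the two differences are null.
\<close>

lemma keisler_eqI:
  assumes \<mu>: "\<mu> \<in> keisler L M x A" and \<phi>: "\<phi> \<in> Lx L x A" and \<psi>: "\<psi> \<in> Lx L x A"
    and 0: "\<not> \<mu> (And \<phi> (Neg \<psi>)) > 0" "\<not> \<mu> (And \<psi> (Neg \<phi>)) > 0"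
  shows "\<mu> \<phi> = \<mu> \<psi>"
proof -
  have half: "\<mu> \<phi> = \<mu> (And \<phi> \<psi>)" if \<phi>: "\<phi> \<in> Lx L x A" and \<psi>: "\<psi> \<in> Lx L x A" and 0: "\<not> \<mu> (And \<phi> (Neg \<psi>)) > 0" for \<phi> \<psi>
  proof -
    have "\<mu> \<phi> = \<mu> (Or (And \<phi> \<psi>) (And \<phi> (Neg \<psi>)))"
      using \<phi> \<psi> sol_subset[of M x \<phi>] by (intro keislerD(3)[OF \<mu>]) (auto simp: sol_Or sol_Neg)
    also have "\<dots> = \<mu> (And \<phi> \<psi>) + \<mu> (And \<phi> (Neg \<psi>))"
      using \<phi> \<psi> by (intro keislerD(5)[OF \<mu>]) (auto simp: sol_Or sol_Neg)
    also have "\<mu> (And \<phi> (Neg \<psi>)) = 0" using 0 keislerD(1)[OF \<mu>, of "And \<phi> (Neg \<psi>)"] \<phi> \<psi> by simp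
    finally show ?thesis by simp
  qed
  have "\<mu> (And \<phi> \<psi>) = \<mu> (And \<psi> \<phi>)" using \<phi> \<psi> by (intro keislerD(3)[OF \<mu>]) (auto simp: sol_Or sol_Neg)
  then show ?thesis using half[OF \<phi> \<psi> 0(1)] half[OF \<psi> \<phi> 0(2)] by simp
qed

end

lemma keisler_restrict:
  assumes \<mu>: "\<mu> \<in> keisler L M x B" and "A \<subseteq> B" shows "restrict \<mu> (Lx L x A) \<in> keisler L M x A"
  using \<mu> Lx_mono[OF assms(2), of L x] unfolding keisler_def PiE_def Pi_def by (simp add: subset_iff)

lemma continuous_map_restrict_type:
  assumes "A \<subseteq> B"
  shows "continuous_map (type_space L M x B) (type_space L M x A) (\<lambda>p. p \<inter> Lx L x A)"
  unfolding type_space_def[of L M x A]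
proof (rule continuous_on_generated_topo)
  show "(\<lambda>p. p \<inter> Lx L x A) ` topspace (type_space L M x B) \<subseteq> \<Union> (basic_clopen L M x A ` Lx L x A)"
    using topspace_TS[of L M x A] unfolding type_space_def[of L M x A] topology_generated_by_topspace
    by (auto simp: types_restrict[OF _ assms])
  fix U assume "U \<in> basic_clopen L M x A ` Lx L x A"
  then obtain \<phi> where \<phi>: "\<phi> \<in> Lx L x A" "U = basic_clopen L M x A \<phi>" by blast
  then have "(\<lambda>p. p \<inter> Lx L x A) -` U \<inter> topspace (type_space L M x B) = basic_clopen L M x B \<phi>"
    using types_restrict[OF _ assms, of _ L M x] by (auto simp: bc_mem)
  then show "openin (type_space L M x B) ((\<lambda>p. p \<inter> Lx L x A) -` U \<inter> topspace (type_space L M x B))"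
    using openin_bc[of \<phi> L x B M] \<phi> Lx_mono[OF assms, of L x] by auto
qed

lemma types_conj:
  assumes q: "q \<in> types L M x A" and F: "finite F" "F \<subseteq> q"
  obtains \<psi> where "\<psi> \<in> q" "\<And>a \<phi>. a \<in> sol M x \<psi> \<Longrightarrow> \<phi> \<in> F \<Longrightarrow> a \<in> sol M x \<phi>"
proof -
  have "\<exists>\<psi>\<in>q. \<forall>a\<in>sol M x \<psi>. \<forall>\<phi>\<in>F. a \<in> sol M x \<phi>"
    using F
  proof (induction F rule: finite_induct)
    case empty then show ?case using types_Tt[OF q] by auto
  next
    case (insert \<phi> F)
    then obtain \<psi> where \<psi>: "\<psi> \<in> q" "\<forall>a\<in>sol M x \<psi>. \<forall>\<phi>\<in>F. a \<in> sol M x \<phi>" by auto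
    have L: "\<psi> \<in> Lx L x A" "\<phi> \<in> Lx L x A" using types_Lx[OF q] \<psi> insert.prems by auto
    have "And \<psi> \<phi> \<in> q"
    proof (rule types_entail[OF q, of "{\<psi>, \<phi>}"])
      show "And \<psi> \<phi> \<in> Lx L x A" using L by simp
    qed (use \<psi> insert.prems in \<open>auto simp only: sol_And\<close>)
    moreover have "\<forall>a\<in>sol M x (And \<psi> \<phi>). \<forall>\<theta>\<in>insert \<phi> F. a \<in> sol M x \<theta>" unfolding sol_And using \<psi> by blast
    ultimately show ?case by blast
  qed
  then show ?thesis using that by blast
qed

section \<open>Saturation and the independence property\<close>

locale nip_group =
  fixes L :: "('s, 'f, 'r) lang" and T :: "('s, 'f, 'r, 'a) fm set" and \<kappa> :: "'k rel"
    and M G :: "('s, 'f, 'r, 'a) struc" and x :: "'s var" and mul :: 'f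
  assumes nip: "NIP L T"
    and mul_sig: "fun_sig L mul = Some ([fst x, fst x], fst x)"
    and monster: "monster_model L T \<kappa> M"
    and G_sub: "elem_sub L G M"
    and G_small: "small \<kappa> G"
begin

lemma model_M: "is_model L T M" and card_\<kappa>: "Card_order \<kappa>"
  and L_less: "|L_formulas L :: ('s, 'f, 'r, 'a) fm set| <o \<kappa>" and sat_M: "saturated L \<kappa> M"
  using monster by (auto simp: monster_model_def)

lemma struc_M: "is_struc L M" using model_M by (simp add: is_model_def)

lemma dom_ne: "dom M s \<noteq> {}" using struc_M by (simp add: is_struc_def)

lemma infinite_L: "infinite (L_formulas L :: ('s, 'f, 'r, 'a) fm set)"
proof
  assume fin: "finite (L_formulas L :: ('s, 'f, 'r, 'a) fm set)"
  define f where "f n = (Eq (Var (fst x, n)) (Var (fst x, n)) :: ('s, 'f, 'r, 'a) fm)" for n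
  have "inj f" by (auto simp: f_def inj_on_def)
  moreover have "range f \<subseteq> L_formulas L" by (auto simp: f_def L_formulas_def)
  ultimately show False using fin finite_subset finite_imageD by (metis infinite_UNIV_nat)
qed

lemma infinite_\<kappa>: "infinite (Field \<kappa>)"
proof
  assume fin: "finite (Field \<kappa>)"
  have "|L_formulas L :: ('s, 'f, 'r, 'a) fm set| \<le>o |Field \<kappa>|"
    using L_less card_\<kappa> by (meson card_of_Field_ordIso ordIso_symmetric ordLeq_ordIso_trans ordLess_imp_ordLeq)
  then show False using card_of_ordLeq_finite[OF _ fin] infinite_L by blast
qed

lemma less_\<kappa>_Un: "|A| <o \<kappa> \<Longrightarrow> |B| <o \<kappa> \<Longrightarrow> |A \<union> B| <o \<kappa>"
  using card_of_Un_ordLess_infinite_Field[OF infinite_\<kappa> card_\<kappa>] .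

lemma less_\<kappa>_countable:
  assumes "countable A" shows "|A| <o \<kappa>"
proof -
  have "|A| \<le>o |UNIV :: nat set|" using assms by (meson card_of_ordLeqI countableE subset_UNIV UNIV_I)
  also have "|UNIV :: nat set| \<le>o |L_formulas L :: ('s, 'f, 'r, 'a) fm set|"
    using infinite_L by (simp add: infinite_iff_card_of_nat)
  finally show ?thesis using L_less ordLeq_ordLess_trans by blast
qed

lemma realize_partial_type:
  assumes "A \<subseteq> univ M" "|A| <o \<kappa>" "P \<subseteq> Lx L z A" "fin_sat M z (dom M (fst z)) P"
  obtains d where "d \<in> dom M (fst z)" "\<And>\<phi>. \<phi> \<in> P \<Longrightarrow> d \<in> sol M z \<phi>"
proof -
  obtain p where p: "P \<subseteq> p" "p \<in> types L M z A"
    using fin_sat_extend_type[OF subset_refl assms(3,4)] by metis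
  then obtain d where "realizes M z d p" using sat_M assms(1,2) unfolding saturated_def by blast
  then show ?thesis using that p(1) by (auto simp: realizes_def)
qed

lemma realize_type:
  assumes "A \<subseteq> univ M" "|A| <o \<kappa>" "p \<in> types L M z A"
  obtains d where "realizes M z d p"
  using sat_M assms unfolding saturated_def by blast

text \<open>
  Saturation for families of conditions given as definable relations.
\<close>

lemma realize_definable:
  assumes A: "A \<subseteq> univ M" "|A| <o \<kappa>"
    and def: "\<And>j. j \<in> J \<Longrightarrow> definable L M A {z} (\<lambda>e. R j (e z))"
    and fin: "\<And>F. finite F \<Longrightarrow> F \<subseteq> J \<Longrightarrow> \<exists>a\<in>dom M (fst z). \<forall>j\<in>F. R j a"
  obtains d where "d \<in> dom M (fst z)" "\<And>j. j \<in> J \<Longrightarrow> R j d"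
proof -
  have "\<exists>\<psi>. \<psi> \<in> Lx L z A \<and> sol M z \<psi> = {a \<in> dom M (fst z). R j a}" if "j \<in> J" for j
    using definable_formula[OF def[OF that]] by metis
  then obtain \<psi> where \<psi>: "\<And>j. j \<in> J \<Longrightarrow> \<psi> j \<in> Lx L z A \<and> sol M z (\<psi> j) = {a \<in> dom M (fst z). R j a}"
    by metis
  have "fin_sat M z (dom M (fst z)) (\<psi> ` J)"
    unfolding fin_sat_def
  proof (intro allI impI)
    fix F assume "finite F \<and> F \<subseteq> \<psi> ` J"
    then obtain F' where F': "finite F'" "F' \<subseteq> J" "F = \<psi> ` F'" by (meson finite_subset_image)
    then obtain a where "a \<in> dom M (fst z)" "\<forall>j\<in>F'. R j a" using fin by blast
    then show "\<exists>a\<in>dom M (fst z). \<forall>\<phi>\<in>F. a \<in> sol M z \<phi>"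
      using F' \<psi> by (intro bexI[of _ a]) auto
  qed
  moreover have "\<psi> ` J \<subseteq> Lx L z A" using \<psi> by auto
  ultimately obtain d where d: "d \<in> dom M (fst z)" "\<And>\<phi>. \<phi> \<in> \<psi> ` J \<Longrightarrow> d \<in> sol M z \<phi>"
    using realize_partial_type[OF A] by metis
  show ?thesis
  proof (rule that[OF d(1)])
    fix j assume "j \<in> J"
    then show "R j d" using d(2)[of "\<psi> j"] \<psi>[of j] by auto
  qed
qed

text \<open>
  If every finite pattern on \<open>a\<^sub>0, a\<^sub>1, \<dots>\<close> is cut out by some \<open>b\<close>, then by saturation so is every subset of
  the index set, which is the independence property.
\<close>

lemma no_infinite_shattering:
  assumes A: "A \<subseteq> univ M" "|A| <o \<kappa>" and def: "definable L M A {u, v} (\<lambda>e. Q (e u) (e v))" and uv: "u \<noteq> v"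
    and a: "\<And>i::nat. a i \<in> dom M (fst u)"
    and sh: "\<And>m s. s \<subseteq> {..<m} \<Longrightarrow> \<exists>b\<in>dom M (fst v). \<forall>i<m. Q (a i) b \<longleftrightarrow> i \<in> s"
  shows False
proof -
  define B where "B = A \<union> (\<lambda>i. (fst u, a i)) ` UNIV"
  have B: "B \<subseteq> univ M" "|B| <o \<kappa>"
    unfolding B_def using A(1) a by (auto simp: univ_def) (intro less_\<kappa>_Un A(2) less_\<kappa>_countable, auto)
  have "\<exists>b\<in>dom M (fst v). \<forall>i. Q (a i) b \<longleftrightarrow> i \<in> I" for I
  proof -
    have "definable L M B {v} (\<lambda>e. Q (a i) (e v) \<longleftrightarrow> i \<in> I)" for i
    proof -
      have "definable L M (insert (fst u, a i) A) ({u, v} - {u}) (\<lambda>e. Q ((e(u := a i)) u) ((e(u := a i)) v))"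
        by (rule definable_param[OF def a])
      then have "definable L M (insert (fst u, a i) A) ({u, v} - {u}) (\<lambda>e. Q (a i) (e v))" using uv by simp
      then have "definable L M B {v} (\<lambda>e. Q (a i) (e v))" by (rule definable_mono) (auto simp: B_def)
      then show ?thesis by (rule definable_iff_bool)
    qed
    moreover have "\<exists>b\<in>dom M (fst v). \<forall>i\<in>F. Q (a i) b \<longleftrightarrow> i \<in> I" if F: "finite F" for F
    proof -
      obtain m where m: "\<And>i. i \<in> F \<Longrightarrow> i < m" using F finite_nat_iff_bounded[of F] by auto
      obtain b where "b\<in>dom M (fst v)" "\<forall>i<m. Q (a i) b \<longleftrightarrow> i \<in> I \<inter> {..<m}" using sh[of "I \<inter> {..<m}" m] by auto
      then show ?thesis using m by (intro bexI[of _ b]) auto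
    qed
    ultimately obtain b where "b \<in> dom M (fst v)" "\<And>i. i \<in> UNIV \<Longrightarrow> Q (a i) b \<longleftrightarrow> i \<in> I"
      using realize_definable[OF B, of UNIV v "\<lambda>i b. Q (a i) b \<longleftrightarrow> i \<in> I"] by metis
    then show ?thesis by auto
  qed
  then obtain b where b: "\<And>I. b I \<in> dom M (fst v)" "\<And>I i. Q (a i) (b I) \<longleftrightarrow> i \<in> I" by metis
  obtain \<psi> where \<psi>: "wf_fm L \<psi>" "fv \<psi> \<subseteq> {u, v}" "pars \<psi> \<subseteq> A"
    "\<And>e. (\<And>w. w \<in> {u, v} \<Longrightarrow> e w \<in> dom M (fst w)) \<Longrightarrow> sat M e \<psi> \<longleftrightarrow> Q (e u) (e v)"
    using def by (rule definableE) blast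
  obtain \<psi>0 c Z where 0: "\<psi>0 \<in> L_formulas L" and c: "c \<in> assignments M" and Z: "Z \<inter> {u, v} = {}"
    and sat0: "\<And>e. (\<And>w. w \<in> Z \<Longrightarrow> e w = c w) \<Longrightarrow> sat M e \<psi>0 = sat M e \<psi>"
    by (rule parameter_elimination[OF \<psi>(1) subset_trans[OF \<psi>(3) A(1)] dom_ne, of "{u, v}"]) (simp, blast)
  define a' where "a' i = c(u := a i)" for i
  define b' where "b' I = c(v := b I)" for I
  have "has_IP M \<psi>0 {u}"
    unfolding has_IP_def
  proof (intro exI[of _ a'] exI[of _ b'] conjI allI)
    show "range a' \<subseteq> assignments M" "range b' \<subseteq> assignments M"
      using c a b(1) by (auto simp: a'_def b'_def assignments_def)
    fix i I
    let ?e = "\<lambda>w. if w \<in> {u} then a' i w else b' I w"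
    have e: "?e u = a i" "?e v = b I" using uv by (auto simp: a'_def b'_def)
    have "sat M ?e \<psi>0 = sat M ?e \<psi>" using Z by (intro sat0) (auto simp: b'_def)
    also have "\<dots> \<longleftrightarrow> Q (?e u) (?e v)" using a b(1) e by (intro \<psi>(4)) auto
    also have "\<dots> \<longleftrightarrow> i \<in> I" unfolding e by (rule b(2))
    finally show "sat M ?e \<psi>0 \<longleftrightarrow> i \<in> I" .
  qed
  then show False using nip model_M 0 unfolding NIP_def by blast
qed

text \<open>
  From finite shattered sequences of every length an infinite one is built. Types have a single
  variable, so its elements are found one at a time; the invariant is that the elements chosen so far
  extend to shattered sequences of every finite length, and saturation provides the next one.
\<close>

lemma shattering_bound:
  assumes A: "A \<subseteq> univ M" "|A| <o \<kappa>" and def: "definable L M A {u, v} (\<lambda>e. Q (e u) (e v))" and uv: "u \<noteq> v"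
  obtains m :: nat where "\<And>a. (\<And>i. i < m \<Longrightarrow> a i \<in> dom M (fst u)) \<Longrightarrow>
    \<exists>s\<subseteq>{..<m}. \<not> (\<exists>b\<in>dom M (fst v). \<forall>i<m. Q (a i) b \<longleftrightarrow> i \<in> s)"
proof -
  define Sh where "Sh m a \<longleftrightarrow> (\<forall>s\<in>Pow {..<m}. \<exists>b\<in>dom M (fst v). \<forall>i\<in>{..<m}. Q (a i) b \<longleftrightarrow> i \<in> s)" for m and a :: "nat \<Rightarrow> 'a"
  have Sh_mono: "Sh m' a" if Shm: "Sh m a" and "m' \<le> m" for m m' a
    unfolding Sh_def
  proof
    fix s assume "s \<in> Pow {..<m'}"
    then have s: "s \<subseteq> {..<m'}" "s \<in> Pow {..<m}" using \<open>m' \<le> m\<close> by auto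
    then obtain b where "b\<in>dom M (fst v)" "\<forall>i\<in>{..<m}. Q (a i) b \<longleftrightarrow> i \<in> s" using Shm unfolding Sh_def by blast
    then show "\<exists>b\<in>dom M (fst v). \<forall>i\<in>{..<m'}. Q (a i) b \<longleftrightarrow> i \<in> s" using \<open>m' \<le> m\<close> by (intro bexI[of _ b]) auto
  qed
  have Sh_cong: "Sh m a = Sh m a'" if "\<And>i. i < m \<Longrightarrow> a i = a' i" for m a a'
    using that unfolding Sh_def by (intro ball_cong bex_cong refl) auto
  have "\<exists>m. \<forall>a. (\<forall>i<m. a i \<in> dom M (fst u)) \<longrightarrow> \<not> Sh m a"
  proof (rule ccontr)
    assume "\<not> ?thesis"
    then have all: "\<exists>a. (\<forall>i<m. a i \<in> dom M (fst u)) \<and> Sh m a" for m by blast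
    obtain dflt where dflt: "dflt \<in> dom M (fst u)" using dom_ne by blast
    \<comment> \<open>The variables \<open>z i\<close> are distinct from \<open>u\<close> and \<open>v\<close>.\<close>
    define K where "K = Suc (max (snd u) (snd v))"
    define z where "z i = (fst u, K + i)" for i
    have zuv: "z i \<noteq> u" "z i \<noteq> v" for i by (auto simp: z_def K_def prod_eq_iff)
    have injz: "z i = z j \<longleftrightarrow> i = j" for i j by (auto simp: z_def)
    have fz: "fst (z i) = fst u" for i by (simp add: z_def)
    have DSh: "definable L M A (z ` {..<m}) (\<lambda>e. Sh m (\<lambda>i. e (z i)))" for m
    proof -
      have D1: "definable L M A (insert v (z ` {..<m})) (\<lambda>e. Q (e (z i)) (e v) \<longleftrightarrow> i \<in> s)" if "i < m" for i s
      proof -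
        have "definable L M A (insert (z i) ({u, v} - {u})) (\<lambda>e. Q ((e(u := e (z i))) u) ((e(u := e (z i))) v))"
          by (rule definable_rename[OF def fz zuv(1)])
        then have "definable L M A (insert (z i) ({u, v} - {u})) (\<lambda>e. Q (e (z i)) (e v))" using uv by simp
        then have "definable L M A (insert v (z ` {..<m})) (\<lambda>e. Q (e (z i)) (e v))" by (rule definable_mono) (use that in auto)
        then show ?thesis by (rule definable_iff_bool)
      qed
      have D2: "definable L M A (insert v (z ` {..<m})) (\<lambda>e. \<forall>i\<in>{..<m}. Q (e (z i)) (e v) \<longleftrightarrow> i \<in> s)" for s
        using D1 by (intro definable_ball[OF dom_ne]) auto
      have D3: "definable L M A (z ` {..<m}) (\<lambda>e. \<exists>b\<in>dom M (fst v). \<forall>i\<in>{..<m}. Q (e (z i)) b \<longleftrightarrow> i \<in> s)" for s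
      proof -
        have "insert v (z ` {..<m}) - {v} = z ` {..<m}" using zuv(2) by (metis Diff_insert_absorb imageE)
        then show ?thesis using definable_ex[OF D2, of v s] zuv(2) by simp
      qed
      show ?thesis unfolding Sh_def using D3 by (intro definable_ball[OF dom_ne]) auto
    qed
    \<comment> \<open>The first \<open>k\<close> elements extend to a shattered sequence of length \<open>m\<close>.\<close>
    define ext where "ext k a m \<longleftrightarrow> (\<exists>f. (\<forall>i. f i \<in> dom M (fst u)) \<and> Sh m (\<lambda>i. if i < k then a i else f i))" for k and a :: "nat \<Rightarrow> 'a" and m
    have ext_mono: "ext k a m'" if "ext k a m" "m' \<le> m" for k a m m' using that Sh_mono unfolding ext_def by blast
    define P where "P k a \<longleftrightarrow> (\<forall>i<k. a i \<in> dom M (fst u)) \<and> (\<forall>m. ext k a m)" for k a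
    have Dext: "definable L M (A \<union> (\<lambda>i. (fst u, a i)) ` {..<k}) {z k} (\<lambda>e. ext (Suc k) (a(k := e (z k))) m)"
      if a: "\<And>i. i < k \<Longrightarrow> a i \<in> dom M (fst u)" for k a m
    proof -
      define W where "W = z ` {k+1..<m}"
      define W' where "W' = z ` {..<k}"
      define g where "g w = a (snd w - K)" for w :: "'s var"
      have gz: "g (z i) = a i" for i by (simp add: g_def z_def)
      have zW: "z i \<in> W \<longleftrightarrow> Suc k \<le> i \<and> i < m" "z i \<in> W' \<longleftrightarrow> i < k" for i
        by (auto simp: W_def W'_def image_iff injz)
      have "definable L M A (z ` {..<m} - W) (\<lambda>e. \<exists>f. (\<forall>w\<in>W. f w \<in> dom M (fst w)) \<and>
          Sh m (\<lambda>i. if z i \<in> W then f (z i) else e (z i)))"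
        using definable_ex_set[OF _ DSh[of m], of W] by (simp add: W_def)
      then have "definable L M (A \<union> (\<lambda>w. (fst w, g w)) ` W') (z ` {..<m} - W - W') (\<lambda>e. \<exists>f. (\<forall>w\<in>W. f w \<in> dom M (fst w)) \<and>
          Sh m (\<lambda>i. if z i \<in> W then f (z i) else if z i \<in> W' then g (z i) else e (z i)))"
        by (rule definable_param_set[rotated]) (auto simp: W'_def fz gz a)
      moreover have "(\<lambda>w. (fst w, g w)) ` W' = (\<lambda>i. (fst u, a i)) ` {..<k}" by (auto simp: W'_def fz gz image_image)
      moreover have "z ` {..<m} - W - W' \<subseteq> {z k}"
      proof
        fix w assume "w \<in> z ` {..<m} - W - W'"
        then obtain i where "w = z i" "i < m" "z i \<notin> W" "z i \<notin> W'" by blast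
        then show "w \<in> {z k}" unfolding zW by (simp add: injz)
      qed
      ultimately have "definable L M (A \<union> (\<lambda>i. (fst u, a i)) ` {..<k}) {z k} (\<lambda>e. \<exists>f. (\<forall>w\<in>W. f w \<in> dom M (fst w)) \<and>
          Sh m (\<lambda>i. if z i \<in> W then f (z i) else if z i \<in> W' then g (z i) else e (z i)))"
        by (metis (no_types, lifting) definable_mono order_refl)
      then show ?thesis
      proof (rule definable_cong)
        fix e :: "'s var \<Rightarrow> 'a"
        show "(\<exists>f. (\<forall>w\<in>W. f w \<in> dom M (fst w)) \<and>
          Sh m (\<lambda>i. if z i \<in> W then f (z i) else if z i \<in> W' then g (z i) else e (z i))) \<longleftrightarrow> ext (Suc k) (a(k := e (z k))) m"
          (is "?l \<longleftrightarrow> ?r")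
        proof
          assume ?l
          then obtain f where f: "\<forall>w\<in>W. f w \<in> dom M (fst w)"
            "Sh m (\<lambda>i. if z i \<in> W then f (z i) else if z i \<in> W' then g (z i) else e (z i))" by blast
          define f' where "f' i = (if z i \<in> W then f (z i) else dflt)" for i
          have "Sh m (\<lambda>i. if i < Suc k then (a(k := e (z k))) i else f' i)"
            using f(2) by (rule Sh_cong[THEN iffD1, rotated]) (auto simp: zW injz gz f'_def less_Suc_eq not_less_eq_eq[symmetric])
          moreover have "\<forall>i. f' i \<in> dom M (fst u)" using f(1) dflt fz by (simp add: f'_def) metis
          ultimately show ?r unfolding ext_def by blast
        next
          assume ?r
          then obtain f where f: "\<forall>i. f i \<in> dom M (fst u)" "Sh m (\<lambda>i. if i < Suc k then (a(k := e (z k))) i else f i)"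
            unfolding ext_def by blast
          define f' where "f' w = f (snd w - K)" for w :: "'s var"
          have f'z: "f' (z i) = f i" for i by (simp add: f'_def z_def)
          have "Sh m (\<lambda>i. if z i \<in> W then f' (z i) else if z i \<in> W' then g (z i) else e (z i))"
            using f(2) by (rule Sh_cong[THEN iffD1, rotated]) (auto simp: zW injz gz f'z less_Suc_eq not_less_eq_eq[symmetric])
          moreover have "\<forall>w\<in>W. f' w \<in> dom M (fst w)" using f(1) by (auto simp: W_def f'z fz)
          ultimately show ?l by blast
        qed
      qed
    qed
    have step: "\<exists>d. P (Suc k) (a(k := d))" if P: "P k a" for k a
    proof -
      have a: "\<And>i. i < k \<Longrightarrow> a i \<in> dom M (fst u)" and e: "\<And>m. ext k a m" using P by (auto simp: P_def)
      define B where "B = A \<union> (\<lambda>i. (fst u, a i)) ` {..<k}"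
      have B: "B \<subseteq> univ M" "|B| <o \<kappa>"
        unfolding B_def using A(1) a by (auto simp: univ_def) (intro less_\<kappa>_Un A(2) less_\<kappa>_countable, auto)
      have fin: "\<exists>d\<in>dom M (fst (z k)). \<forall>m\<in>F. ext (Suc k) (a(k := d)) m" if "finite F" for F
      proof -
        define m where "m = Max (insert 0 F)"
        obtain f where f: "\<forall>i. f i \<in> dom M (fst u)" "Sh m (\<lambda>i. if i < k then a i else f i)" using e[of m] by (auto simp: ext_def)
        have "(\<lambda>i. if i < k then a i else f i) = (\<lambda>i. if i < Suc k then (a(k := f k)) i else f i)" by (auto simp: fun_eq_iff less_Suc_eq)
        then have "ext (Suc k) (a(k := f k)) m" using f unfolding ext_def by (intro exI[of _ f]) simp
        moreover have "m' \<le> m" if "m' \<in> F" for m' using that \<open>finite F\<close> by (simp add: m_def)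
        ultimately show ?thesis using f(1) ext_mono fz by (intro bexI[of _ "f k"]) auto
      qed
      obtain d where d: "d \<in> dom M (fst (z k))" "\<And>m. m \<in> UNIV \<Longrightarrow> ext (Suc k) (a(k := d)) m"
      proof (rule realize_definable[OF B, of UNIV "z k" "\<lambda>m d. ext (Suc k) (a(k := d)) m"])
        show "definable L M B {z k} (\<lambda>e. ext (Suc k) (a(k := e (z k))) m)" for m unfolding B_def by (rule Dext[OF a])
      qed (use fin in blast)+
      then have "P (Suc k) (a(k := d))" using a by (auto simp: P_def fz less_Suc_eq)
      then show ?thesis by blast
    qed
    have "\<exists>f. \<forall>n. P n (f n) \<and> (\<forall>i<n. f (Suc n) i = f n i)"
    proof (rule dependent_nat_choice)
      have "ext 0 a m" for a m
      proof -
        obtain f where f: "\<forall>i<m. f i \<in> dom M (fst u)" "Sh m f" using all[of m] by blast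
        have "Sh m (\<lambda>i. if i < 0 then a i else (if i < m then f i else dflt))"
          using f(2) by (rule Sh_cong[THEN iffD1, rotated]) simp
        then show ?thesis unfolding ext_def using f(1) dflt by (intro exI[of _ "\<lambda>i. if i < m then f i else dflt"]) simp
      qed
      then show "\<exists>a. P 0 a" by (auto simp: P_def)
      fix a n assume "P n a"
      then obtain d where "P (Suc n) (a(n := d))" using step by blast
      then show "\<exists>y. P (Suc n) y \<and> (\<forall>i<n. y i = a i)" by (intro exI[of _ "a(n := d)"]) auto
    qed
    then obtain f where f: "\<And>n. P n (f n)" "\<And>n i. i < n \<Longrightarrow> f (Suc n) i = f n i" by blast
    define b where "b i = f (Suc i) i" for i
    have fb: "f n i = b i" if "i < n" for n i
      using that
    proof (induction n)
      case (Suc n)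
      then show ?case using f(2)[of i n] by (cases "i = n") (auto simp: b_def)
    qed simp
    show False
    proof (rule no_infinite_shattering[OF A def uv])
      show "b i \<in> dom M (fst u)" for i using f(1)[of "Suc i"] by (auto simp: P_def b_def)
      fix m s assume s: "s \<subseteq> {..<m::nat}"
      obtain g where "Sh m (\<lambda>i. if i < m then f m i else g i)" using f(1)[of m] unfolding P_def ext_def by blast
      then have "Sh m b" by (rule Sh_cong[THEN iffD1, rotated]) (simp add: fb)
      then show "\<exists>c\<in>dom M (fst v). \<forall>i<m. Q (b i) c \<longleftrightarrow> i \<in> s" using s unfolding Sh_def by (simp add: Ball_def)
    qed
  qed
  then obtain m where m: "\<And>a. (\<forall>i<m. a i \<in> dom M (fst u)) \<Longrightarrow> \<not> Sh m a" by blast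
  show ?thesis
  proof (rule that[of m])
    fix a assume "\<And>i. i < m \<Longrightarrow> a i \<in> dom M (fst u)"
    then have "\<not> Sh m a" using m by blast
    then show "\<exists>s\<subseteq>{..<m}. \<not> (\<exists>b\<in>dom M (fst v). \<forall>i<m. Q (a i) b \<longleftrightarrow> i \<in> s)"
      unfolding Sh_def by (auto simp: Ball_def)
  qed
qed

end

section \<open>Small elementary submodels\<close>

lemma card_lists_le:
  assumes "infinite B" "|X| \<le>o |B|" shows "|lists X| \<le>o |B|"
proof -
  have n: "|{l \<in> lists X. length l = n}| \<le>o |B|" for n
  proof (induction n)
    case 0
    have "{l \<in> lists X. length l = 0} = {[]}" by auto
    then show ?case using card_of_ordLeq_infinite assms(1) by (metis finite.emptyI finite.insertI card_of_ordLeq_finite ordLeq_total card_of_Well_order finite_insert)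
  next
    case (Suc n)
    have "{l \<in> lists X. length l = Suc n} \<subseteq> (\<lambda>(a, l). a # l) ` (X \<times> {l \<in> lists X. length l = n})"
    proof
      fix l assume "l \<in> {l \<in> lists X. length l = Suc n}"
      then obtain a l' where "l = a # l'" "a \<in> X" "l' \<in> lists X" "length l' = n" by (cases l) auto
      then show "l \<in> (\<lambda>(a, l). a # l) ` (X \<times> {l \<in> lists X. length l = n})" by force
    qed
    then have "|{l \<in> lists X. length l = Suc n}| \<le>o |X \<times> {l \<in> lists X. length l = n}|"
      by (meson card_of_image card_of_mono1 ordLeq_transitive)
    also have "|X \<times> {l \<in> lists X. length l = n}| \<le>o |B|"
      using assms(1) assms(2) Suc by (intro card_of_Sigma_ordLeq_infinite) auto
    finally show ?case .
  qed
  have "lists X = (\<Union>n. {l \<in> lists X. length l = n})" by auto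
  moreover have "|\<Union>n\<in>(UNIV::nat set). {l \<in> lists X. length l = n}| \<le>o |B|"
    using n assms(1) by (intro card_of_UNION_ordLeq_infinite) (auto simp: infinite_iff_card_of_nat)
  ultimately show ?thesis by simp
qed

context nip_group
begin

text \<open>
  Finite lists stand for assignments: only finitely many values matter to a formula, and lists can be
  counted.
\<close>

definition lookup :: "('s var \<times> 'a) list \<Rightarrow> 's var \<Rightarrow> 'a" where
  "lookup l u = (case map_of l u of Some a \<Rightarrow> a | None \<Rightarrow> undefined)"

text \<open>
  The default value keeps the witnesses inside \<open>M\<close>.
\<close>

definition witness :: "('s, 'f, 'r, 'a) fm \<times> 's var \<times> ('s var \<times> 'a) list \<Rightarrow> 's \<times> 'a" where
  "witness = (\<lambda>(\<phi>, v, l). (fst v,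
     if \<exists>a\<in>dom M (fst v). sat M ((lookup l)(v := a)) \<phi>
     then SOME a. a \<in> dom M (fst v) \<and> sat M ((lookup l)(v := a)) \<phi>
     else SOME a. a \<in> dom M (fst v)))"

lemma witness_univ: "witness t \<in> univ M"
proof -
  obtain \<phi> v l where t: "t = (\<phi>, v, l)" by (cases t)
  show ?thesis
  proof (cases "\<exists>a\<in>dom M (fst v). sat M ((lookup l)(v := a)) \<phi>")
    case True
    then have "\<exists>a. a \<in> dom M (fst v) \<and> sat M ((lookup l)(v := a)) \<phi>" by blast
    from someI_ex[OF this] show ?thesis using True by (simp add: t witness_def univ_def)
  next
    case False
    then show ?thesis using some_in_eq[of "dom M (fst v)"] dom_ne by (simp add: t witness_def univ_def)
  qed
qed

lemma witness_sat:
  assumes "a \<in> dom M (fst v)" "sat M ((lookup l)(v := a)) \<phi>"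
  obtains b where "witness (\<phi>, v, l) = (fst v, b)" "b \<in> dom M (fst v)" "sat M ((lookup l)(v := b)) \<phi>"
proof -
  define b where "b = (SOME a. a \<in> dom M (fst v) \<and> sat M ((lookup l)(v := a)) \<phi>)"
  have "\<exists>a. a \<in> dom M (fst v) \<and> sat M ((lookup l)(v := a)) \<phi>" using assms by blast
  from someI_ex[OF this] have b: "b \<in> dom M (fst v)" "sat M ((lookup l)(v := b)) \<phi>" by (simp_all only: b_def)
  have "\<exists>a\<in>dom M (fst v). sat M ((lookup l)(v := a)) \<phi>" using assms by blast
  then have "witness (\<phi>, v, l) = (fst v, b)" by (simp only: witness_def prod.case if_True b_def)
  then show ?thesis using that b by blast
qed

primrec skolem :: "('s \<times> 'a) set \<Rightarrow> nat \<Rightarrow> ('s \<times> 'a) set" where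
  "skolem A 0 = A"
| "skolem A (Suc n) = skolem A n \<union> witness ` (L_formulas L \<times> UNIV \<times> lists (UNIV \<times> snd ` skolem A n))"

lemma skolem_mono: "m \<le> n \<Longrightarrow> skolem A m \<subseteq> skolem A n"
  by (rule lift_Suc_mono_le[of "skolem A"]) auto

lemma skolem_univ: "A \<subseteq> univ M \<Longrightarrow> skolem A n \<subseteq> univ M"
  by (induction n) (use witness_univ in auto)

lemma card_skolem:
  assumes A: "|A| <o \<kappa>" shows "|\<Union>n. skolem A n| <o \<kappa>"
proof -
  define LF where "LF = (L_formulas L :: ('s, 'f, 'r, 'a) fm set)"
  define B where "B = A <+> LF"
  have infB: "infinite B" using infinite_L by (simp add: B_def LF_def)
  have LB: "|LF| \<le>o |B|" unfolding B_def by (rule card_of_Plus2)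
  have vars: "|UNIV :: 's var set| \<le>o |B|"
  proof -
    have "|UNIV :: 's var set| \<le>o |LF|"
      by (rule card_of_ordLeqI[of "\<lambda>v. Eq (Var v) (Var v)"]) (auto simp: inj_on_def LF_def L_formulas_def)
    then show ?thesis using LB ordLeq_transitive by blast
  qed
  have "|skolem A n| \<le>o |B|" for n
  proof (induction n)
    case 0 show ?case by (simp add: B_def card_of_Plus1)
  next
    case (Suc n)
    have "|snd ` skolem A n| \<le>o |B|" using Suc card_of_image ordLeq_transitive by blast
    then have "|(UNIV :: 's var set) \<times> snd ` skolem A n| \<le>o |B|"
      using infB vars by (intro card_of_Sigma_ordLeq_infinite) auto
    then have "|lists ((UNIV :: 's var set) \<times> snd ` skolem A n)| \<le>o |B|" by (rule card_lists_le[OF infB])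
    then have "|(UNIV :: 's var set) \<times> lists ((UNIV :: 's var set) \<times> snd ` skolem A n)| \<le>o |B|"
      using infB vars by (intro card_of_Sigma_ordLeq_infinite) auto
    then have "|LF \<times> (UNIV :: 's var set) \<times> lists ((UNIV :: 's var set) \<times> snd ` skolem A n)| \<le>o |B|"
      using infB LB by (intro card_of_Sigma_ordLeq_infinite) auto
    then have "|witness ` (LF \<times> (UNIV :: 's var set) \<times> lists ((UNIV :: 's var set) \<times> snd ` skolem A n))| \<le>o |B|"
      using card_of_image ordLeq_transitive by blast
    then show ?case using Suc infB unfolding skolem.simps LF_def[symmetric]
      by (intro card_of_Un_ordLeq_infinite_Field) (simp_all add: Field_card_of card_of_card_order_on)
  qed
  then have "|\<Union>n. skolem A n| \<le>o |B|"
    using infB by (intro card_of_UNION_ordLeq_infinite) (auto simp: infinite_iff_card_of_nat)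
  moreover have "|B| <o \<kappa>" unfolding B_def LF_def
    by (rule card_of_Plus_ordLess_infinite_Field[OF infinite_\<kappa> card_\<kappa> A L_less])
  ultimately show ?thesis using ordLeq_ordLess_trans by blast
qed

lemma val_same_fn: "fn N = fn M' \<Longrightarrow> val N e t = val M' e t"
proof (induction t)
  case (Fn f ts)
  have "map (val N e) ts = map (val M' e) ts" using Fn by (intro map_cong) auto
  then show ?case using Fn.prems by (simp only: val.simps)
qed auto

text \<open>
  The downward theorem of Loewenheim and Skolem: closing under the witness function gives the
  Tarski-Vaught criterion, and closure under the function symbols because \<open>v = f(\<dots>)\<close> has a unique
  witness.
\<close>

lemma small_elementary_hull:
  assumes A: "A \<subseteq> univ M" "|A| <o \<kappa>"
  obtains N where "elem_sub L N M" "small \<kappa> N" "A \<subseteq> univ N"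
proof -
  define U where "U = (\<Union>n. skolem A n)"
  have UM: "U \<subseteq> univ M" using skolem_univ[OF A(1)] by (auto simp: U_def)
  define N where "N = M\<lparr>dom := \<lambda>s. {a. (s, a) \<in> U}\<rparr>"
  have N: "fn N = fn M" "rl N = rl M" "\<And>s a. a \<in> dom N s \<longleftrightarrow> (s, a) \<in> U" by (auto simp: N_def)
  have univ_N: "univ N = U" by (auto simp: univ_def N(3))
  have sub: "dom N s \<subseteq> dom M s" for s using UM by (auto simp: N(3) univ_def)
  have closed: "witness (\<phi>, v, l) \<in> U" if "\<phi> \<in> L_formulas L" "snd ` set l \<subseteq> snd ` U" for \<phi> v l
  proof -
    have "\<exists>n. snd ` set l \<subseteq> snd ` skolem A n" using that(2)
    proof (induction l)
      case (Cons p l)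
      then obtain n where n: "snd ` set l \<subseteq> snd ` skolem A n" by auto
      obtain m where m: "snd p \<in> snd ` skolem A m" using Cons.prems by (auto simp: U_def)
      have "snd ` skolem A n \<subseteq> snd ` skolem A (max m n)" "snd ` skolem A m \<subseteq> snd ` skolem A (max m n)"
        by (intro image_mono skolem_mono; simp)+
      then have "snd p \<in> snd ` skolem A (max m n)" "snd ` set l \<subseteq> snd ` skolem A (max m n)"
        using subset_trans[OF n] subsetD[OF _ m] by simp_all
      then show ?case by (intro exI[of _ "max m n"]) (simp only: list.set image_insert insert_subset)
    qed simp
    then obtain n where n: "snd ` set l \<subseteq> snd ` skolem A n" by blast
    have "l \<in> lists (UNIV \<times> snd ` skolem A n)"
      unfolding in_lists_conv_set
    proof
      fix p assume "p \<in> set l"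
      then have "snd p \<in> snd ` skolem A n" using n by blast
      then show "p \<in> UNIV \<times> snd ` skolem A n" by (cases p) auto
    qed
    then have "(\<phi>, v, l) \<in> L_formulas L \<times> UNIV \<times> lists (UNIV \<times> snd ` skolem A n)" using that(1) by simp
    then have "witness (\<phi>, v, l) \<in> skolem A (Suc n)" unfolding skolem.simps by (intro UnI2 imageI)
    then show ?thesis by (auto simp: U_def simp del: skolem.simps)
  qed
  have strN: "is_struc L N"
    unfolding is_struc_def
  proof (intro conjI allI impI)
    fix s
    define \<phi> where "\<phi> = (Eq (Var (s, 0)) (Var (s, 0)) :: ('s, 'f, 'r, 'a) fm)"
    have "witness (\<phi>, (s, 0), []) \<in> U" by (rule closed) (auto simp: \<phi>_def L_formulas_def)
    moreover have "fst (witness (\<phi>, (s, 0), [])) = s" by (simp add: witness_def)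
    ultimately show "dom N s \<noteq> {}" using N(3) by (metis empty_iff prod.collapse)
  next
    fix f ss s as assume f: "fun_sig L f = Some (ss, s)" and as: "list_all2 (\<lambda>a s'. a \<in> dom N s') as ss"
    define vs where "vs = zip ss [0..<length ss]"
    define v where "v = (s, length ss)"
    define l where "l = zip vs as"
    define \<phi> where "\<phi> = (Eq (Var v) (Fn f (map Var vs)) :: ('s, 'f, 'r, 'a) fm)"
    have len: "length as = length ss" "length vs = length ss" using as by (auto simp: list_all2_lengthD vs_def)
    have dist: "distinct vs" by (simp add: vs_def distinct_zipI2)
    have fstvs: "map fst vs = ss" by (simp add: vs_def)
    have "v \<notin> set vs" by (auto simp: v_def vs_def set_zip)
    have sorts: "map (sort_of L) (map Var vs :: ('s, 'f, 'a) trm list) = map Some ss"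
      unfolding fstvs[symmetric] by simp
    have "sort_of L (Fn f (map Var vs) :: ('s, 'f, 'a) trm) = Some s"
      unfolding sort_of.simps f option.case prod.case sorts by simp
    then have "\<phi> \<in> L_formulas L" unfolding L_formulas_def \<phi>_def v_def by simp
    have as_M: "list_all2 (\<lambda>a s'. a \<in> dom M s') as ss" using as by (rule list_all2_mono) (rule subsetD[OF sub])
    then have d: "fn M f as \<in> dom M s" using struc_M f unfolding is_struc_def by blast
    have vals: "map (val M ((lookup l)(v := b))) (map Var vs) = as" for b
    proof (rule nth_equalityI)
      fix i assume "i < length (map (val M ((lookup l)(v := b))) (map Var vs))"
      then have i: "i < length ss" using len by simp
      have "vs ! i \<noteq> v" using \<open>v \<notin> set vs\<close> i len by (metis nth_mem)
      moreover have "map_of l (vs ! i) = Some (as ! i)" using dist i len by (simp add: l_def map_of_zip_nth)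
      ultimately show "map (val M ((lookup l)(v := b))) (map Var vs) ! i = as ! i"
        using i len by (simp add: lookup_def)
    qed (use len in simp)
    have sat_iff: "sat M ((lookup l)(v := b)) \<phi> \<longleftrightarrow> b = fn M f as" for b
      unfolding \<phi>_def sat.simps val.simps vals by simp
    obtain b where b: "witness (\<phi>, v, l) = (fst v, b)" "sat M ((lookup l)(v := b)) \<phi>"
      using witness_sat[of "fn M f as" v l \<phi>] d sat_iff by (auto simp: v_def)
    have "snd ` set l \<subseteq> snd ` U"
    proof
      fix c assume "c \<in> snd ` set l"
      then obtain i where "i < length ss" "c = as ! i" using len by (auto simp: l_def set_zip)
      then have "(ss ! i, c) \<in> U" using as N(3) by (auto simp: list_all2_conv_all_nth)
      then show "c \<in> snd ` U" by force
    qed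
    then have "witness (\<phi>, v, l) \<in> U" by (intro closed \<open>\<phi> \<in> L_formulas L\<close>)
    then show "fn N f as \<in> dom N s" using b sat_iff by (simp add: N v_def)
  qed
  have tv: "sat N e \<phi> \<longleftrightarrow> sat M e \<phi>" if "\<phi> \<in> L_formulas L" "e \<in> assignments N" for \<phi> e
    using that
  proof (induction \<phi> arbitrary: e)
    case (Eq t u) then show ?case by (simp add: val_same_fn[OF N(1)])
  next
    case (Rl r ts)
    have "map (val N e) ts = map (val M e) ts" by (intro map_cong val_same_fn[OF N(1)] refl)
    then show ?case by (simp only: sat.simps N(2))
  next
    case (Neg \<phi>) then show ?case by (simp add: L_formulas_def)
  next
    case (Or \<phi> \<psi>) then show ?case by (simp add: L_formulas_def)
  next
    case (Ex v \<phi>)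
    have \<phi>: "\<phi> \<in> L_formulas L" using Ex.prems by (simp add: L_formulas_def)
    have IH: "sat N (e(v := a)) \<phi> \<longleftrightarrow> sat M (e(v := a)) \<phi>" if "a \<in> dom N (fst v)" for a
      using Ex.prems(2) that by (intro Ex.IH[OF \<phi>]) (auto simp: assignments_def)
    have "\<exists>b\<in>dom N (fst v). sat M (e(v := b)) \<phi>" if a: "a \<in> dom M (fst v)" "sat M (e(v := a)) \<phi>" for a
    proof -
      obtain us where us: "set us = fv \<phi>" using finite_list[OF finite_fv] by blast
      define l where "l = map (\<lambda>u. (u, e u)) us"
      have "map_of l u = Some (e u)" if "u \<in> fv \<phi>" for u using that us by (simp add: l_def map_of_map_restrict)
      then have lk: "sat M ((lookup l)(v := b)) \<phi> = sat M (e(v := b)) \<phi>" for b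
        by (intro sat_cong) (simp add: lookup_def)
      obtain b where b: "witness (\<phi>, v, l) = (fst v, b)" "sat M (e(v := b)) \<phi>"
        using witness_sat[of a v l \<phi>] a lk by metis
      have "snd ` set l \<subseteq> snd ` U"
      proof
        fix c assume "c \<in> snd ` set l"
        then obtain u where "c = e u" by (auto simp: l_def)
        moreover have "e u \<in> dom N (fst u)" using Ex.prems(2) unfolding assignments_def by blast
        ultimately have "(fst u, c) \<in> U" by (simp only: N(3))
        then show "c \<in> snd ` U" by force
      qed
      then have "witness (\<phi>, v, l) \<in> U" by (intro closed \<phi>)
      then show ?thesis using b N(3) by (intro bexI[of _ b]) simp_all
    qed
    then have "(\<exists>a\<in>dom M (fst v). sat M (e(v := a)) \<phi>) \<longleftrightarrow> (\<exists>a\<in>dom N (fst v). sat M (e(v := a)) \<phi>)"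
      using sub by blast
    then show ?case using IH by (simp only: sat.simps) blast
  qed
  have "elem_sub L N M" unfolding elem_sub_def using strN struc_M sub tv by blast
  moreover have "small \<kappa> N" unfolding small_def univ_N U_def by (rule card_skolem[OF A(2)])
  moreover have "A \<subseteq> univ N" unfolding univ_N U_def using skolem.simps(1)[of A] by blast
  ultimately show ?thesis by (rule that)
qed

end

section \<open>Types finitely satisfiable in the small model\<close>

definition left_translate :: "'s var \<Rightarrow> 'f \<Rightarrow> 'a \<Rightarrow> ('s, 'f, 'r, 'a) fm \<Rightarrow> ('s, 'f, 'r, 'a) fm" where
  "left_translate x mul a \<phi> = subst x (Fn mul [Par (fst x, a), Var x]) \<phi>"

context nip_group
begin

lemma mul_dom: "\<lbrakk>a \<in> dom M (fst x); d \<in> dom M (fst x)\<rbrakk> \<Longrightarrow> fn M mul [a, d] \<in> dom M (fst x)"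
  using struc_M mul_sig unfolding is_struc_def by force

lemma dom_G_M: "dom G s \<subseteq> dom M s" using G_sub by (auto simp: elem_sub_def)

text \<open>
  Elementarity for the formula \<open>v\<^sub>0 \<cdot> v\<^sub>1 = v\<^sub>2\<close> shows that the operations of \<open>G\<close> and \<open>M\<close> agree.
\<close>

lemma G_mul: assumes "a \<in> dom G (fst x)" "b \<in> dom G (fst x)" shows "fn M mul [a, b] \<in> dom G (fst x)"
proof -
  have G: "is_struc L G" using G_sub by (simp add: elem_sub_def)
  have c: "fn G mul [a, b] \<in> dom G (fst x)" using G mul_sig assms unfolding is_struc_def by force
  define e where "e v = (if v = (fst x, 0) then a else if v = (fst x, 1) then b else if v = (fst x, 2) then fn G mul [a, b]
     else (SOME c. c \<in> dom G (fst v)))" for v :: "'s var"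
  have "e \<in> assignments G"
  proof -
    have "dom G s \<noteq> {}" for s using G by (simp add: is_struc_def)
    then have "(SOME c. c \<in> dom G s) \<in> dom G s" for s by (simp add: some_in_eq)
    then show ?thesis using assms c by (simp add: assignments_def e_def)
  qed
  moreover define \<phi> where "\<phi> = (Eq (Fn mul [Var (fst x, 0), Var (fst x, 1)]) (Var (fst x, 2)) :: ('s, 'f, 'r, 'a) fm)"
  moreover have "\<phi> \<in> L_formulas L" using mul_sig by (simp add: \<phi>_def L_formulas_def)
  ultimately have "sat G e \<phi> \<longleftrightarrow> sat M e \<phi>" using G_sub unfolding elem_sub_def by blast
  then have "fn M mul [a, b] = fn G mul [a, b]" by (simp add: \<phi>_def e_def)
  then show ?thesis using c by simp
qed

lemma translate_Lx:
  assumes "\<phi> \<in> Lx L x A" shows "translate x mul d \<phi> \<in> Lx L x (insert (fst x, d) A)"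
  using assms fv_subst[of x "Fn mul [Var x, Par (fst x, d)]" \<phi>] pars_subst[of x "Fn mul [Var x, Par (fst x, d)]" \<phi>] mul_sig
  by (auto simp: Lx_def translate_def intro!: wf_subst)

lemma left_translate_Lx:
  assumes "\<phi> \<in> Lx L x A" shows "left_translate x mul d \<phi> \<in> Lx L x (insert (fst x, d) A)"
  using assms fv_subst[of x "Fn mul [Par (fst x, d), Var x]" \<phi>] pars_subst[of x "Fn mul [Par (fst x, d), Var x]" \<phi>] mul_sig
  by (auto simp: Lx_def left_translate_def intro!: wf_subst)

lemma sol_translate:
  assumes "d \<in> dom M (fst x)"
  shows "sol M x (translate x mul d \<phi>) = {a \<in> dom M (fst x). fn M mul [a, d] \<in> sol M x \<phi>}"
  using mul_dom[OF _ assms] by (auto simp: sol_def translate_def sat_subst)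

lemma sol_left_translate:
  assumes "a \<in> dom M (fst x)"
  shows "sol M x (left_translate x mul a \<phi>) = {d \<in> dom M (fst x). fn M mul [a, d] \<in> sol M x \<phi>}"
  using mul_dom[OF assms] by (auto simp: sol_def left_translate_def sat_subst)

lemma definable_mult:
  assumes \<phi>: "\<phi> \<in> Lx L x A" and u: "fst u = fst x" and v: "fst v = fst x"
  shows "definable L M A {u, v} (\<lambda>e. fn M mul [e u, e v] \<in> sol M x \<phi>)"
proof -
  define n where "n = (fst x, Suc (snd x + snd u + snd v))"
  have n: "n \<noteq> x" "n \<noteq> u" "n \<noteq> v" "fst n = fst x" by (auto simp: n_def prod_eq_iff)
  have "definable L M A (insert n ({x} - {x})) (\<lambda>e. (e(x := e n)) x \<in> sol M x \<phi>)"
    by (rule definable_rename[OF definable_sol[OF \<phi>] n(4) n(1)])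
  then have 1: "definable L M A {n, u, v} (\<lambda>e. e n \<in> sol M x \<phi>)" by (rule definable_mono[THEN definable_cong]) auto
  have 2: "definable L M A {n, u, v} (\<lambda>e. e n = fn M mul [e u, e v])"
    by (rule definableI[of L "Eq (Var n) (Fn mul [Var u, Var v])"]) (use mul_sig u v n in auto)
  have "definable L M A ({n, u, v} - {n}) (\<lambda>e. \<exists>b\<in>dom M (fst n). (e(n := b)) n = fn M mul [(e(n := b)) u, (e(n := b)) v] \<and> (e(n := b)) n \<in> sol M x \<phi>)"
    by (rule definable_ex[OF definable_and[OF 2 1]])
  moreover have "{n, u, v} - {n} = {u, v}" using n by auto
  ultimately have 3: "definable L M A {u, v} (\<lambda>e. \<exists>b\<in>dom M (fst n). (e(n := b)) n = fn M mul [(e(n := b)) u, (e(n := b)) v] \<and> (e(n := b)) n \<in> sol M x \<phi>)"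
    by (simp only:)
  show ?thesis
  proof (rule definable_cong[OF 3])
    fix e assume e: "\<And>w. w \<in> {u, v} \<Longrightarrow> e w \<in> dom M (fst w)"
    have "fn M mul [e u, e v] \<in> dom M (fst x)" using e[of u] e[of v] u v by (intro mul_dom) auto
    then show "(\<exists>b\<in>dom M (fst n). (e(n := b)) n = fn M mul [(e(n := b)) u, (e(n := b)) v] \<and> (e(n := b)) n \<in> sol M x \<phi>)
      \<longleftrightarrow> fn M mul [e u, e v] \<in> sol M x \<phi>" using n by auto
  qed
qed

definition coheirs :: "('s, 'f, 'r, 'a) fm set set" where
  "coheirs = {p \<in> types L M x (univ M). fin_sat M x (dom G (fst x)) p}"

text \<open>
  Over such parameters \<open>A\<close>, everything finitely satisfiable in \<open>G\<close> sees \<open>\<phi>(x\<cdot>d)\<close> only through the type of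
  \<open>d\<close> over \<open>A\<close>, and all types over \<open>A\<close> are realized.
\<close>

definition adequate :: "('s \<times> 'a) set \<Rightarrow> ('s, 'f, 'r, 'a) fm \<Rightarrow> bool" where
  "adequate A \<phi> \<longleftrightarrow> A \<subseteq> univ M \<and> |A| <o \<kappa> \<and> univ G \<subseteq> A \<and> \<phi> \<in> Lx L x A"

lemma univ_Lx: "adequate A \<phi> \<Longrightarrow> \<phi> \<in> Lx L x (univ M)"
  using Lx_mono unfolding adequate_def by blast

lemma translate_univ: "\<lbrakk>\<phi> \<in> Lx L x (univ M); d \<in> dom M (fst x)\<rbrakk> \<Longrightarrow> translate x mul d \<phi> \<in> Lx L x (univ M)"
  using translate_Lx[of \<phi> "univ M" d] by (simp add: insert_absorb univ_def)

lemma left_translate_adequate: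
  assumes "adequate A \<phi>" "g \<in> dom G (fst x)" shows "left_translate x mul g \<phi> \<in> Lx L x A"
proof -
  have "(fst x, g) \<in> A" using assms by (auto simp: adequate_def univ_def)
  then show ?thesis using left_translate_Lx[of \<phi> A g] assms(1) by (simp add: adequate_def insert_absorb)
qed

lemma realizes_G_invariant:
  assumes b: "adequate A \<phi>" and q: "q \<in> types L M x A" and d: "realizes M x d q" "realizes M x d' q"
    and g: "g \<in> dom G (fst x)"
  shows "fn M mul [g, d] \<in> sol M x \<phi> \<longleftrightarrow> fn M mul [g, d'] \<in> sol M x \<phi>"
proof -
  have gM: "g \<in> dom M (fst x)" using g dom_G_M by blast
  have "d \<in> dom M (fst x)" "d' \<in> dom M (fst x)" using d by (auto simp: realizes_def)
  then show ?thesis using realizes_iff[OF q d(1) left_translate_adequate[OF b g]] realizes_iff[OF q d(2) left_translate_adequate[OF b g]]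
    by (auto simp: sol_left_translate[OF gM])
qed

lemma coheirsD: "p \<in> coheirs \<Longrightarrow> p \<in> types L M x (univ M)" "p \<in> coheirs \<Longrightarrow> fin_sat M x (dom G (fst x)) p"
  by (auto simp: coheirs_def)

text \<open>
  If the two truth values differed, some \<open>g\<close> in \<open>G\<close> would satisfy exactly one of \<open>\<phi>(g\<cdot>d)\<close> and \<open>\<phi>(g\<cdot>d')\<close>,
  although \<open>d\<close> and \<open>d'\<close> realize the same formulas over \<open>A\<close>.
\<close>

lemma coheirs_invariant:
  assumes p: "p \<in> coheirs" and b: "adequate A \<phi>" and q: "q \<in> types L M x A" and d: "realizes M x d q" "realizes M x d' q"
  shows "translate x mul d \<phi> \<in> p \<longleftrightarrow> translate x mul d' \<phi> \<in> p"
proof -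
  have imp: "translate x mul d' \<phi> \<in> p" if d: "realizes M x d q" "realizes M x d' q" and tp: "translate x mul d \<phi> \<in> p" for d d'
  proof (rule ccontr)
    assume "translate x mul d' \<phi> \<notin> p"
    have dM: "d \<in> dom M (fst x)" "d' \<in> dom M (fst x)" using d by (auto simp: realizes_def)
    then have "Neg (translate x mul d' \<phi>) \<in> p"
      using types_Neg[OF coheirsD(1)[OF p] translate_univ[OF univ_Lx[OF b] dM(2)]] \<open>translate x mul d' \<phi> \<notin> p\<close> by simp
    then obtain g where g: "g \<in> dom G (fst x)" "g \<in> sol M x (translate x mul d \<phi>)" "g \<in> sol M x (Neg (translate x mul d' \<phi>))"
      using fin_satD[OF coheirsD(2)[OF p], of "{translate x mul d \<phi>, Neg (translate x mul d' \<phi>)}"] tp by auto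
    then show False using realizes_G_invariant[OF b q d g(1)] dM by (auto simp: sol_Neg sol_translate)
  qed
  then show ?thesis using d by blast
qed

text \<open>
  A pattern of finitely many translates on finitely many types in \<open>coheirs\<close> is also the pattern on
  suitable elements of \<open>G\<close>, by finite satisfiability; so shattering such types means shattering elements.
\<close>

lemma VC_translates:
  assumes \<phi>: "\<phi> \<in> Lx L x (univ M)"
  obtains m where "VC_dim_le m coheirs ((\<lambda>d. basic_clopen L M x (univ M) (translate x mul d \<phi>)) ` dom M (fst x))"
proof -
  define v where "v = (fst x, Suc (snd x))"
  have v: "v \<noteq> x" "fst v = fst x" by (auto simp: v_def prod_eq_iff)
  have pars: "pars \<phi> \<subseteq> univ M" "|pars \<phi>| <o \<kappa>" using \<phi> finite_pars by (auto simp: Lx_def intro!: less_\<kappa>_countable countable_finite)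
  have "\<phi> \<in> Lx L x (pars \<phi>)" using \<phi> by (auto simp: Lx_def)
  then have Dx: "definable L M (pars \<phi>) {x, v} (\<lambda>e. fn M mul [e x, e v] \<in> sol M x \<phi>)" using v by (intro definable_mult) auto
  obtain m :: nat where m: "\<And>a. (\<And>i. i < m \<Longrightarrow> a i \<in> dom M (fst x)) \<Longrightarrow>
    \<exists>s\<subseteq>{..<m}. \<not> (\<exists>b\<in>dom M (fst v). \<forall>i<m. fn M mul [a i, b] \<in> sol M x \<phi> \<longleftrightarrow> i \<in> s)"
    by (rule shattering_bound[of "pars \<phi>" x v "\<lambda>a b. fn M mul [a, b] \<in> sol M x \<phi>", OF pars Dx v(1)[symmetric]]) (erule that)
  have "card Y \<le> m" if Y: "Y \<subseteq> coheirs" "finite Y"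
    and sh: "shatters ((\<lambda>d. basic_clopen L M x (univ M) (translate x mul d \<phi>)) ` dom M (fst x)) Y" for Y
  proof (rule ccontr)
    assume "\<not> card Y \<le> m"
    obtain P where P: "bij_betw P {0..<card Y} Y" using ex_bij_betw_nat_finite[OF Y(2)] by blast
    have PY: "P i \<in> Y" if "i < m" for i using bij_betw_apply[OF P, of i] that \<open>\<not> card Y \<le> m\<close> by simp
    have Pinj: "P i = P j \<longleftrightarrow> i = j" if "i < m" "j < m" for i j
      using bij_betw_imp_inj_on[OF P] that \<open>\<not> card Y \<le> m\<close> by (auto simp: inj_on_def)
    have "\<exists>d\<in>dom M (fst x). basic_clopen L M x (univ M) (translate x mul d \<phi>) \<inter> Y = P ` s" if "s \<subseteq> {..<m}" for s
    proof -
      have "P ` s \<subseteq> Y" using that PY by auto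
      from shatters_imageD[OF sh this] show ?thesis .
    qed
    then obtain d where d: "\<And>s. s \<subseteq> {..<m} \<Longrightarrow> d s \<in> dom M (fst x)"
      "\<And>s. s \<subseteq> {..<m} \<Longrightarrow> basic_clopen L M x (univ M) (translate x mul (d s) \<phi>) \<inter> Y = P ` s" by metis
    have pat: "translate x mul (d s) \<phi> \<in> P i \<longleftrightarrow> i \<in> s" if "s \<subseteq> {..<m}" "i < m" for s i
    proof -
      have "P i \<in> types L M x (univ M)" using PY[OF that(2)] Y(1) by (auto simp: coheirs_def)
      then have "translate x mul (d s) \<phi> \<in> P i \<longleftrightarrow> P i \<in> P ` s"
        using d(2)[OF that(1)] PY[OF that(2)] by (auto simp: basic_clopen_def)
      also have "\<dots> \<longleftrightarrow> i \<in> s" using Pinj that by (auto simp: image_iff) 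
      finally show ?thesis .
    qed
    have "\<exists>a\<in>dom G (fst x). \<forall>s\<in>Pow {..<m}. fn M mul [a, d s] \<in> sol M x \<phi> \<longleftrightarrow> i \<in> s" if i: "i < m" for i
    proof -
      have Pi: "P i \<in> types L M x (univ M)" "fin_sat M x (dom G (fst x)) (P i)" using PY[OF i] Y(1) by (auto simp: coheirs_def)
      define th where "th s = (if i \<in> s then translate x mul (d s) \<phi> else Neg (translate x mul (d s) \<phi>))" for s
      have "th ` Pow {..<m} \<subseteq> P i"
        using pat[OF _ i] types_Neg[OF Pi(1) translate_univ[OF \<phi> d(1)]] by (auto simp: th_def)
      then obtain a where a: "a \<in> dom G (fst x)" "\<forall>\<theta>\<in>th ` Pow {..<m}. a \<in> sol M x \<theta>"
        using fin_satD[OF Pi(2), of "th ` Pow {..<m}"] by auto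
      have "fn M mul [a, d s] \<in> sol M x \<phi> \<longleftrightarrow> i \<in> s" if "s \<in> Pow {..<m}" for s
      proof -
        have dM: "d s \<in> dom M (fst x)" using d(1) that by simp
        have "a \<in> sol M x (th s)" using a(2) that by blast
        then show ?thesis using dM by (auto simp: th_def sol_Neg sol_translate split: if_splits)
      qed
      then show ?thesis using a(1) by blast
    qed
    then obtain a where a: "\<And>i. i < m \<Longrightarrow> a i \<in> dom G (fst x)"
      "\<And>i s. i < m \<Longrightarrow> s \<in> Pow {..<m} \<Longrightarrow> fn M mul [a i, d s] \<in> sol M x \<phi> \<longleftrightarrow> i \<in> s" by metis
    obtain s where s: "s \<subseteq> {..<m}" "\<not> (\<exists>b\<in>dom M (fst v). \<forall>i<m. fn M mul [a i, b] \<in> sol M x \<phi> \<longleftrightarrow> i \<in> s)"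
      using m[of a, OF subsetD[OF dom_G_M a(1)]] by metis
    then show False using a(2) d(1)[OF s(1)] v(2) by auto
  qed
  then have "VC_dim_le m coheirs ((\<lambda>d. basic_clopen L M x (univ M) (translate x mul d \<phi>)) ` dom M (fst x))"
    by (simp add: VC_dim_le_def)
  then show ?thesis by (rule that)
qed

text \<open>
  The dual family: realizing the types over \<open>A\<close>, shattering them means that elements \<open>d\<close> are shattered by
  the \<open>g\<close> in \<open>G\<close>.
\<close>

lemma VC_left_translates:
  assumes b: "adequate A \<phi>"
  obtains m where "VC_dim_le m (types L M x A) ((\<lambda>g. basic_clopen L M x A (left_translate x mul g \<phi>)) ` dom G (fst x))"
proof -
  define v where "v = (fst x, Suc (snd x))"
  have v: "v \<noteq> x" "fst v = fst x" by (auto simp: v_def prod_eq_iff)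
  have A: "A \<subseteq> univ M" "|A| <o \<kappa>" "\<phi> \<in> Lx L x A" using b by (auto simp: adequate_def)
  have "definable L M A {v, x} (\<lambda>e. fn M mul [e v, e x] \<in> sol M x \<phi>)" using v A by (intro definable_mult) auto
  then have Dx: "definable L M A {x, v} (\<lambda>e. fn M mul [e v, e x] \<in> sol M x \<phi>)" by (simp add: insert_commute)
  obtain m :: nat where m: "\<And>d. (\<And>i. i < m \<Longrightarrow> d i \<in> dom M (fst x)) \<Longrightarrow>
    \<exists>s\<subseteq>{..<m}. \<not> (\<exists>a\<in>dom M (fst v). \<forall>i<m. fn M mul [a, d i] \<in> sol M x \<phi> \<longleftrightarrow> i \<in> s)"
    by (rule shattering_bound[of A x v "\<lambda>d a. fn M mul [a, d] \<in> sol M x \<phi>", OF A(1,2) Dx v(1)[symmetric]]) (erule that)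
  have "card Y \<le> m" if Y: "Y \<subseteq> types L M x A" "finite Y"
    and sh: "shatters ((\<lambda>g. basic_clopen L M x A (left_translate x mul g \<phi>)) ` dom G (fst x)) Y" for Y
  proof (rule ccontr)
    assume "\<not> card Y \<le> m"
    obtain P where P: "bij_betw P {0..<card Y} Y" using ex_bij_betw_nat_finite[OF Y(2)] by blast
    have PY: "P i \<in> Y" if "i < m" for i using bij_betw_apply[OF P, of i] that \<open>\<not> card Y \<le> m\<close> by simp
    have Pinj: "P i = P j \<longleftrightarrow> i = j" if "i < m" "j < m" for i j
      using bij_betw_imp_inj_on[OF P] that \<open>\<not> card Y \<le> m\<close> by (auto simp: inj_on_def)
    have "\<exists>d. realizes M x d (P i)" if "i < m" for i
      using realize_type[OF A(1,2)] PY[OF that] Y(1) by blast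
    then obtain d where d: "\<And>i. i < m \<Longrightarrow> realizes M x (d i) (P i)" by metis
    have dM: "d i \<in> dom M (fst x)" if "i < m" for i using d[OF that] by (simp add: realizes_def)
    obtain s where s: "s \<subseteq> {..<m}" "\<not> (\<exists>a\<in>dom M (fst v). \<forall>i<m. fn M mul [a, d i] \<in> sol M x \<phi> \<longleftrightarrow> i \<in> s)"
      using m[of d, OF dM] by metis
    have "P ` s \<subseteq> Y" using s(1) PY by auto
    from shatters_imageD[OF sh this] obtain g where g: "g \<in> dom G (fst x)"
      "basic_clopen L M x A (left_translate x mul g \<phi>) \<inter> Y = P ` s" by (rule bexE)
    have gM: "g \<in> dom M (fst x)" using g(1) dom_G_M by blast
    have "fn M mul [g, d i] \<in> sol M x \<phi> \<longleftrightarrow> i \<in> s" if i: "i < m" for i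
    proof -
      have Pi: "P i \<in> types L M x A" using PY[OF i] Y(1) by blast
      have "fn M mul [g, d i] \<in> sol M x \<phi> \<longleftrightarrow> left_translate x mul g \<phi> \<in> P i"
        using realizes_iff[OF Pi d[OF i] left_translate_adequate[OF b g(1)]] dM[OF i] by (simp add: sol_left_translate[OF gM])
      also have "\<dots> \<longleftrightarrow> P i \<in> P ` s" using g(2) PY[OF i] Pi by (auto simp: basic_clopen_def)
      also have "\<dots> \<longleftrightarrow> i \<in> s" using Pinj i s(1) by (auto simp: image_iff)
      finally show ?thesis .
    qed
    then show False using s(2) gM v(2) by auto
  qed
  then have "VC_dim_le m (types L M x A) ((\<lambda>g. basic_clopen L M x A (left_translate x mul g \<phi>)) ` dom G (fst x))"
    by (simp add: VC_dim_le_def)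
  then show ?thesis by (rule that)
qed

end

section \<open>Borel definability of finitely satisfiable types\<close>

context nip_group
begin

text \<open>
  The set called \<open>F\<^sub>p\<close> above; by invariance of \<open>p\<close> the choice of \<open>d\<close> does not matter.
\<close>

definition true_set :: "('s \<times> 'a) set \<Rightarrow> ('s, 'f, 'r, 'a) fm \<Rightarrow> ('s, 'f, 'r, 'a) fm set \<Rightarrow> ('s, 'f, 'r, 'a) fm set set" where
  "true_set A \<phi> p = {q \<in> types L M x A. \<exists>d. realizes M x d q \<and> translate x mul d \<phi> \<in> p}"

lemma true_set_iff:
  assumes "p \<in> coheirs" "adequate A \<phi>" "q \<in> types L M x A" "realizes M x d q"
  shows "q \<in> true_set A \<phi> p \<longleftrightarrow> translate x mul d \<phi> \<in> p"
  using coheirs_invariant[OF assms(1-3)] assms(3,4) unfolding true_set_def by blast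

context
  fixes A :: "('s \<times> 'a) set" and \<phi> :: "('s, 'f, 'r, 'a) fm" and p :: "('s, 'f, 'r, 'a) fm set"
  assumes b: "adequate A \<phi>" and p: "p \<in> coheirs"
begin

lemma A_univ: "A \<subseteq> univ M" and A_small: "|A| <o \<kappa>" and A_G: "univ G \<subseteq> A" and \<phi>_A: "\<phi> \<in> Lx L x A"
  using b by (auto simp: adequate_def)

definition below :: "(nat \<Rightarrow> 'a) \<Rightarrow> nat \<Rightarrow> ('s \<times> 'a) set" where
  "below a n = A \<union> (\<lambda>i. (fst x, a i)) ` {..<n}"

definition morley :: "(nat \<Rightarrow> 'a) \<Rightarrow> bool" where
  "morley a \<longleftrightarrow> (\<forall>n. realizes M x (a n) (p \<inter> Lx L x (below a n)))"

lemma below_ok: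
  assumes "\<And>i. i < n \<Longrightarrow> a i \<in> dom M (fst x)"
  shows "below a n \<subseteq> univ M" "|below a n| <o \<kappa>"
proof -
  show "below a n \<subseteq> univ M" using A_univ assms by (auto simp: below_def univ_def)
  show "|below a n| <o \<kappa>" unfolding below_def by (intro less_\<kappa>_Un A_small less_\<kappa>_countable) auto
qed

lemma morley_exists: "\<exists>a. morley a"
  unfolding morley_def
proof (rule dependent_wf_choice[of "{(i, j). i < j}"])
  show "wf {(i, j). i < (j::nat)}" by (rule wf)
next
  fix f g :: "nat \<Rightarrow> 'a" and n r assume "\<And>z. (z, n) \<in> {(i, j). i < j} \<Longrightarrow> f z = g z"
  then have "below f n = below g n" by (auto simp: below_def)
  then show "realizes M x r (p \<inter> Lx L x (below f n)) = realizes M x r (p \<inter> Lx L x (below g n))" by simp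
next
  fix n f assume "\<And>i. (i, n) \<in> {(i, j). i < j} \<Longrightarrow> realizes M x (f i) (p \<inter> Lx L x (below f i))"
  then have f_dom: "\<And>i. i < n \<Longrightarrow> f i \<in> dom M (fst x)" by (auto simp: realizes_def)
  note B = below_ok[of n f, OF f_dom]
  have "p \<inter> Lx L x (below f n) \<in> types L M x (below f n)" by (rule types_restrict[OF coheirsD(1)[OF p] B(1)])
  from realize_type[OF B this] show "\<exists>r. realizes M x r (p \<inter> Lx L x (below f n))" by blast
qed

context
  fixes a :: "nat \<Rightarrow> 'a"
  assumes a: "morley a"
begin

lemma a_dom: "a n \<in> dom M (fst x)" using a by (auto simp: morley_def realizes_def)

lemma below_a: "below a n \<subseteq> univ M" "|below a n| <o \<kappa>" using below_ok a_dom by blast+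

lemma a_iff: assumes "\<theta> \<in> Lx L x (below a n)" shows "\<theta> \<in> p \<longleftrightarrow> a n \<in> sol M x \<theta>"
proof -
  have "p \<inter> Lx L x (below a n) \<in> types L M x (below a n)" by (rule types_restrict[OF coheirsD(1)[OF p] below_a(1)])
  then have "\<theta> \<in> p \<inter> Lx L x (below a n) \<longleftrightarrow> a n \<in> sol M x \<theta>"
    using a assms unfolding morley_def by (intro realizes_iff) auto
  then show ?thesis using assms by blast
qed

definition z :: "nat \<Rightarrow> 's var" where "z i = (fst x, Suc (snd x + i))"
definition idx :: "'s var \<Rightarrow> nat" where "idx w = snd w - Suc (snd x)"

lemma idx_z [simp]: "idx (z i) = i" by (simp add: idx_def z_def)
lemma fst_z [simp]: "fst (z i) = fst x" by (simp add: z_def)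
lemma z_eq [simp]: "z i = z j \<longleftrightarrow> i = j" by (auto simp: z_def)
lemma z_x [simp]: "z i \<noteq> x" "x \<noteq> z i" by (auto simp: z_def prod_eq_iff)

text \<open>
  Induction on the number of variables. If \<open>p\<close> separated the conditions imposed on the last variable by
  the two initial segments, then so would some \<open>g\<close> in \<open>G\<close>, by finite satisfiability; but once \<open>g\<close> is
  substituted, the two initial segments satisfy the same formulas over \<open>A\<close>.
\<close>

lemma indiscernible:
  assumes "definable L M A (z ` {..<m}) R" "strict_mono j"
  shows "R (\<lambda>w. a (j (idx w))) \<longleftrightarrow> R (\<lambda>w. a (idx w))"
  using assms(1)
proof (induction m arbitrary: R)
  case 0
  then show ?case by (intro definable_dep[OF 0]) auto
next
  case (Suc m)
  define Q where "Q k d = R ((\<lambda>w. a (k (idx w)))(z m := d))" for k and d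
  have R_Q: "R (\<lambda>w. a (k (idx w))) = Q k (a (k m))" for k
    unfolding Q_def by (rule definable_dep[OF Suc.prems]) (auto simp: a_dom)
  have formula: "\<exists>\<theta>\<in>Lx L x (below a (k m)). sol M x \<theta> = {d \<in> dom M (fst x). Q k d}"
    if k: "\<And>i. i < m \<Longrightarrow> k i < k m" for k :: "nat \<Rightarrow> nat"
  proof -
    define W where "W = z ` {..<m}"
    let ?R1 = "\<lambda>e. R (\<lambda>w. if w \<in> W then a (k (idx w)) else e w)"
    have "definable L M (A \<union> (\<lambda>w. (fst w, a (k (idx w)))) ` W) (z ` {..<Suc m} - W) ?R1"
      by (rule definable_param_set[OF _ Suc.prems]) (auto simp: W_def a_dom)
    then have D1: "definable L M (below a (k m)) {z m} ?R1"
      by (rule definable_mono) (auto simp: W_def below_def k less_Suc_eq)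
    have "definable L M (below a (k m)) (insert x ({z m} - {z m})) (\<lambda>e. ?R1 (e(z m := e x)))"
      by (rule definable_rename[OF D1]) auto
    then have D2: "definable L M (below a (k m)) {x} (\<lambda>e. ?R1 (e(z m := e x)))" by simp
    have D3: "definable L M (below a (k m)) {x} (\<lambda>e. Q k (e x))"
    proof (rule definable_cong[OF D2])
      fix e assume e: "\<And>v. v \<in> {x} \<Longrightarrow> e v \<in> dom M (fst v)"
      show "?R1 (e(z m := e x)) \<longleftrightarrow> Q k (e x)"
        unfolding Q_def
      proof (rule definable_dep[OF Suc.prems])
        fix v assume "v \<in> z ` {..<Suc m}"
        then obtain i where i: "v = z i" "i \<le> m" by auto
        show "(if v \<in> W then a (k (idx v)) else (e(z m := e x)) v) \<in> dom M (fst v)"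
          using i e[of x] a_dom by (cases "i = m") (auto simp: W_def)
        show "(if v \<in> W then a (k (idx v)) else (e(z m := e x)) v) = ((\<lambda>w. a (k (idx w)))(z m := e x)) v"
          using i by (cases "i = m") (auto simp: W_def)
      qed
    qed
    from definable_formula[OF this] show ?thesis by blast
  qed
  have jm: "\<And>i. i < m \<Longrightarrow> j i < j m" using assms(2) by (simp add: strict_mono_def)
  obtain \<theta> where \<theta>: "\<theta> \<in> Lx L x (below a (j m))" "sol M x \<theta> = {d \<in> dom M (fst x). Q j d}" using formula[of j, OF jm] by blast
  obtain \<eta> where \<eta>: "\<eta> \<in> Lx L x (below a m)" "sol M x \<eta> = {d \<in> dom M (fst x). Q (\<lambda>i. i) d}"
    using formula[of "\<lambda>i. i"] by auto
  have IH: "Q j g \<longleftrightarrow> Q (\<lambda>i. i) g" if g: "g \<in> dom G (fst x)" for g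
  proof -
    have gM: "g \<in> dom M (fst (z m))" using g dom_G_M by auto
    have "definable L M (insert (fst (z m), g) A) (z ` {..<Suc m} - {z m}) (\<lambda>e. R (e(z m := g)))"
      by (rule definable_param[OF Suc.prems gM])
    then have "definable L M A (z ` {..<m}) (\<lambda>e. R (e(z m := g)))"
      using g A_G by (elim definable_mono) (auto simp: univ_def less_Suc_eq)
    from Suc.IH[OF this] show ?thesis unfolding Q_def .
  qed
  have univ: "\<theta> \<in> Lx L x (univ M)" "\<eta> \<in> Lx L x (univ M)" using \<theta>(1) \<eta>(1) Lx_mono[OF below_a(1)] by blast+
  have pt: "p \<in> types L M x (univ M)" and pf: "fin_sat M x (dom G (fst x)) p" using coheirsD[OF p] by auto
  have "\<theta> \<in> p \<longleftrightarrow> \<eta> \<in> p"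
  proof (rule ccontr)
    assume neq: "\<not> ?thesis"
    define F where "F = (if \<theta> \<in> p then {\<theta>, Neg \<eta>} else {Neg \<theta>, \<eta>})"
    have "F \<subseteq> p" using neq types_Neg[OF pt univ(1)] types_Neg[OF pt univ(2)] by (auto simp: F_def)
    moreover have "finite F" by (simp add: F_def)
    ultimately obtain g where g: "g \<in> dom G (fst x)" "\<forall>\<psi>\<in>F. g \<in> sol M x \<psi>" using fin_satD[OF pf, of F] by blast
    have "g \<in> dom M (fst x)" using g dom_G_M by auto
    then show False using g(2) IH[OF g(1)] by (auto simp: F_def sol_Neg \<theta>(2) \<eta>(2) split: if_splits)
  qed
  then show ?case
    using a_iff[OF \<theta>(1)] a_iff[OF \<eta>(1)] a_dom R_Q[of j] R_Q[of "\<lambda>i. i"] by (simp add: \<theta>(2) \<eta>(2))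
qed

abbreviation R :: "'a \<Rightarrow> 'a \<Rightarrow> bool" where "R g d \<equiv> fn M mul [g, d] \<in> sol M x \<phi>"

definition alt :: "nat \<Rightarrow> 'a \<Rightarrow> bool" where "alt n d \<longleftrightarrow> (\<forall>i<n. R (a i) d \<longleftrightarrow> odd i)"

text \<open>
  The types consistent with the truth value of \<open>\<phi>(a\<^sub>i\<cdot>d)\<close> alternating for \<open>i < n\<close>, starting with false. Keeping
  the sequence \<open>a\<close> fixed makes this a closed set.
\<close>

definition alt_types :: "nat \<Rightarrow> ('s, 'f, 'r, 'a) fm set set" where
  "alt_types n = {q \<in> types L M x A. \<forall>\<psi>\<in>q. \<exists>d\<in>sol M x \<psi>. alt n d}"

definition alt_formula :: "nat \<Rightarrow> ('s, 'f, 'r, 'a) fm" where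
  "alt_formula i = (if odd i then left_translate x mul (a i) \<phi> else Neg (left_translate x mul (a i) \<phi>))"

lemma sol_alt_formula: "sol M x (alt_formula i) = {d \<in> dom M (fst x). R (a i) d \<longleftrightarrow> odd i}"
  by (auto simp: alt_formula_def sol_Neg sol_left_translate[OF a_dom])

lemma alt_formula_Lx: assumes "i < n" shows "alt_formula i \<in> Lx L x (below a n)"
proof -
  have "insert (fst x, a i) A \<subseteq> below a n" using assms by (auto simp: below_def)
  then have "left_translate x mul (a i) \<phi> \<in> Lx L x (below a n)"
    using left_translate_Lx[OF \<phi>_A, of "a i"] Lx_mono by blast
  then show ?thesis by (simp add: alt_formula_def)
qed

lemma closedin_alt_types: "closedin (type_space L M x A) (alt_types n)"
proof -
  have "topspace (type_space L M x A) - alt_types n = \<Union> (basic_clopen L M x A ` {\<psi> \<in> Lx L x A. \<not> (\<exists>d\<in>sol M x \<psi>. alt n d)})"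
  proof (intro equalityI subsetI)
    fix q assume "q \<in> topspace (type_space L M x A) - alt_types n"
    then obtain \<psi> where "q \<in> types L M x A" "\<psi> \<in> q" "\<not> (\<exists>d\<in>sol M x \<psi>. alt n d)" by (auto simp: alt_types_def)
    then show "q \<in> \<Union> (basic_clopen L M x A ` {\<psi> \<in> Lx L x A. \<not> (\<exists>d\<in>sol M x \<psi>. alt n d)})"
      using types_Lx[of q L M x A \<psi>] by (auto simp: basic_clopen_def)
  qed (auto simp: alt_types_def basic_clopen_def)
  moreover have "openin (type_space L M x A) (\<Union> (basic_clopen L M x A ` {\<psi> \<in> Lx L x A. \<not> (\<exists>d\<in>sol M x \<psi>. alt n d)}))"
    by (intro openin_Union) (auto intro!: openin_bc)
  ultimately show ?thesis by (simp add: closedin_def alt_types_def)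
qed

text \<open>
  By saturation, consistency with alternation is realized by a single \<open>d\<close>.
\<close>

lemma alternating_realization:
  assumes q: "q \<in> alt_types n"
  obtains d where "realizes M x d q" "alt n d"
proof -
  have qt: "q \<in> types L M x A" using q by (simp add: alt_types_def)
  have "fin_sat M x (dom M (fst x)) (q \<union> alt_formula ` {..<n})"
    unfolding fin_sat_def
  proof (intro allI impI)
    fix F assume F: "finite F \<and> F \<subseteq> q \<union> alt_formula ` {..<n}"
    then obtain \<psi> where \<psi>: "\<psi> \<in> q" "\<And>a \<phi>. a \<in> sol M x \<psi> \<Longrightarrow> \<phi> \<in> F \<inter> q \<Longrightarrow> a \<in> sol M x \<phi>"
      using types_conj[OF qt, of "F \<inter> q"] by auto
    then obtain d where d: "d \<in> sol M x \<psi>" "alt n d" using q by (auto simp: alt_types_def)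
    have dM: "d \<in> dom M (fst x)" using d(1) by (rule subsetD[OF sol_subset])
    have "d \<in> sol M x \<theta>" if \<theta>: "\<theta> \<in> F" for \<theta>
    proof (cases "\<theta> \<in> q")
      case False
      then obtain i where "i < n" "\<theta> = alt_formula i" using F \<theta> by blast
      then show ?thesis using d(2) dM by (simp add: sol_alt_formula alt_def)
    qed (use \<psi>(2)[OF d(1)] \<theta> in blast)
    then show "\<exists>a\<in>dom M (fst x). \<forall>\<phi>\<in>F. a \<in> sol M x \<phi>" using dM by blast
  qed
  moreover have "q \<union> alt_formula ` {..<n} \<subseteq> Lx L x (below a n)"
    using alt_formula_Lx types_Lx[OF qt] Lx_mono[of A "below a n" L x] by (auto simp: below_def)
  ultimately obtain d where d: "d \<in> dom M (fst x)" "\<And>\<theta>. \<theta> \<in> q \<union> alt_formula ` {..<n} \<Longrightarrow> d \<in> sol M x \<theta>"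
    using realize_partial_type[OF below_a(1,2)] by metis
  show ?thesis
  proof (rule that[of d])
    show "realizes M x d q" using d by (simp add: realizes_def)
    show "alt n d" using d(2)[of "alt_formula _"] by (auto simp: alt_def sol_alt_formula)
  qed
qed

text \<open>
  Let \<open>d\<close> realize \<open>q\<close> with alternation up to \<open>n\<close>. If \<open>p\<close> gives \<open>\<phi>(x\<cdot>d)\<close> the truth value required at \<open>n\<close>, then
  \<open>p\<close> contains the formula saying of \<open>x\<close> that some \<open>d'\<close> satisfying \<open>\<psi>\<close> alternates along \<open>a\<^sub>0, \<dots>, a\<^sub>n\<^sub>-\<^sub>1, x\<close>.
  Its parameters lie below \<open>a\<^sub>n\<close>, so \<open>a\<^sub>n\<close> satisfies it.
\<close>

lemma alt_types_step:
  assumes q: "q \<in> alt_types n" and tr: "q \<in> true_set A \<phi> p \<longleftrightarrow> odd n"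
  shows "q \<in> alt_types (Suc n)"
proof -
  have qt: "q \<in> types L M x A" using q by (simp add: alt_types_def)
  obtain d where d: "realizes M x d q" "alt n d" using alternating_realization[OF q] .
  have dM: "d \<in> dom M (fst x)" using d(1) by (simp add: realizes_def)
  have tr: "translate x mul d \<phi> \<in> p \<longleftrightarrow> odd n" using tr true_set_iff[OF p b qt d(1)] by simp
  have "\<exists>d'\<in>sol M x \<psi>. alt (Suc n) d'" if \<psi>: "\<psi> \<in> q" for \<psi>
  proof -
    let ?A = "below a n"
    have AA: "A \<subseteq> ?A" by (auto simp: below_def)
    have ren: "definable L M ?A {x, z 0} (\<lambda>e. e (z 0) \<in> sol M x \<theta>)" if "\<theta> \<in> Lx L x ?A" for \<theta>
    proof -
      have "definable L M ?A (insert (z 0) ({x} - {x})) (\<lambda>e. (e(x := e (z 0))) x \<in> sol M x \<theta>)"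
        by (rule definable_rename[OF definable_sol[OF that]]) auto
      then have "definable L M ?A (insert (z 0) ({x} - {x})) (\<lambda>e. e (z 0) \<in> sol M x \<theta>)" by simp
      then show ?thesis by (rule definable_mono) auto
    qed
    have "\<psi> \<in> Lx L x ?A" using types_Lx[OF qt \<psi>] Lx_mono[OF AA] by blast
    then have 1: "definable L M ?A {x, z 0} (\<lambda>e. e (z 0) \<in> sol M x \<psi>)" by (rule ren)
    have 2: "definable L M ?A {x, z 0} (\<lambda>e. \<forall>i\<in>{..<n}. e (z 0) \<in> sol M x (alt_formula i))"
      by (rule definable_ball[OF dom_ne]) (use ren alt_formula_Lx in auto)
    have "\<phi> \<in> Lx L x ?A" using \<phi>_A Lx_mono[OF AA] by blast
    then have 3: "definable L M ?A {x, z 0} (\<lambda>e. R (e x) (e (z 0)) \<longleftrightarrow> odd n)" by (intro definable_iff_bool definable_mult) auto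
    have "definable L M ?A ({x, z 0} - {z 0}) (\<lambda>e. \<exists>d'\<in>dom M (fst (z 0)). (e(z 0 := d')) (z 0) \<in> sol M x \<psi> \<and>
        (\<forall>i\<in>{..<n}. (e(z 0 := d')) (z 0) \<in> sol M x (alt_formula i)) \<and> (R ((e(z 0 := d')) x) ((e(z 0 := d')) (z 0)) \<longleftrightarrow> odd n))"
      by (rule definable_ex[OF definable_and[OF 1 definable_and[OF 2 3]]])
    moreover have "{x, z 0} - {z 0} = {x}" by (simp add: insert_Diff_if)
    ultimately have D: "definable L M ?A {x} (\<lambda>e. \<exists>d'\<in>dom M (fst x). d' \<in> sol M x \<psi> \<and>
        (\<forall>i\<in>{..<n}. d' \<in> sol M x (alt_formula i)) \<and> (R (e x) d' \<longleftrightarrow> odd n))" by simp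
    obtain \<xi> where \<xi>: "\<xi> \<in> Lx L x ?A" "sol M x \<xi> = {g \<in> dom M (fst x). \<exists>d'\<in>dom M (fst x). d' \<in> sol M x \<psi> \<and>
        (\<forall>i\<in>{..<n}. d' \<in> sol M x (alt_formula i)) \<and> (R g d' \<longleftrightarrow> odd n)}"
      by (rule definable_formula[of L M ?A x "\<lambda>g. \<exists>d'\<in>dom M (fst x). d' \<in> sol M x \<psi> \<and>
        (\<forall>i\<in>{..<n}. d' \<in> sol M x (alt_formula i)) \<and> (R g d' \<longleftrightarrow> odd n)", OF D], rule that)
    have \<xi>u: "\<xi> \<in> Lx L x (univ M)" using \<xi>(1) Lx_mono[OF below_a(1)] by blast
    have pt: "p \<in> types L M x (univ M)" using coheirsD[OF p] by auto
    have "\<xi> \<in> p"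
    proof (rule ccontr)
      assume "\<xi> \<notin> p"
      then have N: "Neg \<xi> \<in> p" using types_Neg[OF pt \<xi>u] by simp
      define \<omega> where "\<omega> = (if odd n then translate x mul d \<phi> else Neg (translate x mul d \<phi>))"
      have "\<omega> \<in> p" using tr types_Neg[OF pt translate_univ[OF univ_Lx[OF b] dM]] by (auto simp: \<omega>_def)
      then obtain g where g: "g \<in> dom M (fst x)" "g \<in> sol M x (Neg \<xi>)" "g \<in> sol M x \<omega>"
        using fin_satD[OF types_fin_sat[OF pt], of "{Neg \<xi>, \<omega>}"] N by auto
      have "R g d \<longleftrightarrow> odd n" using g(1,3) dM by (auto simp: \<omega>_def sol_Neg sol_translate split: if_splits)
      moreover have "d \<in> sol M x \<psi>" using d(1) \<psi> by (simp add: realizes_def)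
      moreover have "\<forall>i\<in>{..<n}. d \<in> sol M x (alt_formula i)" using d(2) dM by (simp add: sol_alt_formula alt_def)
      ultimately have "g \<in> sol M x \<xi>" using g(1) dM unfolding \<xi>(2) by blast
      then show False using g(2) by (simp add: sol_Neg)
    qed
    then have "a n \<in> sol M x \<xi>" using a_iff[OF \<xi>(1)] by simp
    then obtain d' where "d' \<in> sol M x \<psi>" "\<forall>i\<in>{..<n}. d' \<in> sol M x (alt_formula i)" "R (a n) d' \<longleftrightarrow> odd n"
      unfolding \<xi>(2) by blast
    then show ?thesis by (intro bexI[of _ d']) (auto simp: alt_def sol_alt_formula less_Suc_eq)
  qed
  then show ?thesis using qt by (simp add: alt_types_def)
qed

text \<open>
  Otherwise one element alternates along the whole sequence. Every finite pattern is then realized on a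
  subsequence, hence by indiscernibility on an initial segment, against NIP.
\<close>

lemma bounded_alternation: "\<exists>n. q \<notin> alt_types n"
proof (rule ccontr)
  assume "\<not> ?thesis"
  then have qalt: "\<And>n. q \<in> alt_types n" by blast
  define B where "B = A \<union> (\<lambda>i. (fst x, a i)) ` UNIV"
  have "A \<subseteq> B" by (auto simp: B_def)
  have B: "B \<subseteq> univ M" "|B| <o \<kappa>"
    unfolding B_def using A_univ a_dom by (auto simp: univ_def) (intro less_\<kappa>_Un A_small less_\<kappa>_countable, auto)
  have "alt_formula i \<in> Lx L x B" for i
    using alt_formula_Lx[of i "Suc i"] Lx_mono[of "below a (Suc i)" B L x] by (auto simp: B_def below_def)
  moreover have "fin_sat M x (dom M (fst x)) (range alt_formula)"
    unfolding fin_sat_def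
  proof (intro allI impI)
    fix F assume "finite F \<and> F \<subseteq> range alt_formula"
    then obtain I where I: "finite I" "F = alt_formula ` I" by (meson finite_subset_image)
    obtain n where n: "\<And>i. i \<in> I \<Longrightarrow> i < n" using I(1) finite_nat_iff_bounded[of I] by auto
    obtain d where d: "realizes M x d q" "alt n d" using alternating_realization[OF qalt] .
    then show "\<exists>a\<in>dom M (fst x). \<forall>\<phi>\<in>F. a \<in> sol M x \<phi>" using n I(2)
      by (intro bexI[of _ d]) (auto simp: sol_alt_formula alt_def realizes_def)
  qed
  ultimately obtain d where dM: "d \<in> dom M (fst x)" and d: "\<And>\<theta>. \<theta> \<in> range alt_formula \<Longrightarrow> d \<in> sol M x \<theta>"
    using realize_partial_type[OF B, of "range alt_formula" x] by blast
  have alt: "R (a i) d \<longleftrightarrow> odd i" for i using d[of "alt_formula i"] by (simp add: sol_alt_formula)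
  have D: "definable L M A {z 0, x} (\<lambda>e. R (e (z 0)) (e x))" by (rule definable_mult[OF \<phi>_A]) auto
  show False
  proof (rule no_infinite_shattering[OF A_univ A_small D])
    show "z 0 \<noteq> x" by simp
    show "a i \<in> dom M (fst (z 0))" for i using a_dom by simp
    fix m :: nat and s assume s: "s \<subseteq> {..<m}"
    have "definable L M A (insert x (z ` {..<m})) (\<lambda>e. R (e (z i)) (e x) \<longleftrightarrow> i \<in> s)" if "i < m" for i
    proof -
      have "definable L M A {z i, x} (\<lambda>e. R (e (z i)) (e x))" by (rule definable_mult[OF \<phi>_A]) auto
      then have "definable L M A (insert x (z ` {..<m})) (\<lambda>e. R (e (z i)) (e x))" by (rule definable_mono) (use that in auto)
      then show ?thesis by (rule definable_iff_bool)
    qed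
    then have "definable L M A (insert x (z ` {..<m})) (\<lambda>e. \<forall>i\<in>{..<m}. R (e (z i)) (e x) \<longleftrightarrow> i \<in> s)"
      by (intro definable_ball[OF dom_ne]) auto
    then have "definable L M A (insert x (z ` {..<m}) - {x}) (\<lambda>e. \<exists>d\<in>dom M (fst x). \<forall>i\<in>{..<m}. R ((e(x := d)) (z i)) ((e(x := d)) x) \<longleftrightarrow> i \<in> s)"
      by (rule definable_ex)
    moreover have "insert x (z ` {..<m}) - {x} = z ` {..<m}" using z_x(1) by (metis Diff_insert_absorb imageE)
    ultimately have D: "definable L M A (z ` {..<m}) (\<lambda>e. \<exists>d\<in>dom M (fst x). \<forall>i\<in>{..<m}. R (e (z i)) d \<longleftrightarrow> i \<in> s)"
      by simp
    \<comment> \<open>Index \<open>i\<close> goes to an odd position if \<open>i \<in> s\<close> and to an even one otherwise.\<close>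
    define j where "j i = 2 * i + (if i \<in> s then 1 else 0)" for i
    have "strict_mono j" by (rule strict_monoI) (auto simp: j_def)
    have "\<exists>d\<in>dom M (fst x). \<forall>i\<in>{..<m}. R (a (j (idx (z i)))) d \<longleftrightarrow> i \<in> s"
      using dM alt by (intro bexI[of _ d]) (auto simp: j_def)
    then have "\<exists>d\<in>dom M (fst x). \<forall>i\<in>{..<m}. R (a (idx (z i))) d \<longleftrightarrow> i \<in> s"
      using indiscernible[OF D \<open>strict_mono j\<close>] by (simp only:)
    then show "\<exists>d\<in>dom M (fst x). \<forall>i<m. R (a i) d \<longleftrightarrow> i \<in> s" by (simp add: Ball_def)
  qed
qed

text \<open>
  At the longest alternation \<open>n\<close> consistent with \<open>q\<close> the step above is impossible, so the truth value
  given by \<open>p\<close> is the one opposite to \<open>odd n\<close>.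
\<close>

lemma true_set_eq: "true_set A \<phi> p = (\<Union>n\<in>{n. even n}. alt_types n - alt_types (Suc n))"
proof (intro equalityI subsetI)
  fix q assume q: "q \<in> true_set A \<phi> p"
  then have qt: "q \<in> types L M x A" by (simp add: true_set_def)
  have "\<exists>d. d \<in> sol M x \<psi>" if "\<psi> \<in> q" for \<psi> using fin_satD[OF types_fin_sat[OF qt], of "{\<psi>}"] that by auto
  then have "q \<in> alt_types 0" using qt by (auto simp: alt_types_def alt_def)
  define k where "k = (LEAST n. q \<notin> alt_types n)"
  have k: "q \<notin> alt_types k" "\<And>n. n < k \<Longrightarrow> q \<in> alt_types n"
    unfolding k_def using LeastI_ex[OF bounded_alternation] not_less_Least by blast+
  then obtain n where n: "k = Suc n" using \<open>q \<in> alt_types 0\<close> by (cases k) auto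
  have "even n"
  proof (rule ccontr)
    assume "odd n"
    then show False using alt_types_step[of q n] k n q by simp
  qed
  then show "q \<in> (\<Union>n\<in>{n. even n}. alt_types n - alt_types (Suc n))" using k n by auto
next
  fix q assume "q \<in> (\<Union>n\<in>{n. even n}. alt_types n - alt_types (Suc n))"
  then obtain n where "even n" "q \<in> alt_types n" "q \<notin> alt_types (Suc n)" by auto
  then show "q \<in> true_set A \<phi> p" using alt_types_step[of q n] by auto
qed

end

lemma true_set_borel: "true_set A \<phi> p \<in> sets (borel_of (type_space L M x A))"
proof -
  obtain a where a: "morley a" using morley_exists by blast
  have "alt_types a n \<in> sets (borel_of (type_space L M x A))" for n
    by (rule borel_of_closedin[OF closedin_alt_types[OF a]])
  then show ?thesis unfolding true_set_eq[OF a] by (intro sets.countable_UN') auto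
qed

end

end

section \<open>Borel definability of finitely satisfiable measures\<close>

context nip_group
begin

abbreviation "FS \<equiv> fin_sat_measures L M x G"

lemma FS_keisler: "\<mu> \<in> FS \<Longrightarrow> \<mu> \<in> keisler L M x (univ M)" by (simp add: fin_sat_measures_def)

lemma FS_sat: "\<lbrakk>\<mu> \<in> FS; \<phi> \<in> Lx L x (univ M); \<mu> \<phi> > 0\<rbrakk> \<Longrightarrow> \<exists>a\<in>dom G (fst x). a \<in> sol M x \<phi>"
  by (simp add: fin_sat_measures_def)

lemma supp_coheirs: assumes \<mu>: "\<mu> \<in> FS" shows "supp L M x (univ M) \<mu> \<subseteq> coheirs"
proof
  fix p assume p: "p \<in> supp L M x (univ M) \<mu>"
  then have pt: "p \<in> types L M x (univ M)" by (simp add: supp_def)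
  have "fin_sat M x (dom G (fst x)) p"
    unfolding fin_sat_def
  proof (intro allI impI)
    fix F assume F: "finite F \<and> F \<subseteq> p"
    then obtain \<psi> where \<psi>: "\<psi> \<in> p" "\<And>a \<phi>. a \<in> sol M x \<psi> \<Longrightarrow> \<phi> \<in> F \<Longrightarrow> a \<in> sol M x \<phi>"
      using types_conj[OF pt] by metis
    have "\<mu> \<psi> > 0" using p \<psi>(1) by (simp add: supp_def)
    then obtain a where "a \<in> dom G (fst x)" "a \<in> sol M x \<psi>" using FS_sat[OF \<mu> types_Lx[OF pt \<psi>(1)]] by blast
    then show "\<exists>a\<in>dom G (fst x). \<forall>\<phi>\<in>F. a \<in> sol M x \<phi>" using \<psi>(2) by blast
  qed
  then show "p \<in> coheirs" using pt by (simp add: coheirs_def)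
qed

text \<open>
  The difference of the two formulas has no solution in \<open>G\<close>, so it is null.
\<close>

lemma FS_invariant:
  assumes \<mu>: "\<mu> \<in> FS" and b: "adequate A \<phi>" and q: "q \<in> types L M x A" and d: "realizes M x d q" "realizes M x d' q"
  shows "\<mu> (translate x mul d \<phi>) = \<mu> (translate x mul d' \<phi>)"
proof -
  have dM: "d \<in> dom M (fst x)" "d' \<in> dom M (fst x)" using d by (auto simp: realizes_def)
  have tL: "translate x mul d \<phi> \<in> Lx L x (univ M)" "translate x mul d' \<phi> \<in> Lx L x (univ M)"
    using translate_univ[OF univ_Lx[OF b]] dM by auto
  have "\<not> \<mu> (And (translate x mul d \<phi>) (Neg (translate x mul d' \<phi>))) > 0"
    if d: "realizes M x d q" "realizes M x d' q" and dM: "d \<in> dom M (fst x)" "d' \<in> dom M (fst x)" for d d'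
  proof
    assume pos: "\<mu> (And (translate x mul d \<phi>) (Neg (translate x mul d' \<phi>))) > 0"
    have "And (translate x mul d \<phi>) (Neg (translate x mul d' \<phi>)) \<in> Lx L x (univ M)"
      using translate_univ[OF univ_Lx[OF b]] dM by simp
    from FS_sat[OF \<mu> this pos] obtain g where g: "g \<in> dom G (fst x)"
      "g \<in> sol M x (And (translate x mul d \<phi>) (Neg (translate x mul d' \<phi>)))" by blast
    then show False using realizes_G_invariant[OF b q d g(1)] dM unfolding sol_And sol_Neg[of M x "translate x mul d' \<phi>"] sol_translate[OF dM(1)] sol_translate[OF dM(2)]
      by blast
  qed
  then show ?thesis using d dM tL by (intro keisler_eqI[OF FS_keisler[OF \<mu>]]) blast+
qed

lemma fibre_eq:
  assumes \<mu>: "\<mu> \<in> FS" and b: "adequate A \<phi>" and q: "q \<in> types L M x A" and d: "realizes M x d q"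
  shows "fibre M x mul \<mu> \<phi> q = \<mu> (translate x mul d \<phi>)"
  unfolding fibre_def by (rule FS_invariant[OF \<mu> b q someI[of "\<lambda>d. realizes M x d q", OF d] d])

lemma adequate_realize:
  assumes "adequate A \<phi>" "q \<in> types L M x A" obtains d where "realizes M x d q" "d \<in> dom M (fst x)"
proof -
  obtain d where "realizes M x d q" using realize_type[of A q x] assms by (auto simp: adequate_def)
  then show ?thesis using that by (auto simp: realizes_def)
qed

text \<open>
  Uniform approximation on the support of \<open>\<mu>\<close>, whose members are finitely satisfiable in \<open>G\<close>.
\<close>

lemma measure_by_types:
  assumes \<mu>: "\<mu> \<in> FS" and \<phi>: "\<phi> \<in> Lx L x (univ M)" and "\<epsilon> > 0"
  obtains n :: nat and P where "n > 0" "\<And>j. j < n \<Longrightarrow> P j \<in> coheirs"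
    "\<And>d. d \<in> dom M (fst x) \<Longrightarrow> \<bar>\<mu> (translate x mul d \<phi>) - (\<Sum>j<n. of_bool (translate x mul d \<phi> \<in> P j)) / n\<bar> \<le> \<epsilon>"
proof -
  let ?X = "type_space L M x (univ M)" and ?K = "supp L M x (univ M) \<mu>" and ?P = "keisler_borel L M x (univ M) \<mu>"
  let ?H = "\<lambda>d. basic_clopen L M x (univ M) (translate x mul d \<phi>)"
  have k: "\<mu> \<in> keisler L M x (univ M)" by (rule FS_keisler[OF \<mu>])
  have reg: "regular_borel_prob ?X ?P" by (rule keisler_borel_regular[OF k])
  then have sP: "sets ?P = sets (borel_of ?X)" and pP: "prob_space ?P" by (auto simp: regular_borel_prob_def)
  interpret P: prob_space ?P by (rule pP)
  have Kc: "closedin ?X ?K" by (rule closedin_supp[OF k])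
  have KP: "?K \<in> sets ?P" unfolding sP by (rule borel_of_closedin[OF Kc])
  have K1: "measure ?P ?K = 1" by (rule measure_supp[OF k])
  obtain m where m: "VC_dim_le m coheirs (?H ` dom M (fst x))" using VC_translates[OF \<phi>] .
  have VC: "VC_dim_le m ?K (?H ` dom M (fst x))" using m supp_coheirs[OF \<mu>] unfolding VC_dim_le_def by (meson subset_trans)
  have tL: "translate x mul d \<phi> \<in> Lx L x (univ M)" if "d \<in> dom M (fst x)" for d by (rule translate_univ[OF \<phi> that])
  obtain n :: nat and P where nP: "n > 0" "P ` {..<n} \<subseteq> ?K"
    "\<And>d. d \<in> dom M (fst x) \<Longrightarrow> \<bar>measure ?P (?K \<inter> ?H d) / measure ?P ?K - frequency (?H d) n P\<bar> \<le> \<epsilon>"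
  proof (rule VC_approx_compact[OF closedin_compact_space[OF compact_TS Kc] pP KP _ _ _ _ VC \<open>\<epsilon> > 0\<close>])
    show "0 < measure ?P ?K" by (simp add: K1)
    fix d assume d: "d \<in> dom M (fst x)"
    show "?H d \<in> sets ?P" unfolding sP by (rule borel_of_openin[OF openin_bc[OF tL[OF d]]])
    show "openin (subtopology ?X ?K) (?K \<inter> ?H d)"
      using openin_bc[OF tL[OF d]] by (rule openin_subtopology_Int2)
    show "closedin (subtopology ?X ?K) (?K \<inter> ?H d)"
      using closedin_bc[OF tL[OF d]] by (rule closedin_subtopology_Int_closed)
  qed blast
  show ?thesis
  proof (rule that[OF nP(1)])
    show PG: "P j \<in> coheirs" if "j < n" for j using nP(2) supp_coheirs[OF \<mu>] that by auto
    fix d assume d: "d \<in> dom M (fst x)"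
    have "measure ?P (?K \<inter> ?H d) = measure ?P (?H d)"
      by (rule P.prob_Int_full[OF KP K1]) (unfold sP, rule borel_of_openin[OF openin_bc[OF tL[OF d]]])
    also have "\<dots> = \<mu> (translate x mul d \<phi>)" by (rule keisler_borel_bc[OF k tL[OF d]])
    finally have "\<bar>\<mu> (translate x mul d \<phi>) - frequency (?H d) n P\<bar> \<le> \<epsilon>" using nP(3)[OF d] K1 by simp
    moreover have "frequency (?H d) n P = (\<Sum>j<n. of_bool (translate x mul d \<phi> \<in> P j)) / n"
    proof -
      have "indicator (?H d) (P j) = (of_bool (translate x mul d \<phi> \<in> P j) :: real)" if "j < n" for j
        using coheirsD(1)[OF PG[OF that]] by (simp add: indicator_def basic_clopen_def)
      then show ?thesis by (simp add: frequency_def)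
    qed
    ultimately show "\<bar>\<mu> (translate x mul d \<phi>) - (\<Sum>j<n. of_bool (translate x mul d \<phi> \<in> P j)) / n\<bar> \<le> \<epsilon>" by simp
  qed
qed

lemma fibre_by_types:
  assumes \<mu>: "\<mu> \<in> FS" and b: "adequate A \<phi>" and "\<epsilon> > 0"
  obtains n :: nat and P where "n > 0" "\<And>j. j < n \<Longrightarrow> P j \<in> coheirs"
    "\<And>q. q \<in> types L M x A \<Longrightarrow> \<bar>fibre M x mul \<mu> \<phi> q - (\<Sum>j<n. indicator (true_set A \<phi> (P j)) q) / n\<bar> \<le> \<epsilon>"
proof -
  obtain n :: nat and P where nP: "n > 0" "\<And>j. j < n \<Longrightarrow> P j \<in> coheirs"
    "\<And>d. d \<in> dom M (fst x) \<Longrightarrow> \<bar>\<mu> (translate x mul d \<phi>) - (\<Sum>j<n. of_bool (translate x mul d \<phi> \<in> P j)) / n\<bar> \<le> \<epsilon>"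
    by (rule measure_by_types[OF \<mu> univ_Lx[OF b] \<open>\<epsilon> > 0\<close>]) blast
  show ?thesis
  proof (rule that[OF nP(1,2)])
    fix q assume q: "q \<in> types L M x A"
    obtain d where d: "realizes M x d q" "d \<in> dom M (fst x)" using adequate_realize[OF b q] .
    have "indicator (true_set A \<phi> (P j)) q = (of_bool (translate x mul d \<phi> \<in> P j) :: real)" if "j < n" for j
      using true_set_iff[OF nP(2)[OF that] b q d(1)] by (simp add: indicator_def)
    then show "\<bar>fibre M x mul \<mu> \<phi> q - (\<Sum>j<n. indicator (true_set A \<phi> (P j)) q) / n\<bar> \<le> \<epsilon>"
      using nP(3)[OF d(2)] by (simp add: fibre_eq[OF \<mu> b q d(1)])
  qed
qed

text \<open>
  A uniform limit of averages of indicators of Borel sets.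
\<close>

lemma fibre_borel:
  assumes \<mu>: "\<mu> \<in> FS" and b: "adequate A \<phi>"
  shows "fibre M x mul \<mu> \<phi> \<in> borel_measurable (borel_of (type_space L M x A))"
proof -
  have "\<exists>g. g \<in> borel_measurable (borel_of (type_space L M x A)) \<and> (\<forall>q\<in>types L M x A. \<bar>fibre M x mul \<mu> \<phi> q - g q\<bar> \<le> 1 / real (Suc k))" for k
  proof -
    have "1 / real (Suc k) > 0" by simp
    then obtain n :: nat and P where nP: "n > 0" "\<And>j. j < n \<Longrightarrow> P j \<in> coheirs"
      "\<And>q. q \<in> types L M x A \<Longrightarrow> \<bar>fibre M x mul \<mu> \<phi> q - (\<Sum>j<n. indicator (true_set A \<phi> (P j)) q) / n\<bar> \<le> 1 / real (Suc k)"
      by (rule fibre_by_types[OF \<mu> b]) blast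
    have "(\<lambda>q. (\<Sum>j<n. indicator (true_set A \<phi> (P j)) q) / real n) \<in> borel_measurable (borel_of (type_space L M x A))"
      using true_set_borel[OF b nP(2)] by (intro borel_measurable_divide borel_measurable_sum borel_measurable_indicator) auto
    then show ?thesis using nP(3) by blast
  qed
  then obtain g where g: "\<And>k. g k \<in> borel_measurable (borel_of (type_space L M x A))"
    "\<And>k q. q \<in> types L M x A \<Longrightarrow> \<bar>fibre M x mul \<mu> \<phi> q - g k q\<bar> \<le> 1 / real (Suc k)" by metis
  show ?thesis
  proof (rule borel_measurable_LIMSEQ_real[OF _ g(1)])
    fix q assume "q \<in> space (borel_of (type_space L M x A))"
    then have q: "q \<in> types L M x A" by simp
    have "(\<lambda>k. 1 / real (Suc k)) \<longlonglongrightarrow> 0" by (rule LIMSEQ_Suc[OF lim_1_over_n])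
    then have "(\<lambda>k. g k q - fibre M x mul \<mu> \<phi> q) \<longlonglongrightarrow> 0"
      by (rule Lim_null_comparison[rotated]) (use g(2)[OF q] in \<open>auto simp: abs_minus_commute\<close>)
    then show "(\<lambda>k. g k q) \<longlonglongrightarrow> fibre M x mul \<mu> \<phi> q" by (simp add: LIM_zero_iff)
  qed
qed

end

section \<open>Convolution and its continuity\<close>

lemma continuous_map_uniform_approx:
  fixes h :: "'b \<Rightarrow> real"
  assumes "\<And>\<epsilon>. \<epsilon> > 0 \<Longrightarrow> \<exists>g. continuous_map X euclideanreal g \<and> (\<forall>x\<in>topspace X. \<bar>h x - g x\<bar> \<le> \<epsilon>)"
  shows "continuous_map X euclideanreal h"
  unfolding continuous_map_def
proof (intro conjI allI impI)
  fix U :: "real set" assume "openin euclideanreal U"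
  then have U: "open U" by simp
  show "openin X {x \<in> topspace X. h x \<in> U}"
  proof (subst openin_subopen, intro ballI)
    fix x assume x: "x \<in> {x \<in> topspace X. h x \<in> U}"
    then obtain e where e: "e > 0" "\<And>y. \<bar>y - h x\<bar> < e \<Longrightarrow> y \<in> U"
      using U unfolding open_dist dist_real_def by blast
    have "e / 4 > 0" using e by simp
    then obtain g where g: "continuous_map X euclideanreal g" "\<forall>x\<in>topspace X. \<bar>h x - g x\<bar> \<le> e / 4"
      using assms by blast
    define V where "V = {y \<in> topspace X. g y \<in> {g x - e / 4 <..< g x + e / 4}}"
    have "openin X V" unfolding V_def by (rule openin_continuous_map_preimage[OF g(1)]) auto
    moreover have "x \<in> V" using x e by (simp add: V_def)
    moreover have "V \<subseteq> {x \<in> topspace X. h x \<in> U}"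
    proof
      fix y assume y: "y \<in> V"
      then have "g x - e / 4 < g y" "g y < g x + e / 4" "y \<in> topspace X" by (auto simp: V_def)
      moreover have "\<bar>h x - g x\<bar> \<le> e / 4" "\<bar>h y - g y\<bar> \<le> e / 4"
        using g(2) x \<open>y \<in> topspace X\<close> by blast+
      ultimately have "\<bar>h y - h x\<bar> < e" by linarith
      then show "y \<in> {x \<in> topspace X. h x \<in> U}" using e(2) y by (auto simp: V_def)
    qed
    ultimately show "\<exists>T. openin X T \<and> x \<in> T \<and> T \<subseteq> {x \<in> topspace X. h x \<in> U}" by blast
  qed
qed auto

context nip_group
begin

definition borel_over :: "(('s, 'f, 'r, 'a) fm \<Rightarrow> real) \<Rightarrow> ('s \<times> 'a) set \<Rightarrow> ('s, 'f, 'r, 'a) fm set measure" where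
  "borel_over \<nu> A = keisler_borel L M x A (restrict \<nu> (Lx L x A))"

definition supp_over :: "(('s, 'f, 'r, 'a) fm \<Rightarrow> real) \<Rightarrow> ('s \<times> 'a) set \<Rightarrow> ('s, 'f, 'r, 'a) fm set set" where
  "supp_over \<nu> A = supp L M x A (restrict \<nu> (Lx L x A))"

lemma supp_over_iff: "q \<in> supp_over \<nu> A \<longleftrightarrow> q \<in> types L M x A \<and> (\<forall>\<phi>\<in>q. \<nu> \<phi> > 0)"
  unfolding supp_over_def supp_def using types_Lx[of q L M x A] by auto

lemma elem_sub_univ: "elem_sub L N M \<Longrightarrow> univ N \<subseteq> univ M"
  by (auto simp: elem_sub_def univ_def)

lemma adequate_univ:
  assumes "elem_sub L N M" "small \<kappa> N" "univ G \<subseteq> univ N" "\<phi> \<in> Lx L x (univ N)" shows "adequate (univ N) \<phi>"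
  using assms elem_sub_univ[OF assms(1)] by (simp add: adequate_def small_def)

lemma restrict_keisler:
  assumes "\<nu> \<in> FS" "A \<subseteq> univ M" shows "restrict \<nu> (Lx L x A) \<in> keisler L M x A"
  by (rule keisler_restrict[OF FS_keisler[OF assms(1)] assms(2)])

text \<open>
  The integrand is Borel on the whole type space, not only on the support of \<open>\<nu>\<close>.
\<close>

lemma star_Borel_over_adequate:
  assumes \<mu>: "\<mu> \<in> FS" and N: "elem_sub L N M" "small \<kappa> N" and b: "adequate (univ N) \<phi>"
  shows "star_Borel_over L \<kappa> M x mul \<mu> \<nu> \<phi> N"
proof -
  let ?S = "supp L M x (univ N) (restrict \<nu> (Lx L x (univ N)))" and ?X = "type_space L M x (univ N)"
  have "id \<in> borel_of (subtopology ?X ?S) \<rightarrow>\<^sub>M borel_of ?X"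
    by (rule continuous_map_borel_measurable) simp
  from measurable_comp[OF this fibre_borel[OF \<mu> b]]
  have "fibre M x mul \<mu> \<phi> \<in> borel_measurable (borel_of (subtopology ?X ?S))" by simp
  moreover have "\<mu> (translate x mul d \<phi>) = \<mu> (translate x mul d' \<phi>)"
    if "q \<in> ?S" "realizes M x d q" "realizes M x d' q" for q d d'
    using that by (intro FS_invariant[OF \<mu> b, of q]) (auto simp: supp_def)
  moreover have "pars \<phi> \<subseteq> univ N" using b by (auto simp: adequate_def Lx_def)
  ultimately show ?thesis using N unfolding star_Borel_over_def Let_def by blast
qed

lemma small_submodel:
  assumes "B \<subseteq> univ M" "|B| <o \<kappa>"
  obtains N where "elem_sub L N M" "small \<kappa> N" "univ G \<subseteq> univ N" "B \<subseteq> univ N"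
proof -
  have "univ G \<subseteq> univ M" using elem_sub_univ[OF G_sub] .
  then obtain N where "elem_sub L N M" "small \<kappa> N" "univ G \<union> B \<subseteq> univ N"
    using small_elementary_hull[of "univ G \<union> B"] assms G_small less_\<kappa>_Un unfolding small_def by (metis Un_least)
  then show ?thesis using that by blast
qed

lemma pars_small: assumes "\<phi> \<in> Lx L x (univ M)" shows "pars \<phi> \<subseteq> univ M" "|pars \<phi>| <o \<kappa>"
  using assms by (auto simp: Lx_def intro!: less_\<kappa>_countable countable_finite finite_pars)

lemma small_submodel2:
  assumes "\<phi> \<in> Lx L x (univ M)" "\<psi> \<in> Lx L x (univ M)"
  obtains N where "elem_sub L N M" "small \<kappa> N" "adequate (univ N) \<phi>" "adequate (univ N) \<psi>"
proof -
  have "pars \<phi> \<union> pars \<psi> \<subseteq> univ M" "|pars \<phi> \<union> pars \<psi>| <o \<kappa>"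
    using pars_small[OF assms(1)] pars_small[OF assms(2)] less_\<kappa>_Un by auto
  then obtain N where N: "elem_sub L N M" "small \<kappa> N" "univ G \<subseteq> univ N" "pars \<phi> \<union> pars \<psi> \<subseteq> univ N"
    by (rule small_submodel)
  have "\<phi> \<in> Lx L x (univ N)" "\<psi> \<in> Lx L x (univ N)" using assms N(4) by (auto simp: Lx_def)
  then show ?thesis using that[OF N(1,2)] adequate_univ[OF N(1-3)] by blast
qed

lemma star_Borel_FS: assumes "\<mu> \<in> FS" shows "star_Borel L \<kappa> M x mul \<mu> \<nu>"
  unfolding star_Borel_def
proof
  fix \<phi> :: "('s, 'f, 'r, 'a) fm" assume "\<phi> \<in> Lx L x (univ M)"
  then obtain N where "elem_sub L N M" "small \<kappa> N" "adequate (univ N) \<phi>" using small_submodel2 by metis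
  then show "\<exists>N. star_Borel_over L \<kappa> M x mul \<mu> \<nu> \<phi> N" using star_Borel_over_adequate[OF assms] by blast
qed

context
  fixes \<nu> :: "('s, 'f, 'r, 'a) fm \<Rightarrow> real"
  assumes \<nu>: "\<nu> \<in> FS"
begin

lemma borel_over_facts:
  assumes A: "A \<subseteq> univ M"
  shows "regular_borel_prob (type_space L M x A) (borel_over \<nu> A)" "sets (borel_over \<nu> A) = sets (borel_of (type_space L M x A))"
    "prob_space (borel_over \<nu> A)" "space (borel_over \<nu> A) = types L M x A"
    "supp_over \<nu> A \<in> sets (borel_over \<nu> A)" "measure (borel_over \<nu> A) (supp_over \<nu> A) = 1" "closedin (type_space L M x A) (supp_over \<nu> A)"
proof -
  note k = restrict_keisler[OF \<nu> A]
  show reg: "regular_borel_prob (type_space L M x A) (borel_over \<nu> A)" unfolding borel_over_def by (rule keisler_borel_regular[OF k])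
  show s: "sets (borel_over \<nu> A) = sets (borel_of (type_space L M x A))" "prob_space (borel_over \<nu> A)"
    using reg by (auto simp: regular_borel_prob_def)
  show "space (borel_over \<nu> A) = types L M x A" using sets_eq_imp_space_eq[OF s(1)] by simp
  show c: "closedin (type_space L M x A) (supp_over \<nu> A)" unfolding supp_over_def by (rule closedin_supp[OF k])
  show "supp_over \<nu> A \<in> sets (borel_over \<nu> A)" unfolding s by (rule borel_of_closedin[OF c])
  show "measure (borel_over \<nu> A) (supp_over \<nu> A) = 1" unfolding borel_over_def supp_over_def by (rule measure_supp[OF k])
qed

lemma AE_supp_over: assumes A: "A \<subseteq> univ M" shows "AE q in borel_over \<nu> A. q \<in> supp_over \<nu> A"
proof -
  interpret prob_space "borel_over \<nu> A" by (rule borel_over_facts(3)[OF A])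
  show ?thesis using borel_over_facts(5,6)[OF A] by (subst prob_eq_1[symmetric]) auto
qed

text \<open>
  The push-forward along restriction of types is regular and agrees with \<open>\<nu>\<close> on formulas, so uniqueness
  identifies it.
\<close>

lemma borel_over_distr:
  assumes AB: "A \<subseteq> B" and B: "B \<subseteq> univ M"
  shows "borel_over \<nu> A = distr (borel_over \<nu> B) (borel_of (type_space L M x A)) (\<lambda>p. p \<inter> Lx L x A)"
    and "(\<lambda>p. p \<inter> Lx L x A) \<in> borel_over \<nu> B \<rightarrow>\<^sub>M borel_of (type_space L M x A)"
proof -
  let ?r = "\<lambda>p. p \<inter> Lx L x A"
  have A: "A \<subseteq> univ M" using AB B by blast
  have c: "continuous_map (type_space L M x B) (type_space L M x A) ?r" by (rule continuous_map_restrict_type[OF AB])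
  show m: "?r \<in> borel_over \<nu> B \<rightarrow>\<^sub>M borel_of (type_space L M x A)"
    using continuous_map_borel_measurable[OF c] measurable_cong_sets[OF borel_over_facts(2)[OF B] refl] by blast
  have "distr (borel_over \<nu> B) (borel_of (type_space L M x A)) ?r = borel_over \<nu> A"
    unfolding borel_over_def[of \<nu> A]
  proof (rule keisler_borel_unique[OF restrict_keisler[OF \<nu> A]])
    show "regular_borel_prob (type_space L M x A) (distr (borel_over \<nu> B) (borel_of (type_space L M x A)) ?r)"
      by (rule regular_borel_prob_distr[OF borel_over_facts(1)[OF B] compact_TS Hausdorff_TS c])
    fix \<phi> assume \<phi>: "\<phi> \<in> Lx L x A"
    have \<phi>B: "\<phi> \<in> Lx L x B" using \<phi> Lx_mono[OF AB] by blast
    have "measure (distr (borel_over \<nu> B) (borel_of (type_space L M x A)) ?r) (basic_clopen L M x A \<phi>)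
      = measure (borel_over \<nu> B) (?r -` basic_clopen L M x A \<phi> \<inter> space (borel_over \<nu> B))"
      by (rule measure_distr[OF m borel_of_openin[OF openin_bc[OF \<phi>]]])
    also have "?r -` basic_clopen L M x A \<phi> \<inter> space (borel_over \<nu> B) = basic_clopen L M x B \<phi>"
      using types_restrict[OF _ AB, of _ L M x] \<phi> by (auto simp: borel_over_facts(4)[OF B] basic_clopen_def)
    also have "measure (borel_over \<nu> B) (basic_clopen L M x B \<phi>) = \<nu> \<phi>"
      unfolding borel_over_def using keisler_borel_bc[OF restrict_keisler[OF \<nu> B] \<phi>B] \<phi>B by simp
    finally show "measure (distr (borel_over \<nu> B) (borel_of (type_space L M x A)) ?r) (basic_clopen L M x A \<phi>) = restrict \<nu> (Lx L x A) \<phi>"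
      using \<phi> by simp
  qed
  then show "borel_over \<nu> A = distr (borel_over \<nu> B) (borel_of (type_space L M x A)) ?r" by simp
qed

definition integral_over :: "('s \<times> 'a) set \<Rightarrow> (('s, 'f, 'r, 'a) fm \<Rightarrow> real) \<Rightarrow> ('s, 'f, 'r, 'a) fm \<Rightarrow> real" where
  "integral_over A \<mu> \<phi> = integral\<^sup>L (restrict_space (borel_over \<nu> A) (supp_over \<nu> A)) (fibre M x mul \<mu> \<phi>)"

lemma star_over_measurable:
  assumes st: "star_Borel_over L \<kappa> M x mul \<mu> \<nu> \<phi> N"
  shows "(\<lambda>q. indicator (supp_over \<nu> (univ N)) q *\<^sub>R fibre M x mul \<mu> \<phi> q) \<in> borel_measurable (borel_over \<nu> (univ N))"
    and "integral_over (univ N) \<mu> \<phi> = (\<integral>q. indicator (supp_over \<nu> (univ N)) q *\<^sub>R fibre M x mul \<mu> \<phi> q \<partial>borel_over \<nu> (univ N))"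
proof -
  have N: "univ N \<subseteq> univ M" using st elem_sub_univ by (simp add: star_Borel_over_def)
  have S: "supp_over \<nu> (univ N) \<inter> space (borel_over \<nu> (univ N)) \<in> sets (borel_over \<nu> (univ N))" using borel_over_facts(5)[OF N] by auto
  have "sets (borel_of (subtopology (type_space L M x (univ N)) (supp_over \<nu> (univ N))))
    = sets (restrict_space (borel_over \<nu> (univ N)) (supp_over \<nu> (univ N)))"
    using sets_borel_of_subtopology[OF borel_of_closedin[OF borel_over_facts(7)[OF N]]] sets_restrict_space_cong[OF borel_over_facts(2)[OF N]] by simp
  moreover have "fibre M x mul \<mu> \<phi> \<in> borel_measurable (borel_of (subtopology (type_space L M x (univ N)) (supp_over \<nu> (univ N))))"
    using st unfolding star_Borel_over_def Let_def supp_over_def by blast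
  ultimately have "fibre M x mul \<mu> \<phi> \<in> borel_measurable (restrict_space (borel_over \<nu> (univ N)) (supp_over \<nu> (univ N)))"
    using measurable_cong_sets by blast
  then show "(\<lambda>q. indicator (supp_over \<nu> (univ N)) q *\<^sub>R fibre M x mul \<mu> \<phi> q) \<in> borel_measurable (borel_over \<nu> (univ N))"
    using borel_measurable_restrict_space_iff[OF S] by blast
  show "integral_over (univ N) \<mu> \<phi> = (\<integral>q. indicator (supp_over \<nu> (univ N)) q *\<^sub>R fibre M x mul \<mu> \<phi> q \<partial>borel_over \<nu> (univ N))"
    unfolding integral_over_def by (rule integral_restrict_space[OF S])
qed

text \<open>
  Restriction of types carries the measure of \<open>\<nu>\<close> over the larger model to the one over the smaller
  model, and on the supports the two integrands correspond: a realization of a type realizes its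
  restriction.
\<close>

lemma integral_over_independent:
  assumes st1: "star_Borel_over L \<kappa> M x mul \<mu> \<nu> \<phi> N1" and st3: "star_Borel_over L \<kappa> M x mul \<mu> \<nu> \<phi> N3"
    and sub: "univ N1 \<subseteq> univ N3"
  shows "integral_over (univ N1) \<mu> \<phi> = integral_over (univ N3) \<mu> \<phi>"
proof -
  let ?A = "univ N1" and ?B = "univ N3" and ?F = "fibre M x mul \<mu> \<phi>"
  let ?r = "\<lambda>p. p \<inter> Lx L x ?A"
  let ?g1 = "\<lambda>q. indicator (supp_over \<nu> ?A) q *\<^sub>R ?F q" and ?g3 = "\<lambda>q. indicator (supp_over \<nu> ?B) q *\<^sub>R ?F q"
  have N3: "elem_sub L N3 M" "small \<kappa> N3" using st3 by (auto simp: star_Borel_over_def)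
  have B: "?B \<subseteq> univ M" "|?B| <o \<kappa>" using elem_sub_univ[OF N3(1)] N3(2) by (auto simp: small_def)
  have A: "?A \<subseteq> univ M" using sub B by blast
  note m3 = star_over_measurable[OF st3] and m1 = star_over_measurable[OF st1]
  have wd: "\<mu> (translate x mul d \<phi>) = \<mu> (translate x mul d' \<phi>)"
    if "star_Borel_over L \<kappa> M x mul \<mu> \<nu> \<phi> N" "q \<in> supp_over \<nu> (univ N)" "realizes M x d q" "realizes M x d' q" for N q d d'
    using that unfolding star_Borel_over_def Let_def supp_over_def by blast
  have "?g1 (?r q) = ?g3 q" if q: "q \<in> supp_over \<nu> ?B" for q
  proof -
    have qt: "q \<in> types L M x ?B" using q by (simp add: supp_over_def supp_def)
    obtain d where d: "realizes M x d q" using realize_type[OF B qt] .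
    then have rd: "realizes M x d (?r q)" by (simp add: realizes_def)
    have rq: "?r q \<in> supp_over \<nu> ?A"
      using q types_restrict[OF qt sub] unfolding supp_over_iff by blast
    have "?F q = \<mu> (translate x mul d \<phi>)"
      unfolding fibre_def by (rule wd[OF st3 q someI[of "\<lambda>d. realizes M x d q", OF d] d])
    moreover have "?F (?r q) = \<mu> (translate x mul d \<phi>)"
      unfolding fibre_def by (rule wd[OF st1 rq someI[of "\<lambda>d. realizes M x d (?r q)", OF rd] rd])
    ultimately show ?thesis using q rq by simp
  qed
  then have ae: "AE q in borel_over \<nu> ?B. ?g1 (?r q) = ?g3 q" using AE_supp_over[OF B(1)] by (auto elim!: eventually_mono)
  have g1: "?g1 \<in> borel_measurable (borel_of (type_space L M x ?A))"
    using m1(1) measurable_cong_sets[OF borel_over_facts(2)[OF A] refl] by blast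
  have "integral_over ?A \<mu> \<phi> = (\<integral>q. ?g1 q \<partial>distr (borel_over \<nu> ?B) (borel_of (type_space L M x ?A)) ?r)"
    unfolding m1(2) borel_over_distr(1)[OF sub B(1)] ..
  also have "\<dots> = (\<integral>q. ?g1 (?r q) \<partial>borel_over \<nu> ?B)" by (rule integral_distr[OF borel_over_distr(2)[OF sub B(1)] g1])
  also have "\<dots> = (\<integral>q. ?g3 q \<partial>borel_over \<nu> ?B)"
    by (rule integral_cong_AE[OF measurable_compose[OF borel_over_distr(2)[OF sub B(1)] g1] m3(1) ae])
  also have "\<dots> = integral_over ?B \<mu> \<phi>" unfolding m3(2) ..
  finally show ?thesis .
qed

lemma integral_over_adequate:
  assumes \<mu>: "\<mu> \<in> FS" and N: "elem_sub L N M" "small \<kappa> N" and b: "adequate (univ N) \<phi>"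
  shows "integral_over (univ N) \<mu> \<phi> = (\<integral>q. fibre M x mul \<mu> \<phi> q \<partial>borel_over \<nu> (univ N))"
proof -
  have A: "univ N \<subseteq> univ M" using elem_sub_univ[OF N(1)] .
  note st = star_over_measurable[OF star_Borel_over_adequate[OF \<mu> N b, of \<nu>]]
  have F: "fibre M x mul \<mu> \<phi> \<in> borel_measurable (borel_over \<nu> (univ N))"
    using fibre_borel[OF \<mu> b] measurable_cong_sets[OF borel_over_facts(2)[OF A] refl] by blast
  show ?thesis unfolding st(2)
    by (rule integral_cong_AE[OF st(1) F]) (use AE_supp_over[OF A] in \<open>auto elim!: eventually_mono\<close>)
qed

text \<open>
  The model chosen in the definition of the convolution depends on \<open>\<mu>\<close>. Comparing it with \<open>N\<close> through a
  common extension allows one \<open>N\<close> to be used for all \<open>\<mu>\<close>.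
\<close>

lemma conv_eq:
  assumes \<mu>: "\<mu> \<in> FS" and N: "elem_sub L N M" "small \<kappa> N" and b: "adequate (univ N) \<phi>"
  shows "conv L \<kappa> M x mul \<mu> \<nu> \<phi> = (\<integral>q. fibre M x mul \<mu> \<phi> q \<partial>borel_over \<nu> (univ N))"
proof -
  define N1 where "N1 = (SOME N. star_Borel_over L \<kappa> M x mul \<mu> \<nu> \<phi> N)"
  have stN: "star_Borel_over L \<kappa> M x mul \<mu> \<nu> \<phi> N" by (rule star_Borel_over_adequate[OF \<mu> N b])
  then have st1: "star_Borel_over L \<kappa> M x mul \<mu> \<nu> \<phi> N1" unfolding N1_def by (rule someI)
  then have N1: "elem_sub L N1 M" "small \<kappa> N1" by (auto simp: star_Borel_over_def)
  have "univ N1 \<union> univ N \<subseteq> univ M" "|univ N1 \<union> univ N| <o \<kappa>"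
    using elem_sub_univ[OF N1(1)] elem_sub_univ[OF N(1)] N1(2) N(2) less_\<kappa>_Un by (auto simp: small_def)
  then obtain N3 where N3: "elem_sub L N3 M" "small \<kappa> N3" "univ G \<subseteq> univ N3" "univ N1 \<union> univ N \<subseteq> univ N3"
    by (rule small_submodel)
  have "\<phi> \<in> Lx L x (univ N3)" using b N3(4) Lx_mono[of "univ N" "univ N3" L x] unfolding adequate_def by blast
  then have b3: "adequate (univ N3) \<phi>" by (rule adequate_univ[OF N3(1-3)])
  have st3: "star_Borel_over L \<kappa> M x mul \<mu> \<nu> \<phi> N3" by (rule star_Borel_over_adequate[OF \<mu> N3(1,2) b3])
  have "conv L \<kappa> M x mul \<mu> \<nu> \<phi> = integral_over (univ N1) \<mu> \<phi>"
    using star_Borel_FS[OF \<mu>, of \<nu>] univ_Lx[OF b]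
    by (simp add: conv_def Let_def N1_def integral_over_def borel_over_def supp_over_def)
  also have "\<dots> = integral_over (univ N3) \<mu> \<phi>" using N3(4) by (intro integral_over_independent[OF st1 st3]) blast
  also have "\<dots> = integral_over (univ N) \<mu> \<phi>" using N3(4) by (intro integral_over_independent[OF stN st3, symmetric]) blast
  also have "\<dots> = (\<integral>q. fibre M x mul \<mu> \<phi> q \<partial>borel_over \<nu> (univ N))" by (rule integral_over_adequate[OF \<mu> N b])
  finally show ?thesis .
qed

lemma fibre_range:
  assumes \<mu>: "\<mu> \<in> FS" and b: "adequate A \<phi>" and q: "q \<in> types L M x A"
  shows "0 \<le> fibre M x mul \<mu> \<phi> q" "fibre M x mul \<mu> \<phi> q \<le> 1"
proof -
  obtain d where d: "realizes M x d q" "d \<in> dom M (fst x)" using adequate_realize[OF b q] .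
  note t = translate_univ[OF univ_Lx[OF b] d(2)]
  show "0 \<le> fibre M x mul \<mu> \<phi> q" "fibre M x mul \<mu> \<phi> q \<le> 1"
    unfolding fibre_eq[OF \<mu> b q d(1)] using keislerD(1,2)[OF FS_keisler[OF \<mu>] t] by auto
qed

lemma fibre_integrable:
  assumes \<mu>: "\<mu> \<in> FS" and b: "adequate A \<phi>"
  shows "integrable (borel_over \<nu> A) (fibre M x mul \<mu> \<phi>)"
proof -
  have A: "A \<subseteq> univ M" using b by (simp add: adequate_def)
  interpret prob_space "borel_over \<nu> A" by (rule borel_over_facts(3)[OF A])
  show ?thesis
  proof (rule integrable_const_bound[of _ 1])
    show "AE q in borel_over \<nu> A. norm (fibre M x mul \<mu> \<phi> q) \<le> 1"
      using fibre_range[OF \<mu> b] by (intro AE_I2) (simp add: borel_over_facts(4)[OF A])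
    show "fibre M x mul \<mu> \<phi> \<in> borel_measurable (borel_over \<nu> A)"
      using fibre_borel[OF \<mu> b] measurable_cong_sets[OF borel_over_facts(2)[OF A] refl] by blast
  qed
qed

lemma conv_FS: assumes \<mu>: "\<mu> \<in> FS" shows "conv L \<kappa> M x mul \<mu> \<nu> \<in> FS"
proof -
  let ?c = "conv L \<kappa> M x mul \<mu> \<nu>" and ?Lx = "Lx L x (univ M)"
  note k = FS_keisler[OF \<mu>]
  have ext: "?c \<in> extensional ?Lx"
    using star_Borel_FS[OF \<mu>, of \<nu>] by (simp add: conv_def)
  have two: "?c \<phi> = (\<integral>q. fibre M x mul \<mu> \<phi> q \<partial>borel_over \<nu> (univ N))" "?c \<psi> = (\<integral>q. fibre M x mul \<mu> \<psi> q \<partial>borel_over \<nu> (univ N))"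
    if "elem_sub L N M" "small \<kappa> N" "adequate (univ N) \<phi>" "adequate (univ N) \<psi>" for N \<phi> \<psi>
    using conv_eq[OF \<mu> that(1,2)] that by auto
  have range: "?c \<phi> \<in> {0..1}" if \<phi>: "\<phi> \<in> ?Lx" for \<phi>
  proof -
    obtain N where N: "elem_sub L N M" "small \<kappa> N" "adequate (univ N) \<phi>" using small_submodel2[OF \<phi> \<phi>] .
    have A: "univ N \<subseteq> univ M" using elem_sub_univ[OF N(1)] .
    interpret prob_space "borel_over \<nu> (univ N)" by (rule borel_over_facts(3)[OF A])
    have "0 \<le> (\<integral>q. fibre M x mul \<mu> \<phi> q \<partial>borel_over \<nu> (univ N))"
      by (rule Bochner_Integration.integral_nonneg) (use fibre_range(1)[OF \<mu> N(3)] borel_over_facts(4)[OF A] in auto)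
    moreover have "(\<integral>q. fibre M x mul \<mu> \<phi> q \<partial>borel_over \<nu> (univ N)) \<le> 1"
      by (rule integral_le_const[OF fibre_integrable[OF \<mu> N(3)]]) (use fibre_range(2)[OF \<mu> N(3)] borel_over_facts(4)[OF A] in \<open>auto intro!: AE_I2\<close>)
    ultimately show ?thesis using conv_eq[OF \<mu> N] by simp
  qed
  have eq: "?c \<phi> = ?c \<psi>" if \<phi>: "\<phi> \<in> ?Lx" and \<psi>: "\<psi> \<in> ?Lx" and sol: "sol M x \<phi> = sol M x \<psi>" for \<phi> \<psi>
  proof -
    obtain N where N: "elem_sub L N M" "small \<kappa> N" "adequate (univ N) \<phi>" "adequate (univ N) \<psi>" using small_submodel2[OF \<phi> \<psi>] .
    have A: "univ N \<subseteq> univ M" using elem_sub_univ[OF N(1)] .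
    show ?thesis unfolding two(1)[OF N] two(2)[OF N]
    proof (rule Bochner_Integration.integral_cong[OF refl])
      fix q assume "q \<in> space (borel_over \<nu> (univ N))"
      then have q: "q \<in> types L M x (univ N)" by (simp add: borel_over_facts(4)[OF A])
      obtain d where d: "realizes M x d q" "d \<in> dom M (fst x)" using adequate_realize[OF N(3) q] .
      have "sol M x (translate x mul d \<phi>) = sol M x (translate x mul d \<psi>)" unfolding sol_translate[OF d(2)] sol ..
      then show "fibre M x mul \<mu> \<phi> q = fibre M x mul \<mu> \<psi> q"
        unfolding fibre_eq[OF \<mu> N(3) q d(1)] fibre_eq[OF \<mu> N(4) q d(1)]
        by (intro keislerD(3)[OF k] translate_univ \<phi> \<psi> d(2))
    qed
  qed
  have one: "?c \<phi> = 1" if \<phi>: "\<phi> \<in> ?Lx" and sol: "sol M x \<phi> = dom M (fst x)" for \<phi>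
  proof -
    obtain N where N: "elem_sub L N M" "small \<kappa> N" "adequate (univ N) \<phi>" using small_submodel2[OF \<phi> \<phi>] .
    have A: "univ N \<subseteq> univ M" using elem_sub_univ[OF N(1)] .
    interpret prob_space "borel_over \<nu> (univ N)" by (rule borel_over_facts(3)[OF A])
    have "(\<integral>q. fibre M x mul \<mu> \<phi> q \<partial>borel_over \<nu> (univ N)) = (\<integral>q. 1 \<partial>borel_over \<nu> (univ N))"
    proof (rule Bochner_Integration.integral_cong[OF refl])
      fix q assume "q \<in> space (borel_over \<nu> (univ N))"
      then have q: "q \<in> types L M x (univ N)" by (simp add: borel_over_facts(4)[OF A])
      obtain d where d: "realizes M x d q" "d \<in> dom M (fst x)" using adequate_realize[OF N(3) q] .
      have "sol M x (translate x mul d \<phi>) = dom M (fst x)"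
        unfolding sol_translate[OF d(2)] sol using mul_dom[OF _ d(2)] by blast
      then show "fibre M x mul \<mu> \<phi> q = 1"
        unfolding fibre_eq[OF \<mu> N(3) q d(1)] by (intro keislerD(4)[OF k] translate_univ \<phi> d(2))
    qed
    then show ?thesis unfolding conv_eq[OF \<mu> N] using prob_space by simp
  qed
  have add: "?c (Or \<phi> \<psi>) = ?c \<phi> + ?c \<psi>" if \<phi>: "\<phi> \<in> ?Lx" and \<psi>: "\<psi> \<in> ?Lx" and dis: "sol M x \<phi> \<inter> sol M x \<psi> = {}" for \<phi> \<psi>
  proof -
    obtain N where N: "elem_sub L N M" "small \<kappa> N" "adequate (univ N) \<phi>" "adequate (univ N) \<psi>" using small_submodel2[OF \<phi> \<psi>] .
    have A: "univ N \<subseteq> univ M" using elem_sub_univ[OF N(1)] .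
    have bO: "adequate (univ N) (Or \<phi> \<psi>)" using N(3,4) by (simp add: adequate_def)
    have "(\<integral>q. fibre M x mul \<mu> (Or \<phi> \<psi>) q \<partial>borel_over \<nu> (univ N)) = (\<integral>q. fibre M x mul \<mu> \<phi> q + fibre M x mul \<mu> \<psi> q \<partial>borel_over \<nu> (univ N))"
    proof (rule Bochner_Integration.integral_cong[OF refl])
      fix q assume "q \<in> space (borel_over \<nu> (univ N))"
      then have q: "q \<in> types L M x (univ N)" by (simp add: borel_over_facts(4)[OF A])
      obtain d where d: "realizes M x d q" "d \<in> dom M (fst x)" using adequate_realize[OF N(3) q] .
      have "sol M x (translate x mul d \<phi>) \<inter> sol M x (translate x mul d \<psi>) = {}"
        unfolding sol_translate[OF d(2)] using dis by blast
      then have "\<mu> (Or (translate x mul d \<phi>) (translate x mul d \<psi>)) = \<mu> (translate x mul d \<phi>) + \<mu> (translate x mul d \<psi>)"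
        by (intro keislerD(5)[OF k] translate_univ \<phi> \<psi> d(2))
      moreover have "translate x mul d (Or \<phi> \<psi>) = Or (translate x mul d \<phi>) (translate x mul d \<psi>)"
        by (simp add: translate_def)
      ultimately show "fibre M x mul \<mu> (Or \<phi> \<psi>) q = fibre M x mul \<mu> \<phi> q + fibre M x mul \<mu> \<psi> q"
        unfolding fibre_eq[OF \<mu> N(3) q d(1)] fibre_eq[OF \<mu> N(4) q d(1)] fibre_eq[OF \<mu> bO q d(1)] by simp
    qed
    also have "\<dots> = ?c \<phi> + ?c \<psi>" unfolding two(1)[OF N] two(2)[OF N]
      by (rule Bochner_Integration.integral_add[OF fibre_integrable[OF \<mu> N(3)] fibre_integrable[OF \<mu> N(4)]])
    finally show ?thesis unfolding conv_eq[OF \<mu> N(1,2) bO] .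
  qed
  have fs: "\<exists>a\<in>dom G (fst x). a \<in> sol M x \<phi>" if \<phi>: "\<phi> \<in> ?Lx" and pos: "?c \<phi> > 0" for \<phi>
  proof -
    obtain N where N: "elem_sub L N M" "small \<kappa> N" "adequate (univ N) \<phi>" using small_submodel2[OF \<phi> \<phi>] .
    have A: "univ N \<subseteq> univ M" using elem_sub_univ[OF N(1)] .
    have "\<exists>q\<in>supp_over \<nu> (univ N). fibre M x mul \<mu> \<phi> q > 0"
    proof (rule ccontr)
      assume "\<not> ?thesis"
      then have "AE q in borel_over \<nu> (univ N). fibre M x mul \<mu> \<phi> q \<le> 0"
        using AE_supp_over[OF A] by (auto elim!: eventually_mono simp: not_less)
      then have "AE q in borel_over \<nu> (univ N). 0 \<le> - fibre M x mul \<mu> \<phi> q" by (auto elim!: eventually_mono)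
      then have "0 \<le> (\<integral>q. - fibre M x mul \<mu> \<phi> q \<partial>borel_over \<nu> (univ N))" by (rule integral_nonneg_AE)
      then show False using pos unfolding conv_eq[OF \<mu> N] by simp
    qed
    then obtain q where qS: "q \<in> supp_over \<nu> (univ N)" and qpos: "fibre M x mul \<mu> \<phi> q > 0" by blast
    have q: "q \<in> types L M x (univ N)" using qS by (simp add: supp_over_def supp_def)
    obtain d where d: "realizes M x d q" "d \<in> dom M (fst x)" using adequate_realize[OF N(3) q] .
    obtain a where a: "a \<in> dom G (fst x)" "a \<in> sol M x (translate x mul d \<phi>)"
      using FS_sat[OF \<mu> translate_univ[OF \<phi> d(2)]] qpos unfolding fibre_eq[OF \<mu> N(3) q d(1)] by blast
    have aM: "a \<in> dom M (fst x)" using a(1) dom_G_M by blast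
    have lL: "left_translate x mul a \<phi> \<in> Lx L x (univ N)" by (rule left_translate_adequate[OF N(3) a(1)])
    have "d \<in> sol M x (left_translate x mul a \<phi>)"
      using a(2) d(2) unfolding sol_translate[OF d(2)] sol_left_translate[OF aM] by blast
    then have "left_translate x mul a \<phi> \<in> q" using realizes_iff[OF q d(1) lL] by simp
    then have "\<nu> (left_translate x mul a \<phi>) > 0" using qS lL by (auto simp: supp_over_def supp_def)
    moreover have "left_translate x mul a \<phi> \<in> ?Lx" using lL Lx_mono[OF A] by blast
    ultimately obtain b where b: "b \<in> dom G (fst x)" "b \<in> sol M x (left_translate x mul a \<phi>)" using FS_sat[OF \<nu>] by blast
    then have "fn M mul [a, b] \<in> sol M x \<phi>" unfolding sol_left_translate[OF aM] by blast
    then show ?thesis using G_mul[OF a(1) b(1)] by blast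
  qed
  have "?c \<in> ?Lx \<rightarrow>\<^sub>E {0..1}" using ext range by (simp add: PiE_def Pi_def)
  then show ?thesis using eq one add fs unfolding fin_sat_measures_def keisler_def by blast
qed

text \<open>
  Let \<open>r\<close> be a sample of types approximating \<open>\<nu>\<close> on all the sets \<open>true_set A \<phi> p\<close>, and \<open>d\<close> realizations of it.
  Given \<open>\<mu>\<close>, replace the integrand by an average of indicators of such sets, integrate each by its
  frequency on \<open>r\<close>, and return from the average to the integrand at the points of \<open>r\<close>; each of the
  three steps costs \<open>\<epsilon> / 3\<close>.
\<close>

lemma conv_approx_by_points:
  assumes \<phi>: "\<phi> \<in> Lx L x (univ M)" and \<epsilon>: "\<epsilon> > 0"
  obtains n :: nat and d where "n > 0" "\<And>i. i < n \<Longrightarrow> d i \<in> dom M (fst x)"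
    "\<And>\<mu>. \<mu> \<in> FS \<Longrightarrow> \<bar>conv L \<kappa> M x mul \<mu> \<nu> \<phi> - (\<Sum>i<n. \<mu> (translate x mul (d i) \<phi>)) / n\<bar> \<le> \<epsilon>"
proof -
  obtain N where N: "elem_sub L N M" "small \<kappa> N" "adequate (univ N) \<phi>" using small_submodel2[OF \<phi> \<phi>] .
  define A where "A = univ N"
  have b: "adequate A \<phi>" using N by (simp add: A_def)
  have A: "A \<subseteq> univ M" using elem_sub_univ[OF N(1)] by (simp add: A_def)
  let ?X = "type_space L M x A" and ?P = "borel_over \<nu> A"
  let ?F = "\<lambda>g. basic_clopen L M x A (left_translate x mul g \<phi>)"
  interpret P: prob_space ?P by (rule borel_over_facts(3)[OF A])
  obtain m where m: "VC_dim_le m (types L M x A) (?F ` dom G (fst x))" by (rule VC_left_translates[OF b])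
  then have VC: "VC_dim_le m (topspace ?X) (?F ` dom G (fst x))" by simp
  have e3: "\<epsilon> / 3 > 0" using \<epsilon> by simp
  obtain n :: nat and r where nr: "n > 0" "r ` {..<n} \<subseteq> topspace ?X"
    "\<And>B. \<lbrakk>B \<in> sets ?P; \<And>Q. \<lbrakk>finite Q; Q \<subseteq> topspace ?X\<rbrakk> \<Longrightarrow> \<exists>g\<in>dom G (fst x). ?F g \<inter> Q = B \<inter> Q\<rbrakk>
      \<Longrightarrow> \<bar>measure ?P B - frequency B n r\<bar> \<le> \<epsilon> / 3"
  proof (rule uniform_approx_pointwise_closure[OF compact_TS Hausdorff_TS borel_over_facts(1)[OF A] _ _ VC e3])
    fix g assume "g \<in> dom G (fst x)"
    note l = left_translate_adequate[OF b this]
    show "openin ?X (?F g)" by (rule openin_bc[OF l])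
    show "closedin ?X (?F g)" by (rule closedin_bc[OF l])
  qed blast
  have TS: "true_set A \<phi> p \<in> sets ?P" "\<bar>measure ?P (true_set A \<phi> p) - frequency (true_set A \<phi> p) n r\<bar> \<le> \<epsilon> / 3" if p: "p \<in> coheirs" for p
  proof -
    show s: "true_set A \<phi> p \<in> sets ?P" using true_set_borel[OF b p] borel_over_facts(2)[OF A] by simp
    show "\<bar>measure ?P (true_set A \<phi> p) - frequency (true_set A \<phi> p) n r\<bar> \<le> \<epsilon> / 3"
    proof (rule nr(3)[OF s])
      fix Q assume Q: "finite Q" "Q \<subseteq> topspace ?X"
      then have Qt: "q \<in> types L M x A" if "q \<in> Q" for q using that by auto
      have "\<exists>d. realizes M x d q \<and> d \<in> dom M (fst x)" if "q \<in> Q" for q using adequate_realize[OF b Qt[OF that]] by blast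
      then obtain d where d: "\<And>q. q \<in> Q \<Longrightarrow> realizes M x (d q) q" "\<And>q. q \<in> Q \<Longrightarrow> d q \<in> dom M (fst x)" by metis
      define th where "th q = (if translate x mul (d q) \<phi> \<in> p then translate x mul (d q) \<phi> else Neg (translate x mul (d q) \<phi>))" for q
      have "th ` Q \<subseteq> p"
        using types_Neg[OF coheirsD(1)[OF p] translate_univ[OF \<phi> d(2)]] by (auto simp: th_def)
      then obtain g where g: "g \<in> dom G (fst x)" "\<forall>\<theta>\<in>th ` Q. g \<in> sol M x \<theta>"
        using fin_satD[OF coheirsD(2)[OF p], of "th ` Q"] Q(1) by blast
      have gM: "g \<in> dom M (fst x)" using g(1) dom_G_M by blast
      have "q \<in> ?F g \<longleftrightarrow> q \<in> true_set A \<phi> p" if q: "q \<in> Q" for q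
      proof -
        have "q \<in> ?F g \<longleftrightarrow> d q \<in> sol M x (left_translate x mul g \<phi>)"
          using realizes_iff[OF Qt[OF q] d(1)[OF q] left_translate_adequate[OF b g(1)]] Qt[OF q] by (simp add: basic_clopen_def)
        also have "\<dots> \<longleftrightarrow> g \<in> sol M x (translate x mul (d q) \<phi>)"
          unfolding sol_left_translate[OF gM] sol_translate[OF d(2)[OF q]] using gM d(2)[OF q] by blast
        also have "\<dots> \<longleftrightarrow> translate x mul (d q) \<phi> \<in> p"
        proof -
          have "g \<in> sol M x (th q)" using g(2) q by blast
          then show ?thesis by (auto simp: th_def sol_Neg split: if_splits)
        qed
        also have "\<dots> \<longleftrightarrow> q \<in> true_set A \<phi> p" using true_set_iff[OF p b Qt[OF q] d(1)[OF q]] by simp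
        finally show ?thesis .
      qed
      then show "\<exists>g\<in>dom G (fst x). ?F g \<inter> Q = true_set A \<phi> p \<inter> Q" using g(1) by blast
    qed
  qed
  have rt: "r i \<in> types L M x A" if "i < n" for i using nr(2) that by auto
  have "\<exists>d. realizes M x d (r i) \<and> d \<in> dom M (fst x)" if "i < n" for i using adequate_realize[OF b rt[OF that]] by blast
  then obtain d where d: "\<And>i. i < n \<Longrightarrow> realizes M x (d i) (r i)" "\<And>i. i < n \<Longrightarrow> d i \<in> dom M (fst x)" by metis
  show ?thesis
  proof (rule that[OF nr(1) d(2)])
    fix \<mu> assume \<mu>: "\<mu> \<in> FS"
    let ?f = "fibre M x mul \<mu> \<phi>"
    obtain k :: nat and Pt where k: "k > 0" "\<And>j. j < k \<Longrightarrow> Pt j \<in> coheirs"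
      "\<And>q. q \<in> types L M x A \<Longrightarrow> \<bar>?f q - (\<Sum>j<k. indicator (true_set A \<phi> (Pt j)) q) / k\<bar> \<le> \<epsilon> / 3"
      by (rule fibre_by_types[OF \<mu> b e3]) blast
    let ?T = "\<lambda>j. true_set A \<phi> (Pt j)"
    let ?s = "\<lambda>q. (\<Sum>j<k. indicator (?T j) q) / real k"
    have ints: "integrable ?P (\<lambda>q. indicator (?T j) q :: real)" if "j < k" for j
      using TS(1)[OF k(2)[OF that]] by (intro integrable_real_indicator) (auto simp: P.emeasure_eq_measure)
    have int_s: "integrable ?P ?s" using ints by (intro integrable_divide Bochner_Integration.integrable_sum) auto
    have "(\<integral>q. ?s q \<partial>?P) = (\<Sum>j<k. measure ?P (?T j)) / k"
    proof -
      have "(\<integral>q. indicator (?T j) q \<partial>?P) = measure ?P (?T j)" if "j < k" for j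
        using sets.sets_into_space[OF TS(1)[OF k(2)[OF that]]] by (simp add: Int_absorb2)
      then show ?thesis using ints by (simp add: Bochner_Integration.integral_sum)
    qed
    moreover have "\<bar>(\<integral>q. ?f q \<partial>?P) - (\<integral>q. ?s q \<partial>?P)\<bar> \<le> \<epsilon> / 3"
    proof -
      have "(\<integral>q. ?f q \<partial>?P) - (\<integral>q. ?s q \<partial>?P) = (\<integral>q. ?f q - ?s q \<partial>?P)"
        by (rule Bochner_Integration.integral_diff[OF fibre_integrable[OF \<mu> b] int_s, symmetric])
      also have "\<bar>\<dots>\<bar> \<le> (\<integral>q. \<bar>?f q - ?s q\<bar> \<partial>?P)" by (rule integral_abs_bound)
      also have "\<dots> \<le> \<epsilon> / 3"
      proof (rule P.integral_le_const)
        show "integrable ?P (\<lambda>q. \<bar>?f q - ?s q\<bar>)"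
          using fibre_integrable[OF \<mu> b] int_s by (intro integrable_abs Bochner_Integration.integrable_diff)
        show "AE q in ?P. \<bar>?f q - ?s q\<bar> \<le> \<epsilon> / 3" using k(3) by (intro AE_I2) (simp add: borel_over_facts(4)[OF A])
      qed
      finally show ?thesis .
    qed
    moreover have "\<bar>(\<Sum>j<k. measure ?P (?T j)) / k - (\<Sum>j<k. frequency (?T j) n r) / k\<bar> \<le> \<epsilon> / 3"
    proof -
      have "\<bar>(\<Sum>j<k. measure ?P (?T j) - frequency (?T j) n r)\<bar> \<le> (\<Sum>j<k. \<bar>measure ?P (?T j) - frequency (?T j) n r\<bar>)" by (rule sum_abs)
      also have "\<dots> \<le> (\<Sum>j<k. \<epsilon> / 3)" using TS(2)[OF k(2)] by (intro sum_mono) auto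
      finally have "\<bar>(\<Sum>j<k. measure ?P (?T j)) - (\<Sum>j<k. frequency (?T j) n r)\<bar> \<le> k * (\<epsilon> / 3)" by (simp add: sum_subtractf)
      then have "\<bar>((\<Sum>j<k. measure ?P (?T j)) - (\<Sum>j<k. frequency (?T j) n r)) / k\<bar> \<le> \<epsilon> / 3"
        using k(1) by (simp add: abs_divide pos_divide_le_eq mult.commute)
      then show ?thesis by (simp add: diff_divide_distrib)
    qed
    moreover have "(\<Sum>j<k. frequency (?T j) n r) / k = (\<Sum>i<n. ?s (r i)) / n"
    proof -
      have "(\<Sum>j<k. frequency (?T j) n r) = (\<Sum>i<n. \<Sum>j<k. indicator (?T j) (r i)) / n"
        unfolding frequency_def sum_divide_distrib[symmetric] by (subst sum.swap) simp
      then show ?thesis by (simp add: sum_divide_distrib[symmetric] mult.commute)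
    qed
    moreover have "\<bar>(\<Sum>i<n. ?s (r i)) / n - (\<Sum>i<n. \<mu> (translate x mul (d i) \<phi>)) / n\<bar> \<le> \<epsilon> / 3"
    proof -
      have "\<bar>(\<Sum>i<n. ?s (r i) - \<mu> (translate x mul (d i) \<phi>))\<bar> \<le> (\<Sum>i<n. \<bar>?s (r i) - \<mu> (translate x mul (d i) \<phi>)\<bar>)" by (rule sum_abs)
      also have "\<dots> \<le> (\<Sum>i<n. \<epsilon> / 3)"
      proof (rule sum_mono)
        fix i assume "i \<in> {..<n}"
        then have i: "i < n" by simp
        show "\<bar>?s (r i) - \<mu> (translate x mul (d i) \<phi>)\<bar> \<le> \<epsilon> / 3"
          using k(3)[OF rt[OF i]] unfolding fibre_eq[OF \<mu> b rt[OF i] d(1)[OF i]] by (simp add: abs_minus_commute)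
      qed
      finally have "\<bar>(\<Sum>i<n. ?s (r i)) - (\<Sum>i<n. \<mu> (translate x mul (d i) \<phi>))\<bar> \<le> n * (\<epsilon> / 3)" by (simp add: sum_subtractf)
      then have "\<bar>((\<Sum>i<n. ?s (r i)) - (\<Sum>i<n. \<mu> (translate x mul (d i) \<phi>))) / n\<bar> \<le> \<epsilon> / 3"
        using nr(1) by (simp add: abs_divide pos_divide_le_eq mult.commute)
      then show ?thesis by (simp add: diff_divide_distrib)
    qed
    moreover have "conv L \<kappa> M x mul \<mu> \<nu> \<phi> = (\<integral>q. ?f q \<partial>?P)" unfolding A_def by (rule conv_eq[OF \<mu> N])
    ultimately show "\<bar>conv L \<kappa> M x mul \<mu> \<nu> \<phi> - (\<Sum>i<n. \<mu> (translate x mul (d i) \<phi>)) / n\<bar> \<le> \<epsilon>" by linarith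
  qed
qed

lemma topspace_fin_sat_space: "topspace (fin_sat_space L M x G) = FS"
  by (auto simp: fin_sat_space_def fin_sat_measures_def keisler_def)

lemma continuous_map_evaluation:
  assumes "\<psi> \<in> Lx L x (univ M)"
  shows "continuous_map (fin_sat_space L M x G) euclideanreal (\<lambda>\<mu>. \<mu> \<psi>)"
proof -
  have "continuous_map (product_topology (\<lambda>_. top_of_set {0..1::real}) (Lx L x (univ M))) (top_of_set {0..1}) (\<lambda>\<mu>. \<mu> \<psi>)"
    using assms by (intro continuous_map_product_projection)
  then have "continuous_map (fin_sat_space L M x G) (top_of_set {0..1}) (\<lambda>\<mu>. \<mu> \<psi>)"
    unfolding fin_sat_space_def by (rule continuous_map_from_subtopology)
  then show ?thesis by (rule continuous_map_into_fulltopology)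
qed

lemma continuous_map_conv:
  "continuous_map (fin_sat_space L M x G) (fin_sat_space L M x G) (\<lambda>\<mu>. conv L \<kappa> M x mul \<mu> \<nu>)"
proof -
  let ?Y = "fin_sat_space L M x G" and ?c = "\<lambda>\<mu>. conv L \<kappa> M x mul \<mu> \<nu>"
  have kc: "?c \<mu> \<in> keisler L M x (univ M)" if "\<mu> \<in> topspace ?Y" for \<mu>
    using FS_keisler[OF conv_FS] that by (simp add: topspace_fin_sat_space)
  have comp: "continuous_map ?Y (top_of_set {0..1}) (\<lambda>\<mu>. ?c \<mu> \<phi>)" if \<phi>: "\<phi> \<in> Lx L x (univ M)" for \<phi>
  proof -
    have "continuous_map ?Y euclideanreal (\<lambda>\<mu>. ?c \<mu> \<phi>)"
    proof (rule continuous_map_uniform_approx)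
      fix \<epsilon> :: real assume "\<epsilon> > 0"
      obtain n :: nat and d where nd: "n > 0" "\<And>i. i < n \<Longrightarrow> d i \<in> dom M (fst x)"
        "\<And>\<mu>. \<mu> \<in> FS \<Longrightarrow> \<bar>?c \<mu> \<phi> - (\<Sum>i<n. \<mu> (translate x mul (d i) \<phi>)) / n\<bar> \<le> \<epsilon>"
        by (rule conv_approx_by_points[OF \<phi> \<open>\<epsilon> > 0\<close>]) blast
      have "continuous_map ?Y euclideanreal (\<lambda>\<mu>. (\<Sum>i<n. \<mu> (translate x mul (d i) \<phi>)) * (1 / n))"
        using nd(2) by (intro continuous_map_real_mult_right continuous_map_sum continuous_map_evaluation translate_univ[OF \<phi>]) auto
      then show "\<exists>g. continuous_map ?Y euclideanreal g \<and> (\<forall>\<mu>\<in>topspace ?Y. \<bar>?c \<mu> \<phi> - g \<mu>\<bar> \<le> \<epsilon>)"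
        using nd(3) by (intro exI[of _ "\<lambda>\<mu>. (\<Sum>i<n. \<mu> (translate x mul (d i) \<phi>)) * (1 / n)"]) (simp add: topspace_fin_sat_space)
    qed
    moreover have "(\<lambda>\<mu>. ?c \<mu> \<phi>) \<in> topspace ?Y \<rightarrow> {0..1}"
      using keislerD(1,2)[OF kc \<phi>] by auto
    ultimately show ?thesis by (simp add: continuous_map_in_subtopology)
  qed
  have "continuous_map ?Y (product_topology (\<lambda>_. top_of_set {0..1}) (Lx L x (univ M))) ?c"
    unfolding continuous_map_componentwise using comp keislerD(6)[OF kc] by auto
  moreover have "?c \<in> topspace ?Y \<rightarrow> FS" using conv_FS by (auto simp: topspace_fin_sat_space)
  ultimately have "continuous_map ?Y (subtopology (product_topology (\<lambda>_. top_of_set {0..1}) (Lx L x (univ M))) FS) ?c"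
    by (simp add: continuous_map_in_subtopology)
  then show ?thesis by (simp only: fin_sat_space_def[symmetric])
qed

end

end

theorem proposition6p4:
  fixes L :: "('s, 'f, 'r) lang"
    and T :: "('s, 'f, 'r, 'a) fm set"
    and \<kappa> :: "'k rel"
    and \<G> G :: "('s, 'f, 'r, 'a) struc"
    and x :: "'s var"
    and mul :: 'f
    and \<nu> :: "('s, 'f, 'r, 'a) fm \<Rightarrow> real"
  assumes "is_theory L T"
    and "NIP L T"
    and "expands_group L T (fst x) mul"
    and "monster_model L T \<kappa> \<G>"
    and "elem_sub L G \<G>"
    and "small \<kappa> G"
    and "\<nu> \<in> fin_sat_measures L \<G> x G"
  shows "continuous_map (fin_sat_space L \<G> x G) (fin_sat_space L \<G> x G)
           (\<lambda>\<mu>. conv L \<kappa> \<G> x mul \<mu> \<nu>)"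
proof -
  have "fun_sig L mul = Some ([fst x, fst x], fst x)" using assms(3) by (simp add: expands_group_def)
  then interpret nip_group L T \<kappa> \<G> G x mul using assms by unfold_locales
  show ?thesis by (rule continuous_map_conv[OF assms(7)])
qed

end
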